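(* Let $\mathcal{C}$ be a covering of the plane by complete folding curves which satisfies the local isomorphism property. Then one of the two following properties is true: 1) $\mathcal{C}$ consists of $1$, $2$, $3$ or $4$ curves; 2) $\mathcal{C}$ consists of $6$ curves, and $\mathcal{C}$ is generated by a curve associated to the alternating folding sequence or to one of its primitives.
   Context: Curves and coverings. Identify $\mathbb{R}^2$ with $\mathbb{C}$ and $\mathbb{Z}^2$ with $\mathbb{Z}+i\mathbb{Z}$. To a sequence $(a_k)_{1\le k\le n-1}$, $(a_k)_{k\in\mathbb{N}^*}$ or $(a_k)_{k\in\mathbb{Z}}$ with all $a_k=\pm1$ are associated the curves $(C_k)_{1\le k\le n}$, $(C_k)_{k\in\mathbb{N}^*}$, $(C_k)_{k\in\mathbb{Z}}$ whose segments are oriented intervals $C_k=[x_k,x_k+\varepsilon_k]$ with $x_k\in\mathbb{Z}+i\mathbb{Z}$, $\varepsilon_k\in\{1,-1,i,-i\}$, and, whenever $C_k,C_{k+1}$ exist, $x_k+\varepsilon_k=x_{k+1}$ and $\varepsilon_{k+1}=i^{a_k}\varepsilon_k$. Curves are rounded at the points $x_{k+1}$ so that they do not pass through them (so curves sharing no unit interval are disjoint). Curves indexed by $\mathbb{Z}$ are called complete and are considered up to a shift of the index. A covering (of the plane) is a set of complete curves such that each nonoriented interval $[z,z+\varepsilon]$ with $z\in\mathbb{Z}+i\mathbb{Z}$, $\varepsilon\in\{1,i\}$ is the support of exactly one segment of exactly one of the curves. Orientation convention: for each $z=x+iy\in\mathbb{Z}+i\mathbb{Z}$, depending on the parity of $x+y$,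 the segments with endpoint $z$ are $[z,z+1],[z,z-1],[z+i,z],[z-i,z]$, or they are $[z+1,z],[z-1,z],[z,z+i],[z,z-i]$. Folding sequences. For a finite sequence $S=(a_1,\dots,a_m)$ put $\overline{S}=(-a_m,\dots,-a_1)$. The $0$-folding sequence is empty, and the $(n+1)$-folding sequences are the sequences $(\overline{S},\varepsilon,S)$ with $S$ an $n$-folding sequence and $\varepsilon=\pm1$. An $\infty$-folding sequence is a sequence $S=(a_k)_{k\in\mathbb{N}^*}$ such that $(a_1,\dots,a_{2^n-1})$ is an $n$-folding sequence for every $n$; it is determined by the values $a_{2^n}$, $n\in\mathbb{N}$, which can be arbitrary. A complete folding sequence is a sequence $(a_k)_{k\in\mathbb{Z}}$ in $\{\pm1\}$ such that each finite block $(a_{k+1},\dots,a_{k+l})$ is a block of consecutive terms of an $n$-folding sequence for some $n$. $\infty$-folding curves and complete folding curves are the curves associated to such sequences. The derivative of an $\infty$-folding sequence $(a_k)_{k\in\mathbb{N}^*}$ is $(a_{2k})_{k\in\mathbb{N}^*}$; a primitive of $S$ is an $\infty$-folding sequence one of whose successive derivatives is $S$. The alternating folding sequence is the $\infty$-folding sequence with $a_{2^n}=(-1)^n$ for each $n\in\mathbb{N}$. Local isomorphism. For sets of curves $\mathcal{B},\mathcal{C}$: $\mathcal{B}\cong\mathcal{C}$ means that $\mathcal{C}$ is the image of $\mathcal{B}$ under a translation; $\mathcal{B}<\mathcal{C}$ means that $\mathcal{B}\ne\mathcal{C}$, each curve of $\mathcal{B}$ is contained in (is a subcurve of) a curve of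 $\mathcal{C}$, and any consecutive segments of a curve of $\mathcal{C}$ which belong to curves of $\mathcal{B}$ are consecutive in one of them. A covering $\mathcal{C}$ satisfies the local isomorphism property if for each bounded set of curves (finitely many segments) $\mathcal{B}<\mathcal{C}$ there is $r>0$ such that every disc of radius $r$ contains some $\mathcal{B}'<\mathcal{C}$ with $\mathcal{B}'\cong\mathcal{B}$. Generation. A covering $\mathcal{C}$ by complete folding curves which satisfies the local isomorphism property is generated by an $\infty$-folding curve $D$ with initial point $x$ if, up to reversal of orientation, the four curves obtained from $D$ by the rotations of angles $0,\pi/2,\pi,3\pi/2$ around $x$ are subcurves of curves of $\mathcal{C}$ (they are then connected at $x$ into two complete curves of $\mathcal{C}$). *)

theory Defs
  imports "HOL-Analysis.Analysis" "HOL-Library.Sublist"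
begin

section \<open>Folding sequences\<close>

definition bar :: "int list \<Rightarrow> int list" where
  "bar S = rev (map uminus S)"

fun folding_seqs :: "nat \<Rightarrow> int list set" where
  "folding_seqs 0 = {[]}"
| "folding_seqs (Suc n) = {bar S @ [e] @ S | S e. S \<in> folding_seqs n \<and> e \<in> {1, -1}}"

text \<open>Sequences indexed by the positive integers are functions on \<^typ>\<open>nat\<close> whose value
  at 0 is irrelevant.\<close>

definition infty_folding :: "(nat \<Rightarrow> int) \<Rightarrow> bool" where
  "infty_folding S \<longleftrightarrow> (\<forall>n. map S [1..<2 ^ n] \<in> folding_seqs n)"

definition complete_folding :: "(int \<Rightarrow> int) \<Rightarrow> bool" where
  "complete_folding a \<longleftrightarrow>
    (\<forall>k. \<forall>l::nat. \<exists>n. \<exists>T\<in>folding_seqs n. sublist (map a [k + 1..k + int l]) T)"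

definition derivative :: "(nat \<Rightarrow> int) \<Rightarrow> nat \<Rightarrow> int" where
  "derivative S = (\<lambda>k. S (2 * k))"

definition primitive_of :: "(nat \<Rightarrow> int) \<Rightarrow> (nat \<Rightarrow> int) \<Rightarrow> bool" where
  "primitive_of T S \<longleftrightarrow>
    infty_folding T \<and> (\<exists>m\<ge>1. \<forall>k\<ge>1. (derivative ^^ m) T k = S k)"

definition alternating_folding :: "(nat \<Rightarrow> int) \<Rightarrow> bool" where
  "alternating_folding S \<longleftrightarrow> infty_folding S \<and> (\<forall>n. S (2 ^ n) = (-1) ^ n)"


section \<open>Curves\<close>

text \<open>The pair \<open>(x, e)\<close> is the oriented segment from \<open>x\<close> to \<open>x + e\<close>. A curve is a partial map
  from indices to segments. The rounding at the vertices is not modelled: which segments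
  are joined at a vertex is recorded by the indexing.\<close>

type_synonym segment = "complex \<times> complex"
type_synonym curve = "int \<rightharpoonup> segment"

definition lattice_pt :: "int \<Rightarrow> int \<Rightarrow> complex" where
  "lattice_pt x y = Complex (of_int x) (of_int y)"

definition lattice :: "complex set" where
  "lattice = {lattice_pt x y | x y. True}"

definition support :: "segment \<Rightarrow> complex set" where
  "support s = closed_segment (fst s) (fst s + snd s)"

text \<open>\<open>c\<close> is a curve with index set \<open>K\<close> associated to the sequence \<open>a\<close>; only the terms \<open>a k\<close>
  with \<open>k\<close> and \<open>k + 1\<close> in \<open>K\<close> matter.\<close>

definition associated_curve :: "int set \<Rightarrow> (int \<Rightarrow> int) \<Rightarrow> curve \<Rightarrow> bool" where
  "associated_curve K a c \<longleftrightarrow> dom c = K \<and>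
    (\<forall>k x e. c k = Some (x, e) \<longrightarrow> x \<in> lattice \<and> e \<in> {1, -1, \<i>, -\<i>}) \<and>
    (\<forall>k x e x' e'. c k = Some (x, e) \<and> c (k + 1) = Some (x', e') \<longrightarrow>
       a k \<in> {1, -1} \<and> x + e = x' \<and> e' = \<i> powi (a k) * e)"

definition finite_curve :: "curve \<Rightarrow> bool" where
  "finite_curve c \<longleftrightarrow> (\<exists>n\<ge>1. \<exists>a. associated_curve {1..n} a c)"

definition half_curve :: "curve \<Rightarrow> bool" where
  "half_curve c \<longleftrightarrow> (\<exists>a. associated_curve {1..} a c)"

definition complete_curve :: "curve \<Rightarrow> bool" where
  "complete_curve c \<longleftrightarrow> (\<exists>a. associated_curve UNIV a c)"

definition curves :: "curve set" where
  "curves = {c. finite_curve c \<or> half_curve c \<or> complete_curve c}"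

definition infty_curve_of :: "(nat \<Rightarrow> int) \<Rightarrow> curve \<Rightarrow> bool" where
  "infty_curve_of S D \<longleftrightarrow> associated_curve {1..} (\<lambda>k. S (nat k)) D"

definition complete_folding_curve :: "curve \<Rightarrow> bool" where
  "complete_folding_curve c \<longleftrightarrow> (\<exists>a. complete_folding a \<and> associated_curve UNIV a c)"

definition shift :: "int \<Rightarrow> curve \<Rightarrow> curve" where
  "shift s c = (\<lambda>k. c (k + s))"

definition subcurve :: "curve \<Rightarrow> curve \<Rightarrow> bool" where
  "subcurve b c \<longleftrightarrow> (\<exists>s. b \<subseteq>\<^sub>m shift s c)"

definition segments :: "curve set \<Rightarrow> segment set" where
  "segments \<B> = (\<Union>b\<in>\<B>. ran b)"

text \<open>Equality of sets of curves, each curve being considered up to a shift of the index.\<close>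

definition same_curves :: "curve set \<Rightarrow> curve set \<Rightarrow> bool" where
  "same_curves \<B> \<C> \<longleftrightarrow>
    (\<forall>b\<in>\<B>. \<exists>c\<in>\<C>. \<exists>s. b = shift s c) \<and> (\<forall>c\<in>\<C>. \<exists>b\<in>\<B>. \<exists>s. b = shift s c)"

definition translate :: "complex \<Rightarrow> curve \<Rightarrow> curve" where
  "translate t c = map_option (\<lambda>(x, e). (x + t, e)) \<circ> c"

text \<open>Rotation of angle \<open>j\<pi>/2\<close> around \<open>z\<close>.\<close>

definition rotate_curve :: "nat \<Rightarrow> complex \<Rightarrow> curve \<Rightarrow> curve" where
  "rotate_curve j z c = map_option (\<lambda>(x, e). (z + \<i> ^ j * (x - z), \<i> ^ j * e)) \<circ> c"

definition reverse_curve :: "curve \<Rightarrow> curve" where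
  "reverse_curve c = (\<lambda>k. map_option (\<lambda>(x, e). (x + e, - e)) (c (- k)))"


section \<open>Coverings\<close>

text \<open>The orientation convention: for one parity class of lattice points the horizontal segments
  leave and the vertical ones arrive; for the other class it is the opposite.\<close>

definition well_oriented :: "curve set \<Rightarrow> bool" where
  "well_oriented \<C> \<longleftrightarrow> (\<exists>p. \<forall>x y. let z = lattice_pt x y in
     {(u, e) \<in> segments \<C>. u = z \<or> u + e = z} =
       (if even (x + y) = p
        then {(z, 1), (z, -1), (z + \<i>, -\<i>), (z - \<i>, \<i>)}
        else {(z + 1, -1), (z - 1, 1), (z, \<i>), (z, -\<i>)}))"

text \<open>A covering is given by one indexed representative of each of its curves. Uniqueness of the
  pair \<open>(c, k)\<close> excludes two representatives of the same curve up to a shift, so the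
  number of curves is the cardinality of the set.\<close>

definition covering :: "curve set \<Rightarrow> bool" where
  "covering \<C> \<longleftrightarrow> (\<forall>c\<in>\<C>. complete_curve c) \<and>
    (\<forall>z\<in>lattice. \<forall>e\<in>{1, \<i>}. \<exists>!(c, k).
       c \<in> \<C> \<and> (\<exists>s. c k = Some s \<and> support s = closed_segment z (z + e))) \<and>
    well_oriented \<C>"


section \<open>Local isomorphism and generation\<close>

definition translation_equiv :: "curve set \<Rightarrow> curve set \<Rightarrow> bool" where
  "translation_equiv \<B> \<C> \<longleftrightarrow> (\<exists>t. same_curves (translate t ` \<B>) \<C>)"

text \<open>The relation \<open>\<B> < \<C>\<close>; its last clause is about runs \<open>c i, \<dots>, c j\<close> of consecutive segments.\<close>

definition precedes :: "curve set \<Rightarrow> curve set \<Rightarrow> bool" where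
  "precedes \<B> \<C> \<longleftrightarrow> \<not> same_curves \<B> \<C> \<and>
    (\<forall>b\<in>\<B>. \<exists>c\<in>\<C>. subcurve b c) \<and>
    (\<forall>c\<in>\<C>. \<forall>i j. i \<le> j \<and> (\<forall>k\<in>{i..j}. \<exists>s\<in>segments \<B>. c k = Some s) \<longrightarrow>
       (\<exists>b\<in>\<B>. \<exists>m. \<forall>k\<in>{i..j}. b (k + m) = c k))"

definition local_isomorphism :: "curve set \<Rightarrow> bool" where
  "local_isomorphism \<C> \<longleftrightarrow>
    (\<forall>\<B>\<subseteq>curves. finite (segments \<B>) \<and> precedes \<B> \<C> \<longrightarrow>
      (\<exists>r>0. \<forall>z. \<exists>\<B>'\<subseteq>curves. precedes \<B>' \<C> \<and> translation_equiv \<B> \<B>' \<and>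
         (\<Union>s\<in>segments \<B>'. support s) \<subseteq> cball z r))"

text \<open>Each of the four rotated curves may be reversed independently of the others: two of them
  leave the initial point in \<open>\<C>\<close> and two arrive there.\<close>

definition generated_by :: "curve set \<Rightarrow> curve \<Rightarrow> bool" where
  "generated_by \<C> D \<longleftrightarrow> (\<exists>x e. D 1 = Some (x, e) \<and>
    (\<forall>j<4. \<exists>c\<in>\<C>. subcurve (rotate_curve j x D) c \<or>
                  subcurve (reverse_curve (rotate_curve j x D)) c))"

end

theory Submission
  imports Defs
begin

text \<open>Edges are recorded by twice their midpoints and a covering by its curves, read as lattice paths
  \<open>X c\<close>. In a folding sequence the terms of one parity alternate, so a complete folding curve
  alternates at the vertices of one coset of \<open>(1 + \<i>)\<int>[\<i>]\<close> and its other vertices form a complete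
  folding curve on the lattice scaled by \<open>1 + \<i>\<close>. A folding curve contains all the edges in
  arbitrarily large discs, so by local isomorphism every patch of the covering recurs inside one
  curve; hence all the curves have the same coset and the same alternation, and the covering itself
  can be derived, again and again, with the same set of curves.

  Passing from an edge to the longer edge containing it contracts distances by \<open>\<surd>2\<close> up to a bounded
  error. If there are at least five curves, one edge in each of them, followed through the levels,
  ends up among 24 edges, and a finite search shows that these edges end up in a pinwheel: the four
  edges at a vertex that is kept at every level and four further edges, with turns next to that
  vertex that alternate from one level to the next. Two pinwheel edges of the same curve become
  consecutive, so they meet at the centre; thus the pinwheel meets exactly six curves, and the
  levels give the turns of the curves leaving the centre.\<close>

section \<open>Lattice points, edges and the two-to-one refinement\<close>

text \<open>One estimate drives both the contraction and the filling of discs. In doubled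
  coordinates the map from the next level back to the present one sends the parent of
  \<open>m\<close> to \<open>m\<close> plus a unit vector. Distances from a moving origin are
  therefore bounded by iterating \<open>d -> (d + 1) / sqrt 2\<close> upwards, and radii of filled
  discs by iterating \<open>rho -> sqrt 2 * rho - 1\<close> downwards. Both maps fix
  \<open>sqrt 2 + 1\<close>. Upwards this point attracts: finitely many edges end up hardly farther
  than that from the origin, and rounding the origin to a lattice point adds \<open>sqrt 2\<close>,
  so norms fall below \<open>sqrt 15\<close>. Downwards it repels: a filled disc of radius 2.8,
  obtained by a finite check, grows without bound. The obstacle to deriving the whole covering is a
  sign. The pairing of edges at a vertex that dies involves \<open>eps\<close> of its abscissa, so a
  copy translated by \<open>v\<close> obeys the rule of \<open>c0\<close> only up to
  \<open>eps (fst v)\<close>. A single sign is first fixed for arbitrarily large patches; applying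
  the same translations to \<open>c0\<close> itself shows that it is 1.\<close>

type_synonym pt = "int \<times> int"

definition sw :: "pt \<Rightarrow> pt" where "sw u = (snd u, fst u)"
definition rot :: "pt \<Rightarrow> pt" where "rot u = (- snd u, fst u)"
definition sc :: "int \<Rightarrow> pt \<Rightarrow> pt" where "sc s u = (s * fst u, s * snd u)"
definition units :: "pt set" where "units = {(1,0), (-1,0), (0,1), (0,-1)}"
definition eps :: "int \<Rightarrow> int" where "eps k = (if even k then 1 else -1)"
text \<open>\<open>surv p v\<close>: the vertex \<open>v\<close> is kept at the next level, whose point \<open>w\<close> is the point
  \<open>p + (1 + \<i>) w = up p w\<close> of the present level; \<open>dn\<close> is the inverse map. For doubled points the
  offset is \<open>2 * p\<close>.\<close>

definition surv :: "int \<Rightarrow> pt \<Rightarrow> bool" where "surv p v \<longleftrightarrow> even (fst v + snd v + p)"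
definition up :: "int \<Rightarrow> pt \<Rightarrow> pt" where "up p v = (p + fst v - snd v, fst v + snd v)"
definition dn :: "int \<Rightarrow> pt \<Rightarrow> pt" where
  "dn p v = ((fst v + snd v - p) div 2, (snd v - fst v + p) div 2)"
definition edge_pt :: "pt \<Rightarrow> bool" where "edge_pt m \<longleftrightarrow> odd (fst m + snd m)"

lemma dn_up [simp]: "dn p (up p v) = v"
  by (cases v) (simp add: dn_def up_def)

lemma up_dn: "surv p v \<Longrightarrow> up p (dn p v) = v"
proof (cases v)
  case (Pair x y)
  assume "surv p v"
  then have "2 dvd x + y + p" by (simp add: surv_def Pair)
  then obtain k where k: "x + y + p = 2 * k" by (rule dvdE)
  then have "x + y - p = 2 * (k - p)" "y - x + p = 2 * (k - x)" by simp_all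
  then show ?thesis unfolding up_def dn_def Pair fst_conv snd_conv by (simp only: nonzero_mult_div_cancel_left) (use k in simp)
qed

lemma up_inj: "up p v = up p w \<Longrightarrow> v = w"
  by (metis dn_up)

lemma surv_up: "surv p (up p v)"
  by (auto simp: surv_def up_def)

lemma up_add: "up p v + up q w = up (p + q) (v + w)"
  by (auto simp: up_def)

lemma tau_pm: "t \<in> {1, -1} \<Longrightarrow> t * eps k \<in> {1, -1::int}" by (auto simp: eps_def)

lemma eps_Suc [simp]: "eps (k + 1) = - eps k"
  by (simp add: eps_def)

lemma surv_Suc [simp]:
  "surv p (x + 1, y) \<longleftrightarrow> \<not> surv p (x, y)" "surv p (x, y + 1) \<longleftrightarrow> \<not> surv p (x, y)"
  by (auto simp: surv_def)

text \<open>The two dying corners of a unit square are opposite: the vectors from them to the centre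
  have the same product of coordinates, while their abscissas differ in parity. As
  \<open>u + sc \<tau> (sw u)\<close> has coordinate product \<open>\<tau>\<close>, one of the two
  corners has the sign that makes a pair of edges there bound this square.\<close>

lemma face_ex:
  fixes M :: pt
  assumes "odd (fst M)" "odd (snd M)" and t: "t \<in> {1, -1}"
  shows "\<exists>B u. \<not> surv p B \<and> u \<in> units \<and> M = B + B + u + sc (t * eps (fst B)) (sw u)"
proof -
  obtain i j where "fst M = 2*i+1" "snd M = 2*j+1"
    using assms by (metis oddE)
  then have M: "M = (2*i+1, 2*j+1)" by (simp add: prod_eq_iff)
  have *: ?thesis if "\<not> surv p (x,y)" "u \<in> units" "(2*i+1-2*x, 2*j+1-2*y) = u + sc (t * eps x) (sw u)" for x y u
    using that by (intro exI[of _ "(x,y)"] exI[of _ u]) (simp add: M prod_eq_iff)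
  consider "surv p (i,j)" "t * eps i = -1" | "surv p (i,j)" "t * eps i = 1"
    | "\<not> surv p (i,j)" "t * eps i = -1" | "\<not> surv p (i,j)" "t * eps i = 1"
    using tau_pm[OF t, of i] by blast
  then show ?thesis
  proof cases
    case 1 then show ?thesis
      by (intro *[of i "j+1" "(1,0)"]) (simp_all add: units_def sc_def sw_def)
  next
    case 2 then show ?thesis
      by (intro *[of "i+1" j "(-1,0)"]) (simp_all add: units_def sc_def sw_def)
  next
    case 3 then show ?thesis
      by (intro *[of "i+1" "j+1" "(-1,0)"]) (simp_all add: units_def sc_def sw_def)
  next
    case 4 then show ?thesis
      by (intro *[of i j "(1,0)"]) (simp_all add: units_def sc_def sw_def)
  qed
qed

lemma sum_sw_cases:
  assumes "u \<in> units" "\<tau> \<in> {1, -1}"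
  shows "\<exists>a b. u + sc \<tau> (sw u) = (a, b) \<and> a \<in> {1, -1} \<and> b \<in> {1, -1} \<and> a * b = \<tau> \<and>
    (u = (a, 0) \<or> u = (0, b)) \<and> (sc \<tau> (sw u) = (0, b) \<or> sc \<tau> (sw u) = (a, 0))"
  using assms by (auto simp: units_def sc_def sw_def)

lemma eps_pm: "eps k \<in> {1, -1}" by (simp add: eps_def)

lemma face_unique:
  fixes B B' u u' :: pt
  assumes B: "\<not> surv p B" "\<not> surv p B'" and u: "u \<in> units" "u' \<in> units" and t: "t \<in> {1, -1}"
    and eq: "B + B + u + sc (t * eps (fst B)) (sw u) = B' + B' + u' + sc (t * eps (fst B')) (sw u')"
  shows "B = B' \<and> (u' = u \<or> u' = sc (t * eps (fst B)) (sw u))"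
proof -
  define \<tau> \<tau>' where "\<tau> = t * eps (fst B)" and "\<tau>' = t * eps (fst B')"
  have \<tau>: "\<tau> \<in> {1, -1}" "\<tau>' \<in> {1, -1}" using t by (simp_all only: tau_pm \<tau>_def \<tau>'_def)
  obtain a b where ab: "u + sc \<tau> (sw u) = (a, b)" "a \<in> {1, -1}" "b \<in> {1, -1}" "a * b = \<tau>"
    "u = (a, 0) \<or> u = (0, b)" "sc \<tau> (sw u) = (0, b) \<or> sc \<tau> (sw u) = (a, 0)"
    using sum_sw_cases[OF u(1) \<tau>(1)] by metis
  obtain a' b' where ab': "u' + sc \<tau>' (sw u') = (a', b')" "a' \<in> {1, -1}" "b' \<in> {1, -1}" "a' * b' = \<tau>'"
    "u' = (a', 0) \<or> u' = (0, b')"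
    using sum_sw_cases[OF u(2) \<tau>(2)] by metis
  obtain x y x' y' where xy: "B = (x,y)" "B' = (x',y')" by (metis prod.collapse)
  have "B + B + (a, b) = B' + B' + (a', b')"
    using eq ab(1) ab'(1) by (simp add: \<tau>_def \<tau>'_def add.assoc)
  then have e: "2*x + a = 2*x' + a'" "2*y + b = 2*y' + b'" by (simp_all add: xy)
  have par: "even (x + y) \<longleftrightarrow> even (x' + y')" using B by (auto simp: surv_def xy)
  have "a = a' \<and> b = b'"
  proof (rule ccontr)
    assume neq: "\<not> (a = a' \<and> b = b')"
    have d: "x' = x + 1 \<or> x' = x - 1 \<or> x' = x" "a = a' \<longleftrightarrow> x' = x" using e ab(2) ab'(2) by auto
    have d': "y' = y + 1 \<or> y' = y - 1 \<or> y' = y" "b = b' \<longleftrightarrow> y' = y" using e ab(3) ab'(3) by auto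
    \<comment> \<open>Equal parity of the coordinate sums leaves only opposite corners of the
      square.\<close>
    have ne: "a \<noteq> a'" "b \<noteq> b'" using neq d d' par by auto
    have "eps x' = - eps x" using d ne(1) by (auto simp: eps_def)
    then have "\<tau>' = - \<tau>" by (simp add: \<tau>_def \<tau>'_def xy)
    moreover have "\<tau>' = \<tau>" using ne ab(2,3,4) ab'(2,3,4) by auto
    ultimately show False using \<tau> by auto
  qed
  then have "B = B'" "a = a'" "b = b'" using e by (auto simp: xy)
  then show ?thesis using ab ab' unfolding \<tau>_def[symmetric] by (elim disjE; simp; fail)
qed

text \<open>At a vertex \<open>B\<close> that is not kept, a curve arriving from \<open>B + u\<close> leaves to
  \<open>B + sc \<tau> (sw u)\<close> with \<open>\<tau> = t * eps (fst B)\<close>. The long edge so obtained has its midpoint at the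
  centre of a unit square, and \<open>face t B u\<close> is twice that midpoint.\<close>

definition face :: "int \<Rightarrow> pt \<Rightarrow> pt \<Rightarrow> pt" where
  "face t B u = B + B + u + sc (t * eps (fst B)) (sw u)"

definition lattice_path :: "(int \<Rightarrow> pt) \<Rightarrow> bool" where
  "lattice_path y \<longleftrightarrow> (\<forall>k. y (k + 1) - y k \<in> units)"

definition mid :: "(int \<Rightarrow> pt) \<Rightarrow> int \<Rightarrow> pt" where
  "mid y k = y k + y (k + 1)"

text \<open>The rule belongs to the vertex and is symmetric, since \<open>sc s (sw _)\<close> is an
  involution: it pairs the edges at a dying vertex whatever the indexing or the direction of the
  curve. Hence one \<open>p\<close> and one \<open>t\<close> can serve a whole covering, and only
  the index parity \<open>r\<close> depends on the curve.\<close>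

definition plvl :: "int \<Rightarrow> int \<Rightarrow> int \<Rightarrow> (int \<Rightarrow> pt) \<Rightarrow> bool" where
  "plvl p t r y \<longleftrightarrow> (\<forall>k. surv p (y k) \<longleftrightarrow> even (k - r)) \<and>
    (\<forall>k. odd (k - r) \<longrightarrow> y (k + 1) - y k = sc (t * eps (fst (y k))) (sw (y (k - 1) - y k)))"

definition der :: "int \<Rightarrow> int \<Rightarrow> (int \<Rightarrow> pt) \<Rightarrow> int \<Rightarrow> pt" where
  "der p r y j = dn p (y (r + 2 * j))"

text \<open>\<open>dying p m\<close> is the end of the edge \<open>m\<close> that is not kept, and \<open>parent p t m\<close> the edge of the next
  level that contains \<open>m\<close>.\<close>

definition dying :: "int \<Rightarrow> pt \<Rightarrow> pt" where
  "dying p m = (let v = (fst m div 2, snd m div 2)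
     in if surv p v then (if odd (fst m) then v + (1, 0) else v + (0, 1)) else v)"

definition parent :: "int \<Rightarrow> int \<Rightarrow> pt \<Rightarrow> pt" where
  "parent p t m = (let B = dying p m in dn (2 * p) (m + sc (t * eps (fst B)) (sw (m - B - B))))"

lemma units_minus: "u \<in> units \<Longrightarrow> - u \<in> units"
  by (auto simp: units_def)

lemma units_sw: "u \<in> units \<Longrightarrow> s \<in> {1, -1} \<Longrightarrow> sc s (sw u) \<in> units"
  by (auto simp: units_def sc_def sw_def)

lemma sc_sw_invol: "s \<in> {1, -1} \<Longrightarrow> sc s (sw (sc s (sw u))) = u"
  by (auto simp: sc_def sw_def prod_eq_iff)

lemma units_iff_up: "v \<in> units \<longleftrightarrow> fst (up 0 v) \<in> {1, -1} \<and> snd (up 0 v) \<in> {1, -1}"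
  by (cases v) (auto simp: units_def up_def)

lemma pathD: "lattice_path y \<Longrightarrow> y (k + 1) - y k \<in> units"
  by (simp add: lattice_path_def)

lemma pathD': "lattice_path y \<Longrightarrow> y k - y (k + 1) \<in> units"
  using units_minus[OF pathD[of y k]] by simp

lemma unit_parity: "u \<in> units \<Longrightarrow> odd (fst u + snd u)"
  by (auto simp: units_def)

lemma face_odd: "u \<in> units \<Longrightarrow> t \<in> {1, -1} \<Longrightarrow> odd (fst (face t B u)) \<and> odd (snd (face t B u))"
  by (auto simp: face_def units_def sc_def sw_def eps_def)

lemma mid_edge_pt: "lattice_path y \<Longrightarrow> edge_pt (mid y k)"
proof -
  assume "lattice_path y"
  then have "odd (fst (y (k+1) - y k) + snd (y (k+1) - y k))" by (intro unit_parity pathD)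
  then show ?thesis by (auto simp: edge_pt_def mid_def)
qed

lemma mid_ends:
  fixes v B u w :: pt
  assumes "v \<in> units" "u \<in> units" "w + w + v = B + B + u"
  shows "(w = B \<and> v = u) \<or> (w = B + u \<and> v = - u)"
proof -
  obtain a b x y where *: "w = (a,b)" "B = (x,y)" by (metis prod.collapse)
  show ?thesis using assms unfolding * units_def by (auto; presburger)
qed

lemma dying_eq:
  assumes "\<not> surv p B" "u \<in> units"
  shows "dying p (B + B + u) = B"
proof -
  obtain x y where B: "B = (x,y)" by (metis prod.collapse)
  have 1: "surv p (x - 1, y)" "surv p (x, y - 1)" "\<not> surv p (x, y)" using assms(1) by (auto simp: surv_def B)
  have 2: "(2 * x - 1) div 2 = x - 1" "(2 * y - 1) div 2 = y - 1" by simp_all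
  have "u = (1,0) \<or> u = (-1,0) \<or> u = (0,1) \<or> u = (0,-1)" using assms(2) by (auto simp: units_def)
  then show ?thesis
    using 1 by (elim disjE) (simp_all add: dying_def B 2 flip: mult_2)
qed

lemma parent_eq:
  assumes "\<not> surv p B" "u \<in> units"
  shows "parent p t (B + B + u) = dn (2 * p) (face t B u)"
  by (simp add: parent_def dying_eq[OF assms] face_def Let_def)

context
  fixes p t r y
  assumes lv: "plvl p t r y" and pa: "lattice_path y" and t: "t \<in> {1, -1}"
begin

lemma plvl_surv: "surv p (y k) \<longleftrightarrow> even (k - r)"
  using lv by (simp add: plvl_def)

lemma up_der: "up p (der p r y j) = y (r + 2 * j)"
  by (simp add: der_def up_dn plvl_surv)

lemma plvl_next:
  "odd (k - r) \<Longrightarrow> y (k + 1) - y k = sc (t * eps (fst (y k))) (sw (y (k - 1) - y k))"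
  using lv by (simp add: plvl_def)

lemma up_mid_der:
  "up (2 * p) (mid (der p r y) j) = face t (y (r + 2*j + 1)) (y (r + 2*j) - y (r + 2*j + 1))"
proof -
  have "up (2 * p) (mid (der p r y) j) = up p (der p r y j) + up p (der p r y (j + 1))"
    by (simp add: mid_def up_add)
  also have "\<dots> = y (r + 2*j) + y (r + 2*j + 2)"
    by (simp add: up_der distrib_left add.assoc)
  finally show ?thesis
    using plvl_next[of "r + 2*j + 1"] by (simp add: face_def algebra_simps)
qed

text \<open>The long step \<open>sc s (sw u) - u\<close> is a diagonal of a unit square, hence
  \<open>1 + \<i>\<close> times a unit.\<close>

lemma path_der: "lattice_path (der p r y)"
  unfolding lattice_path_def
proof
  fix j
  define B where "B = y (r + 2*j + 1)"
  define u where "u = y (r + 2*j) - B"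
  define s where "s = t * eps (fst B)"
  have u: "u \<in> units" using pathD'[OF pa, of "r + 2*j"] by (simp add: u_def B_def)
  have s: "s \<in> {1, -1}" unfolding s_def by (rule tau_pm[OF t])
  have n: "y (r + 2*j + 2) = B + sc s (sw u)"
    using plvl_next[of "r + 2*j + 1"] by (simp add: B_def u_def s_def algebra_simps)
  have "up 0 (der p r y (j + 1) - der p r y j) = up p (der p r y (j+1)) - up p (der p r y j)"
    by (simp add: up_def)
  also have "\<dots> = y (r + 2*j + 2) - y (r + 2*j)"
    by (simp add: up_der distrib_left add.assoc)
  also have "\<dots> = sc s (sw u) - u" unfolding n by (simp add: u_def)
  finally show "der p r y (j + 1) - der p r y j \<in> units"
    unfolding units_iff_up using u s by (auto simp: units_def sc_def sw_def)
qed

lemma mid_children: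
  "mid y (r + 2*j) = y (r + 2*j + 1) + y (r + 2*j + 1) + (y (r + 2*j) - y (r + 2*j + 1))"
  "mid y (r + 2*j + 1) = y (r + 2*j + 1) + y (r + 2*j + 1) +
     sc (t * eps (fst (y (r + 2*j + 1)))) (sw (y (r + 2*j) - y (r + 2*j + 1)))"
  using plvl_next[of "r + 2*j + 1"] by (simp_all add: mid_def algebra_simps)

text \<open>Edges \<open>r + 2*j\<close> and \<open>r + 2*j + 1\<close> share the dying vertex of
  index \<open>r + 2*j + 1\<close>; exchanging them leaves \<open>face\<close> unchanged because
  \<open>sc s (sw _)\<close> is an involution.\<close>

lemma mid_der_parent: "mid (der p r y) ((k - r) div 2) = parent p t (mid y k)"
proof -
  define j where "j = (k - r) div 2"
  define B where "B = y (r + 2*j + 1)"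
  define u where "u = y (r + 2*j) - B"
  define s where "s = t * eps (fst B)"
  have B: "\<not> surv p B" by (simp add: B_def plvl_surv)
  have u: "u \<in> units" using pathD'[OF pa, of "r + 2*j"] by (simp add: u_def B_def)
  have s: "s \<in> {1, -1}" unfolding s_def by (rule tau_pm[OF t])
  have M: "mid (der p r y) j = dn (2 * p) (face t B u)"
    using up_mid_der[of j] by (metis B_def u_def dn_up)
  consider "k = r + 2*j" | "k = r + 2*j + 1" unfolding j_def by linarith
  then have "parent p t (mid y k) = dn (2 * p) (face t B u)"
  proof cases
    case 1
    then show ?thesis using mid_children(1)[of j] parent_eq[OF B u, of t] by (simp add: B_def u_def)
  next
    case 2
    have "mid y k = B + B + sc s (sw u)" using mid_children(2)[of j] 2 by (simp add: B_def u_def s_def)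
    moreover have "face t B (sc s (sw u)) = face t B u"
      unfolding face_def s_def[symmetric] sc_sw_invol[OF s] by (simp add: algebra_simps)
    ultimately show ?thesis using parent_eq[OF B units_sw[OF u s], of t] by simp
  qed
  then show ?thesis using M by (simp add: j_def)
qed

text \<open>By \<open>face_unique\<close> a long edge determines its dying vertex and the unordered
  pair of short edges there.\<close>

lemma child_of_face:
  assumes "\<not> surv p B" "u \<in> units" and eq: "up (2 * p) (mid (der p r y) j) = face t B u"
  shows "B + B + u \<in> {mid y (r + 2*j), mid y (r + 2*j + 1)}"
proof -
  define B' where "B' = y (r + 2*j + 1)"
  define u' where "u' = y (r + 2*j) - B'"
  have B: "\<not> surv p B'" by (simp add: B'_def plvl_surv)
  have u: "u' \<in> units" using pathD'[OF pa, of "r + 2*j"] by (simp add: u'_def B'_def)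
  have "B' = B \<and> (u = u' \<or> u = sc (t * eps (fst B')) (sw u'))"
    using eq unfolding up_mid_der face_def B'_def[symmetric] u'_def[symmetric]
    by (intro face_unique[OF B assms(1) u assms(2) t])
  then show ?thesis using mid_children[of j] by (auto simp: B'_def u'_def)
qed

end

section \<open>Families of paths that use every edge exactly once\<close>

definition fam :: "'c set \<Rightarrow> ('c \<Rightarrow> int \<Rightarrow> pt) \<Rightarrow> bool" where
  "fam I X \<longleftrightarrow> (\<forall>c\<in>I. lattice_path (X c)) \<and>
    (\<forall>c\<in>I. \<forall>c'\<in>I. \<forall>k k'. mid (X c) k = mid (X c') k' \<longrightarrow> c = c' \<and> k = k') \<and>
    (\<forall>m. edge_pt m \<longrightarrow> (\<exists>c\<in>I. \<exists>k. mid (X c) k = m))"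

definition lvl :: "'c set \<Rightarrow> int \<Rightarrow> int \<Rightarrow> ('c \<Rightarrow> int) \<Rightarrow> ('c \<Rightarrow> int \<Rightarrow> pt) \<Rightarrow> bool" where
  "lvl I p t r X \<longleftrightarrow> t \<in> {1, -1} \<and> (\<forall>c\<in>I. plvl p t (r c) (X c))"

definition Der :: "int \<Rightarrow> ('c \<Rightarrow> int) \<Rightarrow> ('c \<Rightarrow> int \<Rightarrow> pt) \<Rightarrow> 'c \<Rightarrow> int \<Rightarrow> pt" where
  "Der p r X c = der p (r c) (X c)"

lemma fam_path: "fam I X \<Longrightarrow> c \<in> I \<Longrightarrow> lattice_path (X c)"
  by (simp add: fam_def)

lemma fam_inj: "fam I X \<Longrightarrow> mid (X c) k = mid (X c') k' \<Longrightarrow> c \<in> I \<Longrightarrow> c' \<in> I \<Longrightarrow> c = c' \<and> k = k'"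
  by (simp add: fam_def)

lemma fam_surj: "fam I X \<Longrightarrow> edge_pt m \<Longrightarrow> \<exists>c\<in>I. \<exists>k. mid (X c) k = m"
  unfolding fam_def by blast

text \<open>Surjectivity onto the long edges comes from \<open>face_ex\<close>, injectivity from
  \<open>face_unique\<close> by way of \<open>child_of_face\<close>.\<close>

lemma fam_Der:
  assumes F: "fam I X" and L: "lvl I p t r X"
  shows "fam I (Der p r X)"
  unfolding fam_def
proof (intro conjI ballI allI impI)
  note t = L[unfolded lvl_def, THEN conjunct1]
  have l: "plvl p t (r c) (X c)" if "c \<in> I" for c using L that by (simp add: lvl_def)
  show "lattice_path (Der p r X c)" if "c \<in> I" for c
    unfolding Der_def by (rule path_der[OF l[OF that] fam_path[OF F that] t])
  show "\<exists>c\<in>I. \<exists>k. mid (Der p r X c) k = m" if m: "edge_pt m" for m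
  proof -
    have "odd (fst (up (2 * p) m))" "odd (snd (up (2 * p) m))"
      using m by (auto simp: edge_pt_def up_def)
    from face_ex[OF this t, of p] obtain B u where B: "\<not> surv p B" and u: "u \<in> units"
      and M: "up (2 * p) m = face t B u" unfolding face_def by blast
    have "edge_pt (B + B + u)" using unit_parity[OF u] by (auto simp: edge_pt_def)
    then obtain c k where c: "c \<in> I" and k: "mid (X c) k = B + B + u" using fam_surj[OF F] by blast
    have "mid (Der p r X c) ((k - r c) div 2) = dn (2 * p) (up (2 * p) m)"
      unfolding Der_def mid_der_parent[OF l[OF c] fam_path[OF F c] t] k parent_eq[OF B u] M ..
    then show ?thesis using c by auto
  qed
  fix c c' k k'
  assume c: "c \<in> I" "c' \<in> I" and eq: "mid (Der p r X c) k = mid (Der p r X c') k'"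
  note P = fam_path[OF F c(1)] fam_path[OF F c(2)]
  define B where "B = X c (r c + 2*k + 1)"
  define u where "u = X c (r c + 2*k) - B"
  have B: "\<not> surv p B" by (simp add: B_def plvl_surv[OF l[OF c(1)] P(1) t])
  have u: "u \<in> units" using pathD'[OF P(1), of "r c + 2*k"] by (simp add: u_def B_def)
  have "up (2 * p) (mid (der p (r c') (X c')) k') = face t B u"
    using up_mid_der[OF l[OF c(1)] P(1) t, of k] eq unfolding Der_def B_def u_def by simp
  from child_of_face[OF l[OF c(2)] P(2) t B u this]
  have "mid (X c) (r c + 2*k) \<in> {mid (X c') (r c' + 2*k'), mid (X c') (r c' + 2*k' + 1)}"
    unfolding mid_children(1)[OF l[OF c(1)] P(1) t, of k] B_def u_def .
  then have *: "c = c' \<and> (r c + 2*k = r c' + 2*k' \<or> r c + 2*k = r c' + 2*k' + 1)"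
    using fam_inj[OF F _ c] by blast
  then show cc: "c = c'" by blast
  have "k = k' \<or> 2*k = 2*k' + 1" using * unfolding cc by auto
  then show "k = k'" by presburger
qed

section \<open>Turn sequences and the rule at dying vertices\<close>

definition turns :: "(int \<Rightarrow> pt) \<Rightarrow> (int \<Rightarrow> int) \<Rightarrow> bool" where
  "turns y a \<longleftrightarrow> (\<forall>k. a k \<in> {1, -1} \<and> y (k + 2) - y (k + 1) = sc (a k) (rot (y (k + 1) - y k)))"

lemma alternating_parity:
  fixes P :: "int \<Rightarrow> bool"
  assumes "\<And>k. P (k + 1) \<longleftrightarrow> \<not> P k"
  shows "P k \<longleftrightarrow> (P r \<longleftrightarrow> even (k - r))"
proof (induction k rule: int_induct[where k = r])
  case (step1 i) then show ?case using assms[of i] by auto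
next
  case (step2 i) then show ?case using assms[of "i - 1"] by auto
qed simp

lemma int_const:
  fixes g :: "int \<Rightarrow> 'a"
  assumes "\<And>k. g (k + 1) = g k"
  shows "g k = g 0"
proof (induction k rule: int_induct[where k = 0])
  case (step1 i) then show ?case using assms[of i] by auto
next
  case (step2 i) then show ?case using assms[of "i - 1"] by auto
qed simp

lemma eps_pred [simp]: "eps (k - 1) = - eps k" "eps (1 + k) = - eps k"
  by (simp_all add: eps_def)

lemma rot_sc: "rot (sc s u) = sc s (rot u)"
  by (simp add: rot_def sc_def)

text \<open>Between consecutive dying vertices the path makes two perpendicular steps: the abscissa
  changes by one, and the incoming direction stays horizontal or stays vertical. So alternation
  along the index amounts to the factor \<open>eps\<close> of the abscissa, up to one global
  sign.\<close>

lemma plvl_of_turns: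
  assumes pa: "lattice_path y" and T: "turns y a" and alt: "\<And>l. a (r + 2*l) = s * eps l"
  shows "\<exists>p\<in>{0, 1}. \<exists>t\<in>{1, -1}. plvl p t r y"
proof -
  define p where "p = (fst (y r) + snd (y r)) mod 2"
  have "surv p (y (k + 1)) \<longleftrightarrow> \<not> surv p (y k)" for k
    using unit_parity[OF pathD[OF pa, of k]] by (auto simp: surv_def)
  from alternating_parity[of "\<lambda>k. surv p (y k)", OF this, of _ r]
  have s: "surv p (y k) \<longleftrightarrow> even (k - r)" for k
    by (auto simp: surv_def p_def)
  have a: "a k \<in> {1, -1}" and h: "y (k + 2) - y (k + 1) = sc (a k) (rot (y (k + 1) - y k))" for k
    using T by (auto simp: turns_def)
  \<comment> \<open>The value to become \<open>t\<close>. The last factor compares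
    \<open>rot\<close> of the incoming step with \<open>sw\<close> of the reversed step: they are
    opposite for horizontal steps and equal for vertical ones.\<close>
  define g where "g l = a (r + 2*l) * eps (fst (y (r + 2*l + 1))) *
    (if snd (y (r + 2*l + 1) - y (r + 2*l)) = 0 then -1 else 1)" for l
  have "g (l + 1) = g l" for l
  proof -
    define e where "e = y (r + 2*l + 1) - y (r + 2*l)"
    have e: "e \<in> units" using pathD[OF pa] by (simp add: e_def)
    define x where "x = fst (y (r + 2*l + 1))"
    have h1: "y (r + 2*l + 2) - y (r + 2*l + 1) = sc (a (r + 2*l)) (rot e)"
      using h[of "r + 2*l"] by (simp add: e_def)
    have h2: "y (r + 2*l + 3) - y (r + 2*l + 2) = sc (a (r + 2*l + 1)) (rot (sc (a (r + 2*l)) (rot e)))"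
      using h[of "r + 2*l + 1"] h1 by (simp add: add.assoc)
    have x: "fst (y (r + 2*l + 3)) = x + fst (sc (a (r + 2*l)) (rot e)) +
        fst (sc (a (r + 2*l + 1)) (rot (sc (a (r + 2*l)) (rot e))))"
    proof -
      have "fst (y (r + 2*l + 3)) = x + fst (y (r + 2*l + 2) - y (r + 2*l + 1)) + fst (y (r + 2*l + 3) - y (r + 2*l + 2))"
        by (simp add: x_def)
      then show ?thesis by (simp only: h1 h2)
    qed
    have a2: "a (r + 2*l + 2) = - a (r + 2*l)" using alt[of l] alt[of "l + 1"] by (simp add: algebra_simps)
    have "g l = a (r + 2*l) * eps x * (if snd e = 0 then -1 else 1)"
      by (simp add: g_def x_def e_def)
    moreover have "g (l + 1) = a (r + 2*l + 2) * eps (fst (y (r + 2*l + 3))) *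
      (if snd (y (r + 2*l + 3) - y (r + 2*l + 2)) = 0 then -1 else 1)"
      by (simp add: g_def distrib_left add.assoc)
    ultimately show ?thesis
      unfolding x a2 h2 using e a[of "r + 2*l"] a[of "r + 2*l + 1"]
      by (auto simp: units_def sc_def rot_def)
  qed
  then have g: "g l = g 0" for l by (rule int_const)
  have g0: "g 0 \<in> {1, -1}" using a[of r] eps_pm[of "fst (y (r + 1))"] by (auto simp: g_def)
  have "y (k + 1) - y k = sc (g 0 * eps (fst (y k))) (sw (y (k - 1) - y k))" if "odd (k - r)" for k
  proof -
    have "2 dvd k - r - 1" using that by simp
    then obtain l where "k - r - 1 = 2*l" by (rule dvdE)
    then have k: "k = r + 2*l + 1" by simp
    define e where "e = y (r + 2*l + 1) - y (r + 2*l)"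
    have e: "e \<in> units" using pathD[OF pa] by (simp add: e_def)
    have k1: "k + 1 = r + 2*l + 2" using k by simp
    have h1: "y (k + 1) - y k = sc (a (r + 2*l)) (rot e)"
      unfolding k1 unfolding k using h[of "r + 2*l"] by (simp add: e_def)
    have e': "y (k - 1) - y k = - e" by (simp add: k e_def)
    have g': "g 0 = a (r + 2*l) * eps (fst (y k)) * (if snd e = 0 then -1 else 1)"
      using g[of l] by (simp add: g_def k e_def)
    show ?thesis unfolding h1 e' g' using e a[of "r + 2*l"] eps_pm[of "fst (y k)"]
      by (auto simp: units_def sc_def rot_def sw_def)
  qed
  moreover have "p \<in> {0, 1}" by (auto simp: p_def)
  ultimately show ?thesis using g0 s unfolding plvl_def by blast
qed

lemma up_rot: "up 0 (sc s (rot v)) = sc s (rot (up 0 v))"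
  by (simp add: up_def sc_def rot_def algebra_simps)

text \<open>The turns \<open>b\<close> and \<open>- b\<close> at the dying vertices on both sides of
  a kept vertex cancel, so the long path turns there as the short one does.\<close>

lemma turns_der:
  assumes lv: "plvl p t r y" and pa: "lattice_path y" and t: "t \<in> {1, -1}"
    and T: "turns y a" and alt: "\<And>l. a (r + 2*l) = s * eps l"
  shows "turns (der p r y) (\<lambda>j. a (r + 1 + 2*j))"
  unfolding turns_def
proof (intro allI conjI)
  fix j
  have a: "a k \<in> {1, -1}" and h: "y (k + 2) - y (k + 1) = sc (a k) (rot (y (k + 1) - y k))" for k
    using T by (auto simp: turns_def)
  show "a (r + 1 + 2*j) \<in> {1, -1}" by (rule a)
  have ud: "up 0 (der p r y (i + 1) - der p r y i) = y (r + 2*i + 2) - y (r + 2*i)" for i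
  proof -
    have "up 0 (der p r y (i + 1) - der p r y i) = up p (der p r y (i+1)) - up p (der p r y i)"
      by (simp add: up_def)
    then show ?thesis by (simp add: up_der[OF lv pa t] distrib_left add.assoc)
  qed
  define e where "e = y (r + 2*j + 1) - y (r + 2*j)"
  define b where "b = a (r + 2*j)"
  have b: "b \<in> {1, -1}" using a by (simp add: b_def)
  have h1: "y (r + 2*j + 2) - y (r + 2*j + 1) = sc b (rot e)"
    using h[of "r + 2*j"] by (simp add: e_def b_def)
  have h2: "y (r + 2*j + 3) - y (r + 2*j + 2) = sc (a (r + 1 + 2*j)) (rot (sc b (rot e)))"
  proof -
    have e1: "r + 1 + 2*j = r + 2*j + 1" by simp
    show ?thesis unfolding e1 using h[of "r + 2*j + 1"] h1 by (simp add: add.assoc)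
  qed
  have a2: "a (r + 2*j + 2) = - b" using alt[of j] alt[of "j + 1"] by (simp add: algebra_simps b_def)
  have h3: "y (r + 2*j + 4) - y (r + 2*j + 3) = sc (- b) (rot (sc (a (r + 1 + 2*j)) (rot (sc b (rot e)))))"
    using h[of "r + 2*j + 2"] h2 a2 by (simp add: add.assoc)
  have "up 0 (der p r y (j + 2) - der p r y (j + 1)) = y (r + 2*j + 4) - y (r + 2*j + 2)"
    using ud[of "j + 1"] by (simp add: add.assoc distrib_left)
  also have "\<dots> = (y (r + 2*j + 4) - y (r + 2*j + 3)) + (y (r + 2*j + 3) - y (r + 2*j + 2))" by simp
  also have "\<dots> = sc (a (r + 1 + 2*j)) (rot (e + sc b (rot e)))"
    unfolding h2 h3 using b by (auto simp: sc_def rot_def algebra_simps)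
  also have "e + sc b (rot e) = y (r + 2*j + 2) - y (r + 2*j)"
    unfolding h1[symmetric] by (simp add: e_def)
  also have "\<dots> = up 0 (der p r y (j + 1) - der p r y j)" by (simp add: ud)
  finally show "der p r y (j + 2) - der p r y (j + 1) =
      sc (a (r + 1 + 2*j)) (rot (der p r y (j + 1) - der p r y j))"
    unfolding up_rot[symmetric] by (rule up_inj)
qed

section \<open>Unfolding a folding sequence\<close>

lemma eps_add: "eps (a + b) = eps a * eps b"
  by (auto simp: eps_def)

lemma eps_diff: "eps (a - b) = eps a * eps b"
  by (auto simp: eps_def)

lemma eps_minus [simp]: "eps (- a) = eps a"
  by (simp add: eps_def)

lemma eps_sq [simp]: "eps a * eps a = 1"
  by (simp add: eps_def)

lemma folding_seqs_SucD:
  "T \<in> folding_seqs (Suc n) \<Longrightarrow> \<exists>S e. T = bar S @ [e] @ S \<and> S \<in> folding_seqs n \<and> e \<in> {1, -1}"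
  by auto

lemma folding_seqs_SucI:
  "S \<in> folding_seqs n \<Longrightarrow> e \<in> {1, -1} \<Longrightarrow> bar S @ [e] @ S \<in> folding_seqs (Suc n)"
  by auto

lemma length_bar [simp]: "length (bar S) = length S"
  by (simp add: bar_def)

lemma folding_seqs_length: "T \<in> folding_seqs n \<Longrightarrow> length T = 2 ^ n - 1"
proof (induction n arbitrary: T)
  case (Suc n)
  then obtain S e where "T = bar S @ [e] @ S" "S \<in> folding_seqs n" by auto
  then show ?case using Suc.IH[of S] by (simp add: mult_2)
qed simp

lemma bar_nth: "i < length S \<Longrightarrow> bar S ! i = - (S ! (length S - 1 - i))"
  by (simp add: bar_def rev_nth)

lemma bar_append: "bar (xs @ ys) = bar ys @ bar xs"
  by (simp add: bar_def)

lemma bar_bar [simp]: "bar (bar S) = S"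
  by (simp add: bar_def rev_map comp_def)

lemma bar_folding: "S \<in> folding_seqs n \<Longrightarrow> bar S \<in> folding_seqs n"
proof (cases n)
  case (Suc m)
  assume "S \<in> folding_seqs n"
  then obtain R e where S: "S = bar R @ [e] @ R" "R \<in> folding_seqs m" "e \<in> {1, -1}"
    using Suc by auto
  then have "bar S = bar R @ [-e] @ R" by (simp add: bar_append) (simp add: bar_def)
  then show ?thesis using folding_seqs_SucI[OF S(2), of "-e"] S(3) Suc by auto
qed (simp add: bar_def)

definition evens :: "int list \<Rightarrow> int list" where
  "evens T = map (\<lambda>i. T ! (2 * i + 1)) [0..<length T div 2]"

lemma length_evens [simp]: "length (evens T) = length T div 2"
  by (simp add: evens_def)

lemma nth_evens: "i < length T div 2 \<Longrightarrow> evens T ! i = T ! (2 * i + 1)"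
  by (simp add: evens_def)

text \<open>In \<open>bar S @ [e] @ S\<close> the last term of \<open>bar S\<close> is the negative
  of the first term of \<open>S\<close>. Both stand at even positions, so the alternation continues
  across the middle term.\<close>

lemma folding_nth_even:
  "T \<in> folding_seqs (Suc n) \<Longrightarrow> \<exists>c\<in>{1, -1}. \<forall>i<2^n. T ! (2 * i) = c * eps (int i)"
proof (induction n arbitrary: T)
  case 0
  then show ?case by (auto simp: eps_def bar_def)
next
  case (Suc n)
  then obtain S e where T: "T = bar S @ [e] @ S" and S: "S \<in> folding_seqs (Suc n)"
    using folding_seqs_SucD by blast
  obtain c where c: "c \<in> {1, -1}" "\<And>i. i < 2^n \<Longrightarrow> S ! (2 * i) = c * eps (int i)"
    using Suc.IH[OF S] by blast
  have len: "length S = 2 * 2^n - 1" using folding_seqs_length[OF S] by simp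
  have fst_half: "T ! (2 * i) = - c * eps (2^n - 1) * eps (int i)" if "i < 2^n" for i
  proof -
    have i2: "2 * i < length S" using that len by linarith
    have "T ! (2 * i) = bar S ! (2 * i)" using i2 by (simp add: T nth_append)
    then have e1: "T ! (2 * i) = - (S ! (length S - 1 - 2 * i))" using bar_nth[OF i2] by (rule trans)
    have e2: "length S - 1 - 2 * i = 2 * (2^n - 1 - i)" using len that by auto
    have e3: "S ! (2 * (2^n - 1 - i)) = c * eps (int (2^n - 1 - i))" using that by (intro c(2)) auto
    have "int (2^n - 1 - i) = (2^n - 1) - int i" using that by (simp add: of_nat_diff algebra_simps)
    then have e4: "eps (int (2^n - 1 - i)) = eps (2^n - 1) * eps (int i)" by (simp only: eps_diff)
    have "T ! (2 * i) = - (c * (eps (2^n - 1) * eps (int i)))" using e1 e3 e4 e2 by metis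
    then show ?thesis by (simp only: mult.assoc mult_minus_left)
  qed
  have snd_half: "T ! (2 * (2^n + i)) = c * eps (int i)" if "i < 2^n" for i
  proof -
    have "T = (bar S @ [e]) @ S" using T by simp
    then have "T ! (length (bar S @ [e]) + 2 * i) = S ! (2 * i)" by (simp only: nth_append_length_plus)
    moreover have "length (bar S @ [e]) = 2 * 2^n" using len by simp
    ultimately show ?thesis unfolding distrib_left using c(2)[OF that] by metis
  qed
  have key: "eps (2^n + int i) * (- eps (2^n - 1)) = eps (int i)" for i
    by (simp add: eps_def)
  have "T ! (2 * i) = (- c * eps (2^n - 1)) * eps (int i)" if "i < 2 ^ Suc n" for i
  proof (cases "i < 2^n")
    case False
    define j where "j = i - 2^n"
    have j: "i = 2^n + j" "j < 2^n" using that False by (simp_all add: j_def)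
    have "(- c * eps (2^n - 1)) * eps (int i) = c * (eps (2^n + int j) * (- eps (2^n - 1)))"
      unfolding j(1) by simp
    then show ?thesis unfolding key using snd_half[OF j(2)] unfolding j(1) by (rule trans[OF _ sym, rotated])
  qed (rule fst_half)
  moreover have "- c * eps (2^n - 1) \<in> {1, -1}" using c(1) eps_pm[of "2^n - 1"] by auto
  ultimately show ?case by (intro bexI[of _ "- c * eps (2^n - 1)"] allI impI)
qed

text \<open>For nonempty \<open>S\<close> the middle term stands at an odd position, and
  \<open>bar\<close> commutes with taking the terms at odd positions.\<close>

lemma folding_evens: "T \<in> folding_seqs (Suc n) \<Longrightarrow> evens T \<in> folding_seqs n"
proof (induction n arbitrary: T)
  case 0
  then show ?case by (auto simp: evens_def bar_def)
next
  case (Suc n)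
  then obtain S e where T: "T = bar S @ [e] @ S" and S: "S \<in> folding_seqs (Suc n)" and e: "e \<in> {1, -1}"
    using folding_seqs_SucD by blast
  have len: "length S = 2 * 2^n - 1" using folding_seqs_length[OF S] by simp
  have p: "(2::nat)^n > 0" by simp
  have half: "length S div 2 = 2^n - 1" using len p by linarith
  have "evens T = bar (evens S) @ [e] @ evens S"
  proof (rule nth_equalityI)
    have "length T div 2 = 2 * 2^n - 1" using len p by (simp add: T)
    then show l: "length (evens T) = length (bar (evens S) @ [e] @ evens S)"
      using p by (simp add: half)
    fix i assume "i < length (evens T)"
    then have i: "i < 2 * 2^n - 1" using l half p by simp
    have ei: "evens T ! i = T ! (2 * i + 1)" using \<open>i < length (evens T)\<close> by (simp add: nth_evens)
    consider "i < 2^n - 1" | "i = 2^n - 1" | j where "i = 2^n + j" "j < 2^n - 1"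
    proof -
      have "i < 2^n - 1 \<or> i = 2^n - 1 \<or> (\<exists>j. i = 2^n + j \<and> j < 2^n - 1)"
        using i by (cases "i < 2^n") (auto intro!: exI[of _ "i - 2^n"])
      then show ?thesis using that by blast
    qed
    then show "evens T ! i = (bar (evens S) @ [e] @ evens S) ! i"
    proof cases
      case 1
      have i2: "2 * i + 1 < length S" using 1 len by linarith
      have "T ! (2 * i + 1) = - (S ! (length S - 1 - (2 * i + 1)))" using i2 by (simp add: T nth_append bar_nth)
      also have "length S - 1 - (2 * i + 1) = 2 * (2^n - 1 - 1 - i) + 1" using len 1 by auto
      also have "S ! \<dots> = evens S ! (2^n - 1 - 1 - i)" using 1 half by (intro nth_evens[symmetric]) auto
      finally show ?thesis using 1 half ei by (simp add: nth_append bar_nth)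
    next
      case 2
      have "2 * i + 1 = length S" using 2 len p by linarith
      then show ?thesis using ei 2 half by (simp add: T nth_append)
    next
      case 3
      have ix: "2 * i + 1 = length (bar S @ [e]) + (2 * j + 1)" using 3 len p by simp
      have T': "T = (bar S @ [e]) @ S" using T by simp
      have "T ! (2 * i + 1) = ((bar S @ [e]) @ S) ! (length (bar S @ [e]) + (2 * j + 1))"
        unfolding T' ix ..
      also have "\<dots> = S ! (2 * j + 1)" by (rule nth_append_length_plus)
      also have "\<dots> = evens S ! j" using 3 half by (simp add: nth_evens)
      also have "\<dots> = ((bar (evens S) @ [e]) @ evens S) ! (length (bar (evens S) @ [e]) + j)"
        by (rule nth_append_length_plus[symmetric])
      also have "length (bar (evens S) @ [e]) + j = i" using 3 half p by simp
      finally show ?thesis using ei by (simp only: append_assoc)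
    qed
  qed
  then show ?case using folding_seqs_SucI[OF Suc.IH[OF S] e] by (simp only:)
qed

text \<open>Compactness for finitely many alternatives: if each failed at some stage, all would fail
  at the sum of these stages.\<close>

lemma antimono_pigeonhole:
  fixes Q :: "'a \<Rightarrow> nat \<Rightarrow> bool"
  assumes "finite F" "\<And>N. \<exists>x\<in>F. Q x N" "\<And>x M N. M \<le> N \<Longrightarrow> Q x N \<Longrightarrow> Q x M"
  shows "\<exists>x\<in>F. \<forall>N. Q x N"
proof (rule ccontr)
  assume "\<not> ?thesis"
  then obtain f where f: "\<And>x. x \<in> F \<Longrightarrow> \<not> Q x (f x)" by metis
  define N where "N = (\<Sum>x\<in>F. f x)"
  obtain x where x: "x \<in> F" "Q x N" using assms(2) by blast
  have "f x \<le> N" unfolding N_def using assms(1) x(1) by (intro member_le_sum) auto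
  then show False using f x assms(3) by blast
qed

text \<open>Each finite block inherits a parity and a sign from the folding sequence that contains
  it, but these may vary with the block. There are only four pairs, so one of them fits arbitrarily
  long central blocks.\<close>

lemma complete_folding_split:
  assumes cf: "complete_folding a"
  shows "\<exists>r s. s \<in> {1, -1} \<and> (\<forall>l. a (r + 2*l) = s * eps l) \<and> complete_folding (\<lambda>j. a (r + 1 + 2*j))"
proof -
  define Q where "Q = (\<lambda>(r, s) (N::nat). (\<forall>l. \<bar>r + 2*l\<bar> \<le> int N \<longrightarrow> a (r + 2*l) = s * eps l) \<and>
    (\<forall>k (l::nat). - int N \<le> r + 1 + 2*(k+1) \<and> r + 1 + 2*(k + int l) \<le> int N \<longrightarrow>
      (\<exists>n. \<exists>T\<in>folding_seqs n. sublist (map (\<lambda>j. a (r + 1 + 2*j)) [k+1..k+int l]) T)))"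
  have ex: "\<exists>x\<in>{0, 1::int}\<times>{1, -1::int}. Q x N" for N :: nat
  proof -
    obtain n T where T: "T \<in> folding_seqs n"
      and sub: "sublist (map a [(- int N - 1) + 1..(- int N - 1) + int (2*N+1)]) T"
      using cf unfolding complete_folding_def by blast
    have ivl: "[(- int N - 1) + 1..(- int N - 1) + int (2*N+1)] = [- int N..int N]" by simp
    obtain pre suf where app: "T = pre @ map a [- int N..int N] @ suf"
      using sub unfolding sublist_def ivl by blast
    \<comment> \<open>The term \<open>a i\<close> stands at position \<open>o' + i\<close> of
      \<open>T\<close>; the parity \<open>r\<close> chosen below makes \<open>o' + r\<close>
      even.\<close>
    define o' where "o' = int (length pre) + int N"
    have aT: "a i = T ! nat (o' + i) \<and> nat (o' + i) < length T \<and> o' + i \<ge> 0" if "\<bar>i\<bar> \<le> int N" for i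
    proof -
      have e: "nat (o' + i) = length pre + nat (i + int N)" using that by (simp add: o'_def nat_add_distrib)
      have l: "nat (i + int N) < length [- int N..int N]" using that by simp
      have "T ! nat (o' + i) = map a [- int N..int N] ! nat (i + int N)"
        unfolding e app using l by (simp add: nth_append)
      also have "\<dots> = a i" using l that by (simp add: nth_upto abs_le_iff)
      finally show ?thesis using that l e by (auto simp: app o'_def)
    qed
    have "T \<noteq> []" using app by auto
    then obtain n' where n: "n = Suc n'" using T by (cases n) auto
    obtain c where c: "c \<in> {1, -1}" "\<And>i. i < 2^n' \<Longrightarrow> T ! (2 * i) = c * eps (int i)"
      using folding_nth_even T unfolding n by blast
    have len: "length T = 2 * 2^n' - 1" using folding_seqs_length[OF T] n by simp
    define r where "r = o' mod 2"
    define q where "q = (o' + r) div 2"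
    have q: "o' + r = 2 * q" unfolding q_def r_def by presburger
    define s where "s = c * eps q"
    have 1: "a (r + 2*l) = s * eps l" if "\<bar>r + 2*l\<bar> \<le> int N" for l
    proof -
      have *: "o' + (r + 2*l) = 2 * (q + l)" using q by simp
      have **: "nat (2 * (q + l)) = 2 * nat (q + l)" by (simp add: nat_mult_distrib)
      from aT[OF that] have "a (r + 2*l) = T ! (2 * nat (q + l))" and lt: "2 * nat (q + l) < length T"
        and ge: "q + l \<ge> 0" unfolding * ** by auto
      moreover have "nat (q + l) < 2^n'" using lt len by linarith
      ultimately have "a (r + 2*l) = c * eps (int (nat (q + l)))" using c(2) by metis
      then show ?thesis using ge by (simp add: s_def eps_add)
    qed
    have 2: "\<exists>n. \<exists>T\<in>folding_seqs n. sublist (map (\<lambda>j. a (r + 1 + 2*j)) [k+1..k+int l]) T"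
      if kl: "- int N \<le> r + 1 + 2*(k+1)" "r + 1 + 2*(k + int l) \<le> int N" for k and l :: nat
    proof (cases "l = 0")
      case True
      then show ?thesis by (intro exI[of _ 0]) simp
    next
      case False
      have A: "a (r + 1 + 2*j) = T ! (2 * nat (q + j) + 1) \<and> 2 * nat (q + j) + 1 < length T \<and> q + j \<ge> 0"
        if "k + 1 \<le> j" "j \<le> k + int l" for j
      proof -
        have b: "\<bar>r + 1 + 2*j\<bar> \<le> int N" using kl that by presburger
        have *: "o' + (r + 1 + 2*j) = 2 * (q + j) + 1" using q by simp
        from aT[OF b] have "0 \<le> 2 * (q + j) + 1" unfolding * by blast
        then have g: "q + j \<ge> 0" by presburger
        then have "nat (2 * (q + j) + 1) = 2 * nat (q + j) + 1" by (simp add: nat_add_distrib nat_mult_distrib)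
        then show ?thesis using aT[OF b] g unfolding * by simp
      qed
      define E where "E = evens T"
      define d where "d = nat (q + k + 1)"
      have dq: "q + (k + 1) \<ge> 0" using A[of "k+1"] False by auto
      have "map (\<lambda>j. a (r + 1 + 2*j)) [k+1..k+int l] = take l (drop d E)"
      proof (rule nth_equalityI)
        have "2 * nat (q + (k + int l)) + 1 < length T" using A[of "k + int l"] False by auto
        then have "d + l \<le> length E" using dq False unfolding d_def E_def length_evens by linarith
        then show "length (map (\<lambda>j. a (r + 1 + 2*j)) [k+1..k+int l]) = length (take l (drop d E))" by simp
        fix i assume "i < length (map (\<lambda>j. a (r + 1 + 2*j)) [k+1..k+int l])"
        then have i: "i < l" by simp
        have B: "nat (q + (k + 1 + int i)) = d + i" using dq by (simp add: d_def nat_add_distrib[symmetric] add.assoc)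
        have "map (\<lambda>j. a (r + 1 + 2*j)) [k+1..k+int l] ! i = a (r + 1 + 2*(k + 1 + int i))"
          using i by simp
        also have "\<dots> = E ! (d + i)" using A[of "k + 1 + int i"] i unfolding B E_def
          by (subst nth_evens) auto
        also have "\<dots> = take l (drop d E) ! i" using i \<open>d + l \<le> length E\<close> by simp
        finally show "map (\<lambda>j. a (r + 1 + 2*j)) [k+1..k+int l] ! i = take l (drop d E) ! i" .
      qed
      moreover have "sublist (take l (drop d E)) E"
        by (meson sublist_take sublist_drop sublist_order.order_trans)
      ultimately show ?thesis using folding_evens[OF T[unfolded n]] unfolding E_def by metis
    qed
    have "r \<in> {0, 1}" "s \<in> {1, -1}" using c(1) eps_pm[of q] by (auto simp: r_def s_def)
    then show ?thesis using 1 2 by (intro bexI[of _ "(r, s)"]) (auto simp: Q_def)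
  qed
  have "\<exists>x\<in>{0, 1::int}\<times>{1, -1::int}. \<forall>N. Q x N"
  proof (rule antimono_pigeonhole)
    show "Q x M" if "M \<le> N" "Q x N" for x and M N :: nat
    proof -
      obtain r s where x: "x = (r, s)" by (cases x)
      have MN: "int M \<le> int N" using that(1) by simp
      have 1: "a (r + 2*l) = s * eps l" if "\<bar>r + 2*l\<bar> \<le> int M" for l
        using \<open>Q x N\<close> order_trans[OF that MN] unfolding x Q_def prod.case by blast
      have 2: "\<exists>n. \<exists>T\<in>folding_seqs n. sublist (map (\<lambda>j. a (r + 1 + 2*j)) [k+1..k+int l]) T"
        if "- int M \<le> r + 1 + 2*(k+1)" "r + 1 + 2*(k + int l) \<le> int M" for k and l :: nat
      proof -
        have "- int N \<le> r + 1 + 2*(k+1)" "r + 1 + 2*(k + int l) \<le> int N" using that MN by linarith+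
        then show ?thesis using \<open>Q x N\<close> unfolding x Q_def prod.case by blast
      qed
      show ?thesis unfolding x Q_def prod.case using 1 2 by blast
    qed
  qed (use ex in auto)
  then obtain r s where s: "s \<in> {1, -1}" and Q: "\<And>N. Q (r, s) N" by auto
  have "a (r + 2*l) = s * eps l" for l
    using Q[of "nat \<bar>r + 2*l\<bar>"] by (auto simp: Q_def)
  moreover have "complete_folding (\<lambda>j. a (r + 1 + 2*j))"
    unfolding complete_folding_def
  proof (intro allI)
    fix k and l :: nat
    show "\<exists>n. \<exists>T\<in>folding_seqs n. sublist (map (\<lambda>j. a (r + 1 + 2*j)) [k + 1..k + int l]) T"
    proof -
      define N where "N = nat (\<bar>r + 1 + 2*(k+1)\<bar> + \<bar>r + 1 + 2*(k + int l)\<bar>)"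
      have "- int N \<le> r + 1 + 2*(k+1)" "r + 1 + 2*(k + int l) \<le> int N" by (simp_all add: N_def)
      then show ?thesis using Q[of N] unfolding Q_def prod.case by blast
    qed
  qed
  ultimately show ?thesis using s by blast
qed

section \<open>Recurrence inside one curve\<close>

text \<open>Both neighbours of a vertex are copied along with it, so that the pairing of edges at
  the vertex is copied too.\<close>

definition window :: "'c set \<Rightarrow> ('c \<Rightarrow> int \<Rightarrow> pt) \<Rightarrow> 'c \<Rightarrow> int \<Rightarrow> pt \<Rightarrow> bool" where
  "window I X c0 R v \<longleftrightarrow> (\<forall>c\<in>I. \<forall>k. \<bar>fst (X c k)\<bar> \<le> R \<and> \<bar>snd (X c k)\<bar> \<le> R \<longrightarrow>
    (\<exists>k'. X c0 k' = X c k + v \<and> X c0 (k' + 1) = X c (k + 1) + v \<and> X c0 (k' - 1) = X c (k - 1) + v))"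

text \<open>The form of local isomorphism that passes to derived families. The even coordinate sum
  makes the translation preserve \<open>surv p\<close>.\<close>

definition repeats :: "'c set \<Rightarrow> ('c \<Rightarrow> int \<Rightarrow> pt) \<Rightarrow> 'c \<Rightarrow> bool" where
  "repeats I X c0 \<longleftrightarrow> (\<exists>a. complete_folding a \<and> turns (X c0) a) \<and>
    (\<forall>R. \<exists>v. even (fst v + snd v) \<and> window I X c0 R v)"

lemma window_mono: "window I X c0 R v \<Longrightarrow> R' \<le> R \<Longrightarrow> window I X c0 R' v"
  unfolding window_def by (meson order_trans)

lemma lattice_path_alternates: "lattice_path y \<Longrightarrow> surv p (y (k + 1)) \<longleftrightarrow> \<not> surv p (y k)"
  using unit_parity[OF pathD[of y k]] by (auto simp: surv_def)

lemma surv_add: "even (fst v + snd v) \<Longrightarrow> surv p (w + v) \<longleftrightarrow> surv p w"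
  by (auto simp: surv_def)

text \<open>The folding sequence of \<open>c0\<close> gives the rule on \<open>c0\<close>. Every
  vertex of every curve is carried into \<open>c0\<close> by some window, which transports the rule
  to the whole family.\<close>

lemma lvl_ex:
  assumes F: "fam I X" and c0: "c0 \<in> I" and rep: "repeats I X c0"
  shows "\<exists>p\<in>{0, 1}. \<exists>t r. lvl I p t r X \<and> repeats I (Der p r X) c0"
proof -
  obtain a where cf: "complete_folding a" and T: "turns (X c0) a" using rep by (auto simp: repeats_def)
  obtain r0 s where alt: "\<And>l. a (r0 + 2*l) = s * eps l"
    and cf': "complete_folding (\<lambda>j. a (r0 + 1 + 2*j))"
    using complete_folding_split[OF cf] by blast
  obtain p t0 where p: "p \<in> {0, 1}" and t0: "t0 \<in> {1, -1}" and l0: "plvl p t0 r0 (X c0)"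
    using plvl_of_turns[OF fam_path[OF F c0] T alt] by (elim bexE)
  \<comment> \<open>Translation by \<open>v\<close> multiplies the sign of the rule by
    \<open>eps (fst v)\<close>; one value occurs for arbitrarily large windows.\<close>
  have "\<exists>\<delta>\<in>{1, -1::int}. \<forall>N. \<exists>v. even (fst v + snd v) \<and> eps (fst v) = \<delta> \<and> window I X c0 (int N) v"
  proof (rule antimono_pigeonhole)
    show "\<exists>\<delta>\<in>{1, -1::int}. \<exists>v. even (fst v + snd v) \<and> eps (fst v) = \<delta> \<and> window I X c0 (int N) v" for N
    proof -
      obtain v where "even (fst v + snd v)" "window I X c0 (int N) v"
        using rep unfolding repeats_def by blast
      then show ?thesis by (intro bexI[of _ "eps (fst v)"] exI[of _ v] conjI refl eps_pm)
    qed
    show "\<exists>v. even (fst v + snd v) \<and> eps (fst v) = \<delta> \<and> window I X c0 (int M) v"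
      if "M \<le> N" "\<exists>v. even (fst v + snd v) \<and> eps (fst v) = \<delta> \<and> window I X c0 (int N) v" for \<delta> M N
    proof -
      obtain v where v: "even (fst v + snd v)" "eps (fst v) = \<delta>" "window I X c0 (int N) v"
        using \<open>\<exists>v. _\<close> by (elim exE conjE)
      have "window I X c0 (int M) v" by (rule window_mono[OF v(3)]) (use \<open>M \<le> N\<close> in simp)
      then show ?thesis using v(1,2) by (intro exI[of _ v] conjI)
    qed
  qed simp
  then obtain \<delta> where \<delta>: "\<delta> \<in> {1, -1::int}"
    and win: "\<And>N. \<exists>v. even (fst v + snd v) \<and> eps (fst v) = \<delta> \<and> window I X c0 (int N) v"
    by (elim bexE) (rule that, assumption, erule spec)
  define t where "t = t0 * \<delta>"
  have t: "t \<in> {1, -1}" using t0 \<delta> by (auto simp: t_def)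
  define r where "r c = (if c = c0 then r0 else if surv p (X c 0) then 0 else 1)" for c
  have par: "surv p (X c k) \<longleftrightarrow> even (k - r c)" if c: "c \<in> I" for c k
  proof (cases "c = c0")
    case True
    then show ?thesis using l0 by (simp add: plvl_def r_def)
  next
    case False
    have "surv p (X c k) \<longleftrightarrow> (surv p (X c 0) \<longleftrightarrow> even (k - 0))"
      by (rule alternating_parity[of "\<lambda>k. surv p (X c k)", OF lattice_path_alternates[OF fam_path[OF F c]]])
    then show ?thesis using False by (auto simp: r_def)
  qed
  have rule: "X c (k + 1) - X c k = sc (t * eps (fst (X c k))) (sw (X c (k - 1) - X c k))"
    if c: "c \<in> I" and k: "odd (k - r c)" for c k
  proof -
    define N where "N = nat (\<bar>fst (X c k)\<bar> + \<bar>snd (X c k)\<bar>)"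
    have "\<bar>fst (X c k)\<bar> \<le> int N" "\<bar>snd (X c k)\<bar> \<le> int N" by (simp_all add: N_def)
    moreover obtain v where v: "even (fst v + snd v)" "eps (fst v) = \<delta>" "window I X c0 (int N) v"
      using win by blast
    ultimately obtain k' where k': "X c0 k' = X c k + v" "X c0 (k' + 1) = X c (k + 1) + v"
      "X c0 (k' - 1) = X c (k - 1) + v" using c unfolding window_def by blast
    have "\<not> surv p (X c0 k')" using par[OF c] k v(1) by (simp add: k'(1) surv_add)
    then have "odd (k' - r0)" using par[OF c0] by (simp add: r_def)
    then have "X c0 (k' + 1) - X c0 k' = sc (t0 * eps (fst (X c0 k'))) (sw (X c0 (k' - 1) - X c0 k'))"
      using l0 by (simp add: plvl_def)
    then show ?thesis unfolding k' by (simp add: eps_add v(2) t_def mult.assoc mult.commute[of \<delta>])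
  qed
  have L: "lvl I p t r X" unfolding lvl_def plvl_def using t par rule by blast
  \<comment> \<open>\<open>c0\<close> obeys the rule with \<open>t0\<close> by its own alternation
    and the rule with \<open>t\<close> by its translation into itself.\<close>
  have "\<delta> = 1"
  proof -
    define k where "k = r0 + 1"
    have k: "odd (k - r c0)" "odd (k - r0)" by (simp_all add: k_def r_def)
    define u where "u = X c0 (k - 1) - X c0 k"
    have u: "u \<in> units" using pathD'[OF fam_path[OF F c0], of "k - 1"] by (simp add: u_def)
    have "sc (t * eps (fst (X c0 k))) (sw u) = sc (t0 * eps (fst (X c0 k))) (sw u)"
      using rule[OF c0 k(1)] l0 k(2) by (simp add: plvl_def u_def)
    then show ?thesis using u t0 \<delta> eps_pm[of "fst (X c0 k)"] by (auto simp: t_def units_def sc_def sw_def)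
  qed
  have l: "plvl p t (r c) (X c)" if "c \<in> I" for c using L that by (simp add: lvl_def)
  have "repeats I (Der p r X) c0" unfolding repeats_def
  proof (intro conjI allI)
    have "turns (Der p r X c0) (\<lambda>j. a (r0 + 1 + 2*j))"
      using turns_der[OF l[OF c0] fam_path[OF F c0] t T, of s] alt by (simp add: Der_def r_def)
    then show "\<exists>a. complete_folding a \<and> turns (Der p r X c0) a" using cf' by blast
    fix R :: int
    \<comment> \<open>Points within \<open>R\<close> at the new level come from points within
      \<open>2 * R + 1\<close>. The vertices two indices away are needed as well; they are reached
      through the windows at \<open>k - 1\<close>, \<open>k\<close> and
      \<open>k + 1\<close>.\<close>
    define N where "N = nat (2 * \<bar>R\<bar> + 4)"
    have N: "int N = 2 * \<bar>R\<bar> + 4" by (simp add: N_def)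
    obtain v where v: "even (fst v + snd v)" "eps (fst v) = 1" "window I X c0 (int N) v"
      using win \<open>\<delta> = 1\<close> by blast
    define v' where "v' = dn 0 v"
    have uv: "up 0 v' = v" unfolding v'_def by (rule up_dn) (use v(1) in \<open>simp add: surv_def\<close>)
    \<comment> \<open>Here \<open>\<delta> = 1\<close> is essential: an even abscissa of
      \<open>v\<close> makes the coordinate sum of \<open>v'\<close> even.\<close>
    have "even (fst v)" using v(2) by (auto simp: eps_def split: if_splits)
    then have "even (fst v' + snd v')" using v(1) uv[symmetric] by (simp add: up_def)
    moreover have "window I (Der p r X) c0 R v'" unfolding window_def
    proof (intro ballI allI impI)
      fix c j
      assume c: "c \<in> I" and j: "\<bar>fst (Der p r X c j)\<bar> \<le> R \<and> \<bar>snd (Der p r X c j)\<bar> \<le> R"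
      define k where "k = r c + 2*j"
      have up: "up p (Der p r X c i) = X c (r c + 2*i)" if "c \<in> I" for c i
        unfolding Der_def by (rule up_der[OF l[OF that] fam_path[OF F that] t])
      have b0: "\<bar>fst (X c k)\<bar> \<le> 2 * R + 1 \<and> \<bar>snd (X c k)\<bar> \<le> 2 * R + 1"
        using j p unfolding k_def up[OF c, symmetric] up_def by auto
      have st: "\<bar>fst (X c (i + 1)) - fst (X c i)\<bar> \<le> 1 \<and> \<bar>snd (X c (i + 1)) - snd (X c i)\<bar> \<le> 1" for i
        using pathD[OF fam_path[OF F c], of i] unfolding units_def by (auto simp: prod_eq_iff)
      have bR: "R \<ge> 0" using j by linarith
      have "\<bar>fst (X c k)\<bar> \<le> int N" "\<bar>snd (X c k)\<bar> \<le> int N" using b0 N bR by auto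
      then obtain k0 where k0: "X c0 k0 = X c k + v" "X c0 (k0 + 1) = X c (k + 1) + v"
        "X c0 (k0 - 1) = X c (k - 1) + v" using v(3) c unfolding window_def by blast
      have "\<bar>fst (X c (k + 1))\<bar> \<le> int N" "\<bar>snd (X c (k + 1))\<bar> \<le> int N" using b0 st[of k] N bR by auto
      then obtain k1 where k1: "X c0 k1 = X c (k + 1) + v" "X c0 (k1 + 1) = X c (k + 1 + 1) + v"
        "X c0 (k1 - 1) = X c (k + 1 - 1) + v" using v(3) c unfolding window_def by blast
      have "\<bar>fst (X c (k - 1))\<bar> \<le> int N" "\<bar>snd (X c (k - 1))\<bar> \<le> int N" using b0 st[of "k - 1"] N bR by auto
      then obtain k2 where k2: "X c0 k2 = X c (k - 1) + v" "X c0 (k2 + 1) = X c (k - 1 + 1) + v"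
        "X c0 (k2 - 1) = X c (k - 1 - 1) + v" using v(3) c unfolding window_def by blast
      \<comment> \<open>The three windows return unrelated indices; they are consecutive because
        \<open>c0\<close> uses each edge only once.\<close>
      have "mid (X c0) (k1 - 1) = mid (X c0) k0" using k0 k1 by (simp add: mid_def)
      then have k1': "k1 = k0 + 1" using fam_inj[OF F _ c0 c0] by force
      have "mid (X c0) k2 = mid (X c0) (k0 - 1)" using k0 k2 by (simp add: mid_def)
      then have k2': "k2 = k0 - 1" using fam_inj[OF F _ c0 c0] by force
      have "surv p (X c0 k0)" using par[OF c, of k] by (simp add: k0(1) surv_add[OF v(1)] k_def)
      then have "2 dvd k0 - r c0" using par[OF c0] by simp
      then obtain j0 where j0: "k0 = r c0 + 2*j0" by (metis dvdE diff_add_cancel add.commute)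
      have eq: "Der p r X c0 i' = Der p r X c i + v'" if "X c0 (r c0 + 2*i') = X c (r c + 2*i) + v" for i i'
      proof (rule up_inj)
        show "up p (Der p r X c0 i') = up p (Der p r X c i + v')"
          using up_add[of p "Der p r X c i" 0 v'] by (simp add: up[OF c] up[OF c0] that uv)
      qed
      have "X c0 (r c0 + 2*(j0+1)) = X c (r c + 2*(j+1)) + v"
        using k1(2) unfolding k1' j0 k_def by (simp add: algebra_simps)
      moreover have "X c0 (r c0 + 2*(j0-1)) = X c (r c + 2*(j-1)) + v"
        using k2(3) unfolding k2' j0 k_def by (simp add: algebra_simps)
      moreover have "X c0 (r c0 + 2*j0) = X c (r c + 2*j) + v" using k0(1) unfolding j0 k_def .
      ultimately show "\<exists>k'. Der p r X c0 k' = Der p r X c j + v' \<and>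
            Der p r X c0 (k' + 1) = Der p r X c (j + 1) + v' \<and>
            Der p r X c0 (k' - 1) = Der p r X c (j - 1) + v'"
        using eq by blast
    qed
    ultimately show "\<exists>v. even (fst v + snd v) \<and> window I (Der p r X) c0 R v" by blast
  qed
  then show ?thesis using p L by blast
qed

section \<open>Parents of finite sets of edges\<close>

definition choices :: "(int \<times> int) list" where
  "choices = [(0, 1), (0, -1), (1, 1), (1, -1)]"

definition unit_list :: "pt list" where
  "unit_list = [(1,0), (-1,0), (0,1), (0,-1)]"

text \<open>The end points are doubled, like the edges, so \<open>v\<close> in \<open>deg\<close>,
  \<open>small\<close> and \<open>in_pinwheel\<close> is a doubled vertex.\<close>

definition ends :: "pt \<Rightarrow> pt list" where
  "ends m = (if odd (fst m) then [m - (1,0), m + (1,0)] else [m - (0,1), m + (0,1)])"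

definition deg :: "pt list \<Rightarrow> pt \<Rightarrow> nat" where
  "deg L v = length (filter (\<lambda>m. List.member unit_list (m - v)) L)"

text \<open>A set of edges of distinct curves has at most two edges at each vertex, so it has at most four
  elements if it is contained in a small set.\<close>

definition small :: "pt list \<Rightarrow> bool" where
  "small L \<longleftrightarrow> length L \<le> 6 \<and> list_ex (\<lambda>v. length L \<le> 4 + (deg L v - 2)) (concat (map ends L))"

text \<open>The last four entries are the quarter turns of \<open>(2, t)\<close>: edges attached at
  right angles to the outer ends of the four arms.\<close>

definition pinwheel :: "int \<Rightarrow> pt list" where
  "pinwheel t = unit_list @ map (\<lambda>(x, y). (x, t * y)) [(2,1), (-1,2), (-2,-1), (1,-2)]"

definition in_pinwheel :: "pt list \<Rightarrow> bool" where
  "in_pinwheel L \<longleftrightarrow> length L \<le> 8 \<and> list_ex (\<lambda>v. list_ex (\<lambda>t. list_all (\<lambda>m. List.member (pinwheel t) (m - v)) L) [1, -1])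
    (concat (map ends L))"

text \<open>All four pairs of parity and sign are tried, because the pair at the next level is
  unknown once a vertex has been moved to the origin. A \<open>small\<close> set closes its branch,
  as it cannot hold edges of five distinct curves.\<close>

fun settles :: "(pt list \<Rightarrow> bool) \<Rightarrow> nat \<Rightarrow> pt list \<Rightarrow> bool" where
  "settles Q 0 L \<longleftrightarrow> small L \<or> Q L"
| "settles Q (Suc n) L \<longleftrightarrow> small L \<or> Q L \<or>
     list_all (\<lambda>(p, t). settles Q n (remdups (map (parent p t) L))) choices"

text \<open>The edges whose doubled midpoint has squared norm 1, 5, 9 or 13, that is, norm below
  \<open>sqrt 15\<close>.\<close>

definition disc24 :: "pt list" where
  "disc24 = unit_list @ [(1,2),(1,-2),(-1,2),(-1,-2),(2,1),(2,-1),(-2,1),(-2,-1),(3,0),(-3,0),(0,3),(0,-3),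
     (3,2),(3,-2),(-3,2),(-3,-2),(2,3),(2,-3),(-2,3),(-2,-3)]"

lemma disc24_settles: "settles in_pinwheel 4 disc24" by code_simp

text \<open>The next level after a pinwheel is forced. A kept centre with sign \<open>s\<close>
  gives a small set at once, and a dying centre gives one after at most one further level. What
  remains is a kept centre with sign \<open>- s\<close>, and then the parents lie in the pinwheel of
  sign \<open>- s\<close>.\<close>

lemma pinwheel_table:
  "list_all (\<lambda>s. small (remdups (map (parent 0 s) (pinwheel s))) \<and>
     list_all (\<lambda>m. List.member (pinwheel (- s)) (parent 0 (- s) m)) (pinwheel s) \<and>
     list_all (\<lambda>t. settles (\<lambda>_. False) 1 (remdups (map (parent 1 t) (pinwheel s)))) [1, -1]) [1, -1]"
  by code_simp

definition at_vertex :: "pt \<Rightarrow> pt \<Rightarrow> bool" where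
  "at_vertex v m \<longleftrightarrow> m - v - v \<in> units"

definition covers :: "pt list \<Rightarrow> pt \<Rightarrow> pt set \<Rightarrow> bool" where
  "covers L v K \<longleftrightarrow> (\<forall>m\<in>K. m - v - v \<in> set L)"

lemma set_unit_list [simp]: "set unit_list = units"
  by (simp add: unit_list_def units_def)

lemma edge_dying:
  assumes "edge_pt m"
  shows "\<exists>B u. \<not> surv p B \<and> u \<in> units \<and> m = B + B + u"
proof -
  obtain X Y where m: "m = (X, Y)" by (metis prod.collapse)
  have o: "odd (X + Y)" using assms by (simp add: edge_pt_def m)
  show ?thesis
  proof (cases "odd X")
    case True
    then obtain i j where "X = 2*i+1" "Y = 2*j" using o by (metis oddE evenE even_add)
    then have *: "m = (i,j) + (i,j) + (1,0)" "m = (i+1,j) + (i+1,j) + (-1,0)" by (simp_all add: m)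
    have "\<not> surv p (i,j) \<or> \<not> surv p (i+1,j)" by simp
    then show ?thesis using * unfolding units_def by (metis insertCI)
  next
    case False
    then obtain i j where "X = 2*i" "Y = 2*j+1" using o by (metis oddE evenE even_add)
    then have *: "m = (i,j) + (i,j) + (0,1)" "m = (i,j+1) + (i,j+1) + (0,-1)" by (simp_all add: m)
    have "\<not> surv p (i,j) \<or> \<not> surv p (i,j+1)" by simp
    then show ?thesis using * unfolding units_def by (metis insertCI)
  qed
qed

lemma dn_up_add: "surv q a \<Longrightarrow> dn (p + q) (up p b + a) = b + dn q a"
  by (metis up_add up_dn dn_up)

lemma surv_double: "surv (2 * p) M \<longleftrightarrow> even (fst M + snd M)"
  by (simp add: surv_def)

text \<open>Moving the vertex \<open>v\<close> to the origin replaces \<open>p\<close> by a parity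
  and multiplies \<open>t\<close> by \<open>eps (fst v)\<close>. This is why a search around the
  origin with four cases per level is enough.\<close>

lemma parent_translate:
  assumes m: "edge_pt m" and t: "t \<in> {1, -1}" and p': "p' = (p + fst v + snd v) mod 2"
  shows "parent p t (m + v + v) = parent p' (t * eps (fst v)) m + dn (p - p') v + dn (p - p') v"
proof -
  obtain B u where B: "\<not> surv p' B" and u: "u \<in> units" and mB: "m = B + B + u"
    using edge_dying[OF m] by blast
  have "even (p + fst v + snd v - p')" unfolding p' by presburger
  then have v: "surv (p - p') v" by (simp add: surv_def) presburger
  have Bv: "\<not> surv p (B + v)" using B v by (auto simp: surv_def)
  have e: "m + v + v = (B + v) + (B + v) + u" by (simp add: mB algebra_simps)
  have f: "face t (B + v) u = face (t * eps (fst v)) B u + (v + v)"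
    by (simp add: face_def eps_add mult.assoc mult.commute algebra_simps)
  have s: "surv (2 * p') (face (t * eps (fst v)) B u)"
    using face_odd[OF u tau_pm[OF t], of "fst v" B] by (auto simp: surv_double)
  have vv: "v + v = up (2 * (p - p')) (dn (p - p') v + dn (p - p') v)"
    using up_add[of "p - p'" "dn (p - p') v" "p - p'" "dn (p - p') v"] by (simp add: up_dn[OF v])
  have "parent p t (m + v + v) = dn (2 * (p - p') + 2 * p') (v + v + face (t * eps (fst v)) B u)"
    unfolding e parent_eq[OF Bv u] f by (simp add: add.commute algebra_simps)
  also have "\<dots> = dn (p - p') v + dn (p - p') v + dn (2 * p') (face (t * eps (fst v)) B u)"
    unfolding vv by (rule dn_up_add[OF s])
  also have "dn (2 * p') (face (t * eps (fst v)) B u) = parent p' (t * eps (fst v)) m"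
    unfolding mB parent_eq[OF B u] ..
  finally show ?thesis by (simp add: add.commute add.left_commute)
qed

lemma edge_pt_diff2: "edge_pt (m - v - v) \<longleftrightarrow> edge_pt m"
  by (simp add: edge_pt_def)

lemma parent_edge_pt:
  assumes m: "edge_pt m" and t: "t \<in> {1, -1}"
  shows "edge_pt (parent p t m)"
proof -
  obtain B u where B: "\<not> surv p B" and u: "u \<in> units" and mB: "m = B + B + u"
    using edge_dying[OF m] by blast
  have "even (fst (face t B u) + snd (face t B u))" using face_odd[OF u t] by simp
  then have "up (2 * p) (parent p t m) = face t B u"
    unfolding mB parent_eq[OF B u] by (intro up_dn) (simp add: surv_double)
  then have "odd (snd (up (2 * p) (parent p t m)))" using face_odd[OF u t] by simp
  then show ?thesis by (simp add: up_def edge_pt_def)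
qed

lemma covers_step:
  assumes K: "\<forall>m\<in>K. edge_pt m" and c: "covers L v K" and t: "t \<in> {1, -1}"
    and p': "p' = (p + fst v + snd v) mod 2"
  shows "covers (remdups (map (parent p' (t * eps (fst v))) L)) (dn (p - p') v) (parent p t ` K)"
  unfolding covers_def
proof
  fix m' assume "m' \<in> parent p t ` K"
  then obtain m where m: "m \<in> K" "m' = parent p t m" by blast
  have e: "edge_pt (m - v - v)" using K m by (simp add: edge_pt_diff2)
  have "parent p t (m - v - v + v + v) = parent p' (t * eps (fst v)) (m - v - v) + dn (p - p') v + dn (p - p') v"
    by (rule parent_translate[OF e t p'])
  then have "m' - dn (p - p') v - dn (p - p') v = parent p' (t * eps (fst v)) (m - v - v)"
    by (simp add: m(2))
  then show "m' - dn (p - p') v - dn (p - p') v \<in> set (remdups (map (parent p' (t * eps (fst v))) L))"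
    using c m(1) by (auto simp: covers_def)
qed

lemma card_le_filter:
  assumes "finite K" "inj_on f K" "f ` K \<subseteq> set L"
  shows "card K \<le> length (filter (\<lambda>x. \<not> P x) L) + card {m \<in> K. P (f m)}"
proof -
  have "card K \<le> card {m \<in> K. \<not> P (f m)} + card {m \<in> K. P (f m)}"
  proof -
    have "K = {m \<in> K. \<not> P (f m)} \<union> {m \<in> K. P (f m)}" by blast
    then show ?thesis by (metis card_Un_le)
  qed
  moreover have "card {m \<in> K. \<not> P (f m)} = card (f ` {m \<in> K. \<not> P (f m)})"
    by (intro card_image[symmetric] inj_on_subset[OF assms(2)]) auto
  moreover have "card (f ` {m \<in> K. \<not> P (f m)}) \<le> card (set (filter (\<lambda>x. \<not> P x) L))"
    using assms(3) by (intro card_mono) auto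
  moreover have "card (set (filter (\<lambda>x. \<not> P x) L)) \<le> length (filter (\<lambda>x. \<not> P x) L)"
    by (rule card_length)
  ultimately show ?thesis by linarith
qed

lemma ends_double:
  assumes "edge_pt m" "w \<in> set (ends m)"
  shows "\<exists>w'. w = w' + w'"
proof -
  have "even (fst w)" "even (snd w)" using assms by (auto simp: ends_def edge_pt_def split: if_splits)
  then obtain a b where "fst w = 2*a" "snd w = 2*b" by (metis evenE)
  then show ?thesis by (intro exI[of _ "(a,b)"]) (simp add: prod_eq_iff)
qed

lemma card_small:
  assumes K: "finite K" "covers L v K" and L: "\<forall>m\<in>set L. edge_pt m" and s: "small L"
    and deg2: "\<And>v. card {m \<in> K. at_vertex v m} \<le> 2"
  shows "card K \<le> 4"
proof -
  obtain w m0 where w: "length L \<le> 4 + (deg L w - 2)" "m0 \<in> set L" "w \<in> set (ends m0)"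
    using s by (auto simp: small_def list_ex_iff)
  obtain w' where w': "w = w' + w'" using ends_double w L by blast
  let ?P = "\<lambda>m. m - w \<in> units"
  have "card K \<le> length (filter (\<lambda>x. \<not> ?P x) L) + card {m \<in> K. ?P (m - v - v)}"
    using K by (intro card_le_filter) (auto simp: inj_on_def covers_def)
  moreover have "{m \<in> K. ?P (m - v - v)} = {m \<in> K. at_vertex (v + w') m}"
    by (simp add: at_vertex_def w' algebra_simps)
  moreover have "length (filter (\<lambda>x. \<not> ?P x) L) + deg L w = length L"
    using sum_length_filter_compl[of ?P L] by (simp add: deg_def)
  moreover have "card K \<le> length L"
  proof -
    have "card K = card ((\<lambda>m. m - v - v) ` K)" by (intro card_image[symmetric]) (simp add: inj_on_def)
    also have "\<dots> \<le> card (set L)" using K by (intro card_mono) (auto simp: covers_def)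
    finally show ?thesis using card_length[of L] by linarith
  qed
  ultimately show ?thesis using w(1) deg2[of "v + w'"] by (cases "deg L w \<le> 2") auto
qed

text \<open>\<open>K n\<close> consists of the ancestors at level \<open>n\<close> of edges of at least five distinct curves.\<close>

locale shrinking =
  fixes p t :: "nat \<Rightarrow> int" and K :: "nat \<Rightarrow> pt set"
  assumes p: "\<And>n. p n \<in> {0, 1}" and t: "\<And>n. t n \<in> {1, -1}"
    and step: "\<And>n. K (Suc n) = parent (p n) (t n) ` K n"
    and edge: "\<And>n m. m \<in> K n \<Longrightarrow> edge_pt m"
    and fin: "\<And>n. finite (K n)"
    and deg2: "\<And>n v. card {m \<in> K n. at_vertex v m} \<le> 2"
    and card5: "\<And>n. card (K n) \<ge> 5"
begin

lemma not_small: "covers L v (K n) \<Longrightarrow> \<forall>m\<in>set L. edge_pt m \<Longrightarrow> \<not> small L"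
  using card_small[OF fin _ _ _ deg2] card5[of n] by fastforce

text \<open>The actual parity and sign form one of the \<open>choices\<close>, and
  \<open>not_small\<close> rules out the closed branches.\<close>

lemma settles_covers:
  assumes "settles Q j L" "covers L v (K n)" "\<forall>m\<in>set L. edge_pt m"
  shows "\<exists>n' v' L'. covers L' v' (K n') \<and> Q L' \<and> (\<forall>m\<in>set L'. edge_pt m)"
  using assms
proof (induction j arbitrary: L v n)
  case 0
  then have "Q L" using not_small[OF 0(2,3)] by simp
  then show ?case using 0(2,3) by blast
next
  case (Suc j)
  define p' where "p' = (p n + fst v + snd v) mod 2"
  define t' where "t' = t n * eps (fst v)"
  define L' where "L' = remdups (map (parent p' t') L)"
  have t': "t' \<in> {1, -1}" unfolding t'_def by (rule tau_pm[OF t])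
  have c: "(p', t') \<in> set choices" using t' by (auto simp: choices_def p'_def)
  show ?case
  proof (cases "Q L")
    case False
    then have "settles Q j L'"
      using Suc.prems(1) not_small[OF Suc.prems(2,3)] c unfolding L'_def by (auto simp: list_all_iff)
    moreover have "covers L' (dn (p n - p') v) (K (Suc n))"
      unfolding step L'_def t'_def
      by (rule covers_step[OF _ Suc.prems(2) t p'_def]) (use edge in blast)
    moreover have "\<forall>m\<in>set L'. edge_pt m"
      using Suc.prems(3) parent_edge_pt[OF _ t'] by (auto simp: L'_def)
    ultimately show ?thesis by (rule Suc.IH)
  qed (use Suc.prems in blast)
qed

lemma pinwheel_edge_pt: "s \<in> {1, -1} \<Longrightarrow> m \<in> set (pinwheel s) \<Longrightarrow> edge_pt m"
  by (auto simp: pinwheel_def unit_list_def edge_pt_def)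

lemma pinwheel_step:
  assumes s: "s \<in> {1, -1}" and c: "covers (pinwheel s) v (K n)"
  shows "surv (p n) v" "t n * eps (fst v) = - s" "covers (pinwheel (- s)) (dn (p n) v) (K (Suc n))"
proof -
  define p' where "p' = (p n + fst v + snd v) mod 2"
  define t' where "t' = t n * eps (fst v)"
  have t': "t' \<in> {1, -1}" unfolding t'_def by (rule tau_pm[OF t])
  have p': "p' = 0 \<or> p' = 1" by (auto simp: p'_def)
  define L' where "L' = remdups (map (parent p' t') (pinwheel s))"
  have cv: "covers L' (dn (p n - p') v) (K (Suc n))"
    unfolding step L'_def t'_def
    by (rule covers_step[OF _ c t p'_def]) (use edge in blast)
  have e: "\<forall>m\<in>set L'. edge_pt m"
    using pinwheel_edge_pt[OF s] parent_edge_pt[OF _ t'] by (auto simp: L'_def)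
  have tab: "small (remdups (map (parent 0 s) (pinwheel s)))"
    "\<forall>m\<in>set (pinwheel s). parent 0 (- s) m \<in> set (pinwheel (- s))"
    "\<forall>t\<in>{1, -1}. settles (\<lambda>_. False) 1 (remdups (map (parent 1 t) (pinwheel s)))"
    using pinwheel_table s by (auto simp: list_all_iff simp del: settles.simps)
  have p0: "p' = 0"
  proof (rule ccontr)
    assume "p' \<noteq> 0"
    then have "p' = 1" using p' by simp
    then have "settles (\<lambda>_. False) 1 L'" using tab(3) t' unfolding L'_def by blast
    from settles_covers[OF this cv e] show False by blast
  qed
  have t's: "t' = - s"
  proof (rule ccontr)
    assume "t' \<noteq> - s"
    then have "t' = s" using s t' by auto
    then have "small L'" using tab(1) p0 unfolding L'_def by simp
    then show False using not_small[OF cv e] by blast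
  qed
  show "surv (p n) v" using p0 unfolding p'_def surv_def by presburger
  show "t n * eps (fst v) = - s" using t's unfolding t'_def .
  have "set L' \<subseteq> set (pinwheel (- s))" using tab(2) unfolding L'_def p0 t's by auto
  then show "covers (pinwheel (- s)) (dn (p n) v) (K (Suc n))"
    using cv unfolding covers_def p0 by auto
qed

end

section \<open>Contraction of distances into a disc of 24 edges\<close>

definition cpt :: "pt \<Rightarrow> complex" where
  "cpt v = Complex (of_int (fst v)) (of_int (snd v))"

lemma cpt_add: "cpt (v + w) = cpt v + cpt w"
  by (simp add: cpt_def complex_eq_iff)

lemma cpt_diff: "cpt (v - w) = cpt v - cpt w"
  by (simp add: cpt_def complex_eq_iff)

lemma cpt_eq [simp]: "cpt v = cpt w \<longleftrightarrow> v = w"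
  by (simp add: cpt_def complex_eq_iff prod_eq_iff)

lemma cpt_up: "cpt (up p v) = of_int p + (1 + \<i>) * cpt v"
  by (simp add: cpt_def up_def complex_eq_iff)

lemma cmod_units: "u \<in> units \<Longrightarrow> cmod (cpt u) = 1"
  by (auto simp: units_def cpt_def cmod_def)

lemma cmod_1i: "cmod (1 + \<i>) = sqrt 2"
  by (simp add: cmod_def)

lemma parent_contract:
  assumes m: "edge_pt m" and t: "t \<in> {1, -1}"
  shows "\<exists>w. cmod w = 1 \<and> of_int (2 * p) + (1 + \<i>) * cpt (parent p t m) = cpt m + w"
proof -
  obtain B u where B: "\<not> surv p B" and u: "u \<in> units" and mB: "m = B + B + u"
    using edge_dying[OF m] by blast
  define w where "w = sc (t * eps (fst B)) (sw u)"
  have w: "w \<in> units" unfolding w_def by (rule units_sw[OF u tau_pm[OF t]])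
  have "even (fst (face t B u) + snd (face t B u))" using face_odd[OF u t] by simp
  then have "up (2 * p) (parent p t m) = face t B u"
    unfolding mB parent_eq[OF B u] by (intro up_dn) (simp add: surv_double)
  also have "\<dots> = m + w" by (simp add: face_def mB w_def)
  finally have "cpt (up (2 * p) (parent p t m)) = cpt m + cpt w" by (simp only: cpt_add)
  then show ?thesis using cmod_units[OF w] by (auto simp only: cpt_up)
qed

lemma disc24_table:
  "list_all (\<lambda>a. list_all (\<lambda>b. odd (a + b) \<and> a * a + b * b < 15 \<longrightarrow> List.member disc24 (a, b))
     [-3,-2,-1,0,1,2,3]) [-3,-2,-1,0,1,2,3]"
  by code_simp

lemma disc24:
  assumes "edge_pt m" "cmod (cpt m) < sqrt 15"
  shows "m \<in> set disc24"
proof -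
  obtain a b where m: "m = (a, b)" by (metis prod.collapse)
  have "sqrt (of_int (a\<^sup>2 + b\<^sup>2)) < sqrt 15" using assms(2) by (simp add: m cpt_def cmod_def)
  then have "real_of_int (a\<^sup>2 + b\<^sup>2) < 15" by (simp only: real_sqrt_less_iff)
  then have l: "a\<^sup>2 + b\<^sup>2 < 15" by linarith
  moreover have "a\<^sup>2 \<ge> 0" "b\<^sup>2 \<ge> 0" by simp_all
  ultimately have "a\<^sup>2 < 16" "b\<^sup>2 < 16" by linarith+
  then have "\<bar>a\<bar>\<^sup>2 < 4\<^sup>2" "\<bar>b\<bar>\<^sup>2 < 4\<^sup>2" by simp_all
  then have "\<bar>a\<bar> < 4" "\<bar>b\<bar> < 4" using power2_less_imp_less[of _ "4::int"] by auto
  then have "a \<in> set [-3,-2,-1,0,1,2,3]" "b \<in> set [-3,-2,-1,0,1,2,3]" by auto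
  moreover have "odd (a + b) \<and> a * a + b * b < 15" using assms(1) l by (simp add: m edge_pt_def power2_eq_square)
  ultimately have "List.member disc24 (a, b)" using disc24_table unfolding list_all_iff by blast
  then show ?thesis by (simp add: m)
qed

context shrinking
begin

text \<open>The origin carried through the levels; edges are doubled, hence the comparison with
  \<open>2 * z n\<close> below.\<close>

primrec z :: "nat \<Rightarrow> complex" where
  "z 0 = 0"
| "z (Suc n) = (z n - of_int (p n)) / (1 + \<i>)"

lemma contraction:
  assumes D: "\<And>m. m \<in> K 0 \<Longrightarrow> cmod (cpt m) \<le> D" and "D \<ge> 0"
  shows "m \<in> K n \<Longrightarrow> cmod (cpt m - 2 * z n) \<le> sqrt 2 + 1 + D / sqrt 2 ^ n"
proof (induction n arbitrary: m)
  case 0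
  then have "cmod (cpt m) \<le> D" by (rule D)
  then show ?case by (simp add: add_nonneg_nonneg add_increasing)
next
  case (Suc n)
  obtain m0 where m0: "m0 \<in> K n" "m = parent (p n) (t n) m0" using Suc.prems unfolding step by blast
  obtain w where w: "cmod w = 1" "of_int (2 * p n) + (1 + \<i>) * cpt m = cpt m0 + w"
    using parent_contract[OF edge[OF m0(1)] t[of n], of "p n"] m0(2) by blast
  have ne: "(1 + \<i>) \<noteq> 0" by (simp add: complex_eq_iff)
  have zS: "(1 + \<i>) * z (Suc n) = z n - of_int (p n)" using ne by simp
  have "(1 + \<i>) * (cpt m - 2 * z (Suc n)) = (1 + \<i>) * cpt m - 2 * ((1 + \<i>) * z (Suc n))"
    by (simp add: algebra_simps del: z.simps)
  also have "\<dots> = (1 + \<i>) * cpt m - 2 * (z n - of_int (p n))" unfolding zS ..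
  also have "\<dots> = (cpt m0 - 2 * z n) + w" using w(2) by (simp add: algebra_simps)
  finally have "cmod ((1 + \<i>) * (cpt m - 2 * z (Suc n))) \<le> cmod (cpt m0 - 2 * z n) + 1"
    using norm_triangle_ineq[of "cpt m0 - 2 * z n" w] w(1) by simp
  then have "sqrt 2 * cmod (cpt m - 2 * z (Suc n)) \<le> sqrt 2 + 1 + D / sqrt 2 ^ n + 1"
    using Suc.IH[OF m0(1)] by (simp add: norm_mult cmod_1i)
  also have "\<dots> = sqrt 2 * (sqrt 2 + 1 + D / sqrt 2 ^ Suc n)"
    by (simp add: distrib_left field_simps)
  finally show ?case by (simp only: mult_le_cancel_left_pos real_sqrt_gt_0_iff zero_less_numeral)
qed

lemma covers_disc24: "\<exists>n v. covers disc24 v (K n)"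
proof -
  define D where "D = (\<Sum>m\<in>K 0. cmod (cpt m))"
  have D: "cmod (cpt m) \<le> D" if "m \<in> K 0" for m
    unfolding D_def using fin that by (intro member_le_sum) auto
  have D0: "D \<ge> 0" unfolding D_def by (intro sum_nonneg) simp
  have s2: "sqrt 2 > 1" by simp
  \<comment> \<open>Fits into the gap between \<open>2 * sqrt 2 + 1\<close> and
    \<open>sqrt 15\<close>, which is about 0.0446.\<close>
  define \<epsilon> :: real where "\<epsilon> = 0.04"
  have \<epsilon>: "\<epsilon> > 0" by (simp add: \<epsilon>_def)
  have pos: "0 < \<epsilon> / (D + 1)" using D0 \<epsilon> by (intro divide_pos_pos) auto
  have "inverse (sqrt 2) < 1" using s2 by (simp add: inverse_less_1_iff)
  then obtain n where n: "inverse (sqrt 2) ^ n < \<epsilon> / (D + 1)"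
    using real_arch_pow_inv[OF pos] by blast
  have "D / sqrt 2 ^ n = D * inverse (sqrt 2) ^ n" by (simp add: power_inverse divide_inverse)
  also have "\<dots> \<le> (D + 1) * inverse (sqrt 2) ^ n" by (intro mult_right_mono) auto
  also have "\<dots> < (D + 1) * (\<epsilon> / (D + 1))" using D0 n by (intro mult_strict_left_mono) auto
  also have "(D + 1) * (\<epsilon> / (D + 1)) = \<epsilon>" using D0 by simp
  finally have small: "D / sqrt 2 ^ n < \<epsilon>" .
  define v where "v = (round (Re (z n)), round (Im (z n)))"
  have rnd: "\<bar>2 * b - (a + a)\<bar> \<le> 1" if "\<bar>a - b\<bar> \<le> 1 / 2" for a b :: real
    using that unfolding abs_le_iff by linarith
  have "\<bar>Re (2 * z n - (cpt v + cpt v))\<bar> \<le> 1" "\<bar>Im (2 * z n - (cpt v + cpt v))\<bar> \<le> 1"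
    using rnd[OF of_int_round_abs_le[of "Re (z n)"]] rnd[OF of_int_round_abs_le[of "Im (z n)"]]
    by (simp_all add: v_def cpt_def)
  then have "(Re (2 * z n - (cpt v + cpt v)))\<^sup>2 + (Im (2 * z n - (cpt v + cpt v)))\<^sup>2 \<le> 1 + 1"
    by (intro add_mono) (simp_all only: abs_square_le_1)
  then have rv: "cmod (2 * z n - (cpt v + cpt v)) \<le> sqrt 2"
    unfolding cmod_def by (intro real_sqrt_le_mono) simp
  have s15: "2 * sqrt 2 + 1.04 < sqrt 15"
  proof (rule real_less_rsqrt)
    have "sqrt 2 < 1.4143" by (rule real_less_lsqrt) (auto simp: power2_eq_square)
    moreover have "(2 * sqrt 2 + 1.04)\<^sup>2 = 8 + 4.16 * sqrt 2 + 1.0816" by (simp add: power2_eq_square algebra_simps)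
    ultimately show "(2 * sqrt 2 + 1.04)\<^sup>2 < 15" by simp
  qed
  have "covers disc24 v (K n)" unfolding covers_def
  proof
    fix m assume m: "m \<in> K n"
    have "cpt (m - v - v) = (cpt m - 2 * z n) + (2 * z n - (cpt v + cpt v))"
      by (simp add: cpt_diff)
    then have "cmod (cpt (m - v - v)) \<le> cmod (cpt m - 2 * z n) + cmod (2 * z n - (cpt v + cpt v))"
      by (simp only: norm_triangle_ineq)
    also have "\<dots> \<le> sqrt 2 + 1 + 0.04 + sqrt 2"
      using contraction[OF D D0 m] small[unfolded \<epsilon>_def] rv by linarith
    also have "\<dots> < sqrt 15" using s15 by simp
    finally show "m - v - v \<in> set disc24"
      using edge[OF m] by (intro disc24) (simp_all add: edge_pt_diff2)
  qed
  then show ?thesis by blast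
qed

text \<open>The search leads into some pinwheel; from then on \<open>pinwheel_step\<close> keeps the
  edges in pinwheels and determines their centre and sign at every level.\<close>

lemma eventually_pinwheel:
  "\<exists>N x s. \<forall>n\<ge>N. s n \<in> {1, -1} \<and> covers (pinwheel (s n)) (x n) (K n) \<and> surv (p n) (x n) \<and>
     x (Suc n) = dn (p n) (x n) \<and> t n * eps (fst (x n)) = - s n \<and> s (Suc n) = - s n"
proof -
  obtain n v where c: "covers disc24 v (K n)" using covers_disc24 by blast
  have "\<forall>m\<in>set disc24. edge_pt m" by (auto simp: disc24_def unit_list_def edge_pt_def)
  from settles_covers[OF disc24_settles c this] obtain N v' L where
    L: "covers L v' (K N)" "in_pinwheel L" "\<forall>m\<in>set L. edge_pt m" by blast
  have "\<exists>m0\<in>set L. \<exists>w\<in>set (ends m0). \<exists>s0\<in>{1, -1}. \<forall>m\<in>set L. m - w \<in> set (pinwheel s0)"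
    using L(2) by (simp add: in_pinwheel_def list_ex_iff list_all_iff)
  then obtain w m0 s0 where w: "m0 \<in> set L" "w \<in> set (ends m0)" and s0: "s0 \<in> {1, -1}"
    and Lw: "\<forall>m\<in>set L. m - w \<in> set (pinwheel s0)" by blast
  obtain w' where w': "w = w' + w'" using ends_double w L(3) by blast
  have c0: "covers (pinwheel s0) (v' + w') (K N)"
    unfolding covers_def
  proof
    fix m assume "m \<in> K N"
    then have "m - v' - v' - w \<in> set (pinwheel s0)" using L(1) Lw unfolding covers_def by blast
    moreover have "m - v' - v' - w = m - (v' + w') - (v' + w')" by (simp add: w' prod_eq_iff)
    ultimately show "m - (v' + w') - (v' + w') \<in> set (pinwheel s0)" by metis
  qed
  define f where "f = rec_nat (v' + w') (\<lambda>i v. dn (p (N + i)) v)"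
  have f: "f 0 = v' + w'" "f (Suc i) = dn (p (N + i)) (f i)" for i by (simp_all add: f_def)
  define g where "g i = s0 * (-1) ^ i" for i :: nat
  have g: "g i \<in> {1, -1}" for i using s0 by (cases "even i") (auto simp: g_def)
  have cov: "covers (pinwheel (g i)) (f i) (K (N + i))" for i
  proof (induction i)
    case (Suc i)
    show ?case using pinwheel_step(3)[OF g Suc.IH] by (simp add: f g_def)
  qed (use c0 in \<open>simp add: f g_def\<close>)
  show ?thesis
  proof (intro exI[of _ N] exI[of _ "\<lambda>n. f (n - N)"] exI[of _ "\<lambda>n. g (n - N)"] allI impI)
    fix n assume "N \<le> n"
    then obtain i where n: "n = N + i" by (metis le_Suc_ex)
    note st = pinwheel_step[OF g cov[of i]]
    have "Suc n - N = Suc i" "n - N = i" by (simp_all add: n)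
    then show "g (n - N) \<in> {1, -1} \<and> covers (pinwheel (g (n - N))) (f (n - N)) (K n) \<and> surv (p n) (f (n - N)) \<and>
       f (Suc n - N) = dn (p n) (f (n - N)) \<and> t n * eps (fst (f (n - N))) = - g (n - N) \<and> g (Suc n - N) = - g (n - N)"
      using st(1,2) cov[of i] g[of i] by (simp add: n f g_def)
  qed
qed

end

section \<open>Folding curves fill discs\<close>

definition fills :: "real \<Rightarrow> (int \<Rightarrow> pt) \<Rightarrow> bool" where
  "fills \<rho> y \<longleftrightarrow> (\<exists>z. \<forall>m. edge_pt m \<and> cmod (cpt m - z) \<le> \<rho> \<longrightarrow> (\<exists>k. mid y k = m))"

lemma fills_mono: "fills \<rho> y \<Longrightarrow> \<rho>' \<le> \<rho> \<Longrightarrow> fills \<rho>' y"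
  unfolding fills_def by (meson order_trans)

text \<open>An edge within \<open>sqrt 2 * \<rho> - 1\<close> of the image of the centre has its
  parent within \<open>\<rho>\<close> of the centre. That parent lies on the derived path, so
  \<open>child_of_face\<close> puts the edge on the path.\<close>

lemma fills_step:
  assumes lv: "plvl p t r y" and pa: "lattice_path y" and t: "t \<in> {1, -1}"
    and f: "fills \<rho> (der p r y)"
  shows "fills (sqrt 2 * \<rho> - 1) y"
proof -
  obtain z where z: "\<And>m. edge_pt m \<Longrightarrow> cmod (cpt m - z) \<le> \<rho> \<Longrightarrow> \<exists>k. mid (der p r y) k = m"
    using f unfolding fills_def by blast
  have "\<exists>k. mid y k = m" if m: "edge_pt m" and d: "cmod (cpt m - (of_int (2 * p) + (1 + \<i>) * z)) \<le> sqrt 2 * \<rho> - 1" for m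
  proof -
    obtain w where w: "cmod w = 1" "of_int (2 * p) + (1 + \<i>) * cpt (parent p t m) = cpt m + w"
      using parent_contract[OF m t] by blast
    have "(1 + \<i>) * (cpt (parent p t m) - z) = (cpt m - (of_int (2 * p) + (1 + \<i>) * z)) + w"
      using w(2) by (simp add: algebra_simps)
    then have "cmod ((1 + \<i>) * (cpt (parent p t m) - z)) \<le> sqrt 2 * \<rho> - 1 + 1"
      using norm_triangle_ineq[of "cpt m - (of_int (2 * p) + (1 + \<i>) * z)" w] d w(1) by (simp only:)
    then have "sqrt 2 * cmod (cpt (parent p t m) - z) \<le> sqrt 2 * \<rho>" by (simp add: norm_mult cmod_1i)
    then have "cmod (cpt (parent p t m) - z) \<le> \<rho>" by simp
    from z[OF parent_edge_pt[OF m t] this] obtain j where j: "mid (der p r y) j = parent p t m" by blast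
    obtain B u where B: "\<not> surv p B" and u: "u \<in> units" and mB: "m = B + B + u"
      using edge_dying[OF m] by blast
    have "even (fst (face t B u) + snd (face t B u))" using face_odd[OF u t] by simp
    then have "up (2 * p) (parent p t m) = face t B u"
      unfolding mB parent_eq[OF B u] by (intro up_dn) (simp add: surv_double)
    then have "up (2 * p) (mid (der p r y) j) = face t B u" by (simp add: j)
    from child_of_face[OF lv pa t B u this] show ?thesis unfolding mB by auto
  qed
  then show ?thesis unfolding fills_def by blast
qed

text \<open>The folding sequence whose fold signs, from the finest level upwards, are \<open>ss\<close>.\<close>

fun weave :: "int \<Rightarrow> int list \<Rightarrow> int list" where
  "weave b [] = [b]"
| "weave b (x # xs) = b # x # weave (- b) xs"

fun folds :: "int list \<Rightarrow> int list" where
  "folds [] = []"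
| "folds (s # ss) = weave s (folds ss)"

fun walk :: "pt \<Rightarrow> pt \<Rightarrow> int list \<Rightarrow> pt list" where
  "walk P d [] = [P + P + d]"
| "walk P d (a # as) = (P + P + d) # walk (P + d) (sc a (rot d)) as"

lemma length_weave: "length (weave b xs) = 2 * length xs + 1"
  by (induction b xs rule: weave.induct) auto

lemma nth_weave:
  "i \<le> length xs \<Longrightarrow> weave b xs ! (2 * i) = b * eps (int i)"
  "i < length xs \<Longrightarrow> weave b xs ! (2 * i + 1) = xs ! i"
proof (induction b xs arbitrary: i rule: weave.induct)
  case (1 b)
  { case 1 then show ?case by (simp add: eps_def) }
  { case 2 then show ?case by simp }
next
  case (2 b x xs)
  { case 1 then show ?case using 2(1)[of "i - 1"] by (cases i) (auto simp: eps_def) }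
  { case prems: 2 then show ?case using 2(2)[of "i - 1"] by (cases i) auto }
qed

text \<open>Splitting off alternating terms \<open>n\<close> times and weaving them back exhibits a
  block determined by \<open>n\<close> signs, so only \<open>2 ^ n\<close> patterns need to be
  examined.\<close>

lemma folds_of_complete_folding:
  "complete_folding a \<Longrightarrow> (\<And>k. a k \<in> {1, -1}) \<Longrightarrow>
    \<exists>k ss. length ss = n \<and> set ss \<subseteq> {1, -1} \<and> (\<forall>i<length (folds ss). a (k + 1 + int i) = folds ss ! i)"
proof (induction n arbitrary: a)
  case 0
  then show ?case by simp
next
  case (Suc n)
  obtain r s where s: "s \<in> {1, -1}" and alt: "\<And>l. a (r + 2*l) = s * eps l"
    and cf: "complete_folding (\<lambda>j. a (r + 1 + 2*j))"
    using complete_folding_split[OF Suc.prems(1)] by (elim exE conjE) (rule that, auto)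
  obtain k ss where ss: "length ss = n" "set ss \<subseteq> {1, -1}"
    and k: "\<And>i. i < length (folds ss) \<Longrightarrow> a (r + 1 + 2*(k + 1 + int i)) = folds ss ! i"
    using Suc.IH[OF cf Suc.prems(2)] by blast
  \<comment> \<open>The block starts with the alternating term of index
    \<open>r + 2 * (k + 1)\<close>.\<close>
  define b where "b = s * eps (k + 1)"
  have "a (r + 1 + 2*k + 1 + int i) = weave b (folds ss) ! i" if "i < length (weave b (folds ss))" for i
  proof (cases "even i")
    case True
    then obtain j where j: "i = 2 * j" by (rule evenE)
    have "r + 1 + 2*k + 1 + int i = r + 2 * (k + 1 + int j)" by (simp add: j)
    then have "a (r + 1 + 2*k + 1 + int i) = s * eps (k + 1 + int j)" by (simp only: alt)
    also have "\<dots> = b * eps (int j)" unfolding b_def eps_add[of "k + 1"] by (rule mult.assoc[symmetric])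
    also have "\<dots> = weave b (folds ss) ! (2 * j)"
      using that by (intro nth_weave(1)[symmetric]) (simp add: j length_weave)
    finally show ?thesis by (simp only: j)
  next
    case False
    then obtain j where j: "i = 2 * j + 1" by (rule oddE)
    have jl: "j < length (folds ss)" using that by (simp add: j length_weave)
    have "r + 1 + 2*k + 1 + int i = r + 1 + 2 * (k + 1 + int j)" by (simp add: j)
    then have "a (r + 1 + 2*k + 1 + int i) = folds ss ! j" by (simp only: k[OF jl])
    then show ?thesis using nth_weave(2)[OF jl, of b] by (simp only: j)
  qed
  then have "\<forall>i<length (folds (b # ss)). a (r + 1 + 2*k + 1 + int i) = folds (b # ss) ! i" by simp
  moreover have "set (b # ss) \<subseteq> {1, -1}" "length (b # ss) = Suc n"
    using ss s eps_pm[of "k + 1"] by (auto simp: b_def)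
  ultimately show ?case by blast
qed

lemma walk_mid:
  assumes T: "turns y a" and as: "\<And>i. i < length as \<Longrightarrow> a (k + int i) = as ! i"
  shows "set (walk (y k) (y (k + 1) - y k) as) \<subseteq> range (mid y)"
  using as
proof (induction as arbitrary: k)
  case Nil
  then show ?case by (auto simp: mid_def intro!: image_eqI[of _ _ k])
next
  case (Cons b as)
  have b: "a k = b" using Cons.prems[of 0] by simp
  have "y (k + 2) - y (k + 1) = sc (a k) (rot (y (k + 1) - y k))" using T by (auto simp: turns_def)
  then have "set (walk (y (k + 1)) (sc b (rot (y (k + 1) - y k))) as) \<subseteq> range (mid y)"
    using Cons.IH[of "k + 1"] Cons.prems[of "Suc i" for i] b by (simp add: add.assoc)
  moreover have "y k + (y (k + 1) - y k) = y (k + 1)" by simp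
  ultimately show ?case by (auto simp: mid_def intro!: image_eqI[of _ _ k])
qed

definition neighbours :: "pt list" where
  "neighbours = [(0,0), (1,1), (1,-1), (-1,1), (-1,-1), (2,0), (-2,0), (0,2), (0,-2)]"

text \<open>Certificate for \<open>six_folds\<close>: each of the 64 walks, of 64 edges each,
  contains all the \<open>neighbours\<close> of one of these points.\<close>

definition centres :: "pt list" where
  "centres = [(5,-2), (2,7), (2,-7), (-6,3), (-4,-9), (-7,-4), (-1,6), (9,-6), (11,4), (2,3), (6,-7),
     (0,-5), (6,-11), (-5,-2), (-2,11), (14,-5), (-13,4), (6,11), (5,8), (9,6), (5,-6), (5,6)]"

definition has_centre :: "pt list \<Rightarrow> bool" where
  "has_centre W \<longleftrightarrow> list_ex (\<lambda>z. list_all (\<lambda>d. List.member W (z + d)) neighbours) centres"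

fun all_signs :: "nat \<Rightarrow> int list list" where
  "all_signs 0 = [[]]"
| "all_signs (Suc n) = concat (map (\<lambda>ss. [1 # ss, -1 # ss]) (all_signs n))"

lemma all_signs: "length ss = n \<Longrightarrow> set ss \<subseteq> {1, -1} \<Longrightarrow> ss \<in> set (all_signs n)"
proof (induction n arbitrary: ss)
  case (Suc n)
  obtain s ss' where ss: "ss = s # ss'" using Suc.prems(1) by (auto simp: length_Suc_conv)
  have "ss' \<in> set (all_signs n)" "s \<in> {1, -1}" using Suc.IH[of ss'] Suc.prems by (auto simp: ss)
  then show ?case unfolding ss by auto
qed simp

lemma six_folds: "list_all (\<lambda>ss. has_centre (walk 0 (1, 0) (folds ss))) (all_signs 6)"
  by code_simp

text \<open>Multiplication by \<open>d\<close> in the Gaussian integers. For a unit \<open>d\<close>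
  it is a rotation, which reduces the check to walks that leave the origin in direction
  \<open>(1, 0)\<close>.\<close>

definition lin :: "pt \<Rightarrow> pt \<Rightarrow> pt" where
  "lin d v = sc (fst v) d + sc (snd v) (rot d)"

lemma lin_add: "lin d (v + w) = lin d v + lin d w"
  by (simp add: lin_def sc_def algebra_simps)

lemma lin_rot: "lin d (sc a (rot v)) = sc a (rot (lin d v))"
  by (simp add: lin_def sc_def rot_def algebra_simps)

lemma walk_lin: "walk (P + lin d Q) (lin d e) as = map (\<lambda>m. P + P + lin d m) (walk Q e as)"
proof (induction as arbitrary: Q e)
  case (Cons a as)
  show ?case
    using Cons.IH[of "Q + e" "sc a (rot e)"] by (simp add: lin_add lin_rot add.assoc add.left_commute)
qed (simp add: lin_add add.assoc add.left_commute)

lemma lin_neighbours_table: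
  "list_all (\<lambda>d. list_all (\<lambda>e. list_ex (\<lambda>e'. e = lin d e') neighbours) neighbours) unit_list"
  by code_simp

lemma lin_neighbours:
  assumes "d \<in> units" "e \<in> set neighbours"
  shows "\<exists>e'\<in>set neighbours. e = lin d e'"
  using lin_neighbours_table assms unfolding list_all_iff list_ex_iff set_unit_list by blast

lemma neighbours_table:
  "list_all (\<lambda>a. list_all (\<lambda>b. even (a + b) \<and> a * a + b * b < 8 \<longrightarrow> List.member neighbours (a, b))
     [-2,-1,0,1,2]) [-2,-1,0,1,2]"
  by code_simp

text \<open>Differences of doubled midpoints have an even coordinate sum, and the square of 2.8 is
  below 8; only the squared norms 0, 2 and 4 are left.\<close>

lemma close_edges:
  assumes "edge_pt m" "edge_pt z" "cmod (cpt m - cpt z) \<le> 2.8"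
  shows "m - z \<in> set neighbours"
proof -
  obtain a b where ab: "m - z = (a, b)" by (metis prod.collapse)
  have "sqrt (of_int (a\<^sup>2 + b\<^sup>2)) \<le> 2.8" using assms(3) ab unfolding cpt_diff[symmetric] by (simp add: cpt_def cmod_def)
  then have "real_of_int (a\<^sup>2 + b\<^sup>2) \<le> 2.8\<^sup>2" by (rule sqrt_le_D)
  then have "real_of_int (a\<^sup>2 + b\<^sup>2) < 8" by (simp add: power2_eq_square)
  then have l: "a\<^sup>2 + b\<^sup>2 < 8" by linarith
  moreover have "a\<^sup>2 \<ge> 0" "b\<^sup>2 \<ge> 0" by simp_all
  ultimately have "a\<^sup>2 < 9" "b\<^sup>2 < 9" by linarith+
  then have "\<bar>a\<bar>\<^sup>2 < 3\<^sup>2" "\<bar>b\<bar>\<^sup>2 < 3\<^sup>2" by simp_all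
  then have "\<bar>a\<bar> < 3" "\<bar>b\<bar> < 3" using power2_less_imp_less[of _ "3::int"] by auto
  then have "a \<in> set [-2,-1,0,1,2]" "b \<in> set [-2,-1,0,1,2]" by auto
  moreover have "even (a + b)"
  proof -
    have e: "a + b = (fst m + snd m) - (fst z + snd z)" using ab by (auto simp: prod_eq_iff)
    show ?thesis unfolding e using assms(1,2) by (simp only: edge_pt_def even_diff) simp
  qed
  moreover have "a * a + b * b < 8" using l by (simp add: power2_eq_square)
  ultimately have "List.member neighbours (a, b)" using neighbours_table unfolding list_all_iff by blast
  then show ?thesis by (simp add: ab)
qed

lemma fills_base:
  assumes pa: "lattice_path y" and T: "turns y a" and cf: "complete_folding a"
  shows "fills 2.8 y"
proof -
  have a: "a k \<in> {1, -1}" for k using T by (simp add: turns_def)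
  obtain k ss where ss: "length ss = 6" "set ss \<subseteq> {1, -1}"
    and k: "\<forall>i<length (folds ss). a (k + 1 + int i) = folds ss ! i"
    using folds_of_complete_folding[OF cf a, of 6] by blast
  define P where "P = y (k + 1)"
  define d where "d = y (k + 1 + 1) - y (k + 1)"
  have d: "d \<in> units" unfolding d_def by (rule pathD[OF pa])
  have "has_centre (walk 0 (1, 0) (folds ss))"
    using six_folds all_signs[OF ss] unfolding list_all_iff by blast
  then obtain z where z: "\<forall>e\<in>set neighbours. z + e \<in> set (walk 0 (1, 0) (folds ss))"
    by (auto simp: has_centre_def list_ex_iff list_all_iff)
  have "set (walk P d (folds ss)) \<subseteq> range (mid y)"
    unfolding P_def d_def by (rule walk_mid[OF T]) (use k in blast)
  moreover have "walk P d (folds ss) = map (\<lambda>m. P + P + lin d m) (walk 0 (1, 0) (folds ss))"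
  proof -
    have "lin d 0 = 0" "lin d (1, 0) = d" by (simp_all add: lin_def sc_def prod_eq_iff)
    then show ?thesis using walk_lin[of P d 0 "(1, 0)"] by simp
  qed
  ultimately have sub: "P + P + lin d (z + e) \<in> range (mid y)" if "e \<in> set neighbours" for e
    using z that by auto
  define z' where "z' = P + P + lin d z"
  have nb: "z' + e \<in> range (mid y)" if e: "e \<in> set neighbours" for e
  proof -
    obtain e' where "e' \<in> set neighbours" "e = lin d e'" using lin_neighbours[OF d e] by blast
    then show ?thesis using sub[of e'] by (simp add: z'_def lin_add add.assoc)
  qed
  have "0 \<in> set neighbours" by (simp add: neighbours_def zero_prod_def)
  from nb[OF this] have "edge_pt z'" using mid_edge_pt[OF pa] by auto
  have "\<exists>k. mid y k = m" if "edge_pt m" "cmod (cpt m - cpt z') \<le> 2.8" for m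
    using nb[OF close_edges[OF that(1) \<open>edge_pt z'\<close> that(2)]] by auto
  then show ?thesis unfolding fills_def by blast
qed

lemma folding_path_fills:
  "lattice_path y \<Longrightarrow> turns y a \<Longrightarrow> complete_folding a \<Longrightarrow> fills \<rho> y"
proof -
  have "fills (2.8 + real n / 10) y" if "lattice_path y" "turns y a" "complete_folding a" for n y a
    using that
  proof (induction n arbitrary: y a)
    case 0
    then show ?case using fills_base by simp
  next
    case (Suc n)
    obtain r s where alt: "\<And>l. a (r + 2*l) = s * eps l"
      and cf: "complete_folding (\<lambda>j. a (r + 1 + 2*j))"
      using complete_folding_split[OF Suc.prems(3)] by (elim exE conjE) (rule that, auto)
    obtain p t where t: "t \<in> {1, -1}" and lv: "plvl p t r y"
      using plvl_of_turns[OF Suc.prems(1,2) alt] by (elim bexE)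
    have "fills (2.8 + real n / 10) (der p r y)"
      by (rule Suc.IH[OF path_der[OF lv Suc.prems(1) t] turns_der[OF lv Suc.prems(1) t Suc.prems(2) alt] cf])
    then have "fills (sqrt 2 * (2.8 + real n / 10) - 1) y" by (rule fills_step[OF lv Suc.prems(1) t])
    \<comment> \<open>Bounding \<open>sqrt 2\<close> below by 1.4 gives
      \<open>2.92 + 0.14 * n\<close> on the right, so 0.1 is a safe uniform gain per level.\<close>
    moreover have "2.8 + real (Suc n) / 10 \<le> sqrt 2 * (2.8 + real n / 10) - 1"
    proof -
      have "1.4 \<le> sqrt 2" by (rule real_le_rsqrt) (simp add: power2_eq_square)
      then have "1.4 * (2.8 + real n / 10) \<le> sqrt 2 * (2.8 + real n / 10)" by (intro mult_right_mono) auto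
      then show ?thesis by (simp add: field_simps)
    qed
    ultimately show ?case by (rule fills_mono)
  qed
  note * = this
  assume "lattice_path y" "turns y a" "complete_folding a"
  from *[OF this, of "nat \<lceil>10 * \<rho>\<rceil>"] show "fills \<rho> y"
    by (rule fills_mono) linarith
qed

section \<open>From coverings to families of lattice paths\<close>

definition pos :: "curve \<Rightarrow> int \<Rightarrow> pt" where
  "pos c k = (\<lfloor>Re (fst (the (c k)))\<rfloor>, \<lfloor>Im (fst (the (c k)))\<rfloor>)"

lemma lattice_cpt: "x \<in> lattice \<longleftrightarrow> (\<exists>v. x = cpt v)"
  by (auto simp: lattice_def lattice_pt_def cpt_def)

lemma unit_ex: "e \<in> {1, -1, \<i>, -\<i>} \<Longrightarrow> \<exists>u\<in>units. e = cpt u"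
  by (auto simp: units_def cpt_def complex_eq_iff)

lemma cpt_rot: "s \<in> {1, -1} \<Longrightarrow> cpt (sc s (rot u)) = \<i> powi s * cpt u"
  by (auto simp: cpt_def sc_def rot_def complex_eq_iff)

lemma pos_eq: "c k = Some (cpt v, e) \<Longrightarrow> pos c k = v"
  by (simp add: pos_def cpt_def)

lemma associated_UNIV:
  assumes "associated_curve UNIV a c"
  shows "c k = Some (cpt (pos c k), cpt (pos c (k + 1) - pos c k))" (is ?seg)
    and "lattice_path (pos c)" and "turns (pos c) a"
proof -
  have dom: "\<exists>x e. c k = Some (x, e)" for k
  proof -
    have "k \<in> dom c" using assms by (simp add: associated_curve_def)
    then show ?thesis by auto
  qed
  have ex: "\<exists>v u. c k = Some (cpt v, cpt u) \<and> u \<in> units" for k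
  proof -
    obtain x e where xe: "c k = Some (x, e)" using dom by blast
    then have "x \<in> lattice" "e \<in> {1, -1, \<i>, -\<i>}" using assms unfolding associated_curve_def by blast+
    then show ?thesis using xe unit_ex[of e] by (auto simp: lattice_cpt)
  qed
  have seg: "c k = Some (cpt (pos c k), cpt (pos c (k + 1) - pos c k)) \<and> pos c (k + 1) - pos c k \<in> units" for k
  proof -
    obtain v u where vu: "c k = Some (cpt v, cpt u)" "u \<in> units" using ex by blast
    obtain v' u' where vu': "c (k + 1) = Some (cpt v', cpt u')" using ex by blast
    have "cpt v + cpt u = cpt v'" using assms vu vu' unfolding associated_curve_def by blast
    then have "v' = v + u" unfolding cpt_add[symmetric] by simp
    then show ?thesis using vu pos_eq[of c k, OF vu(1)] pos_eq[of c "k + 1", OF vu'] by simp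
  qed
  show ?seg using seg by blast
  show "lattice_path (pos c)" using seg by (simp add: lattice_path_def)
  show "turns (pos c) a" unfolding turns_def
  proof (intro allI conjI)
    fix k
    have 1: "c k = Some (cpt (pos c k), cpt (pos c (k + 1) - pos c k))" using seg by blast
    have 2: "c (k + 1) = Some (cpt (pos c (k + 1)), cpt (pos c (k + 2) - pos c (k + 1)))"
      using seg[of "k + 1"] by (simp add: add.assoc)
    have "a k \<in> {1, -1} \<and> cpt (pos c (k + 2) - pos c (k + 1)) = \<i> powi (a k) * cpt (pos c (k + 1) - pos c k)"
      using assms 1 2 unfolding associated_curve_def by blast
    then show "a k \<in> {1, -1}" and "pos c (k + 2) - pos c (k + 1) = sc (a k) (rot (pos c (k + 1) - pos c k))"
      using cpt_rot[of "a k"] by (auto simp flip: cpt_eq)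
  qed
qed

lemma support_eq_iff:
  assumes "u \<in> units" "u' \<in> units"
  shows "support (cpt v, cpt u) = support (cpt v', cpt u') \<longleftrightarrow> v + (v + u) = v' + (v' + u')"
proof -
  have "support (cpt v, cpt u) = support (cpt v', cpt u') \<longleftrightarrow> {cpt v, cpt (v + u)} = {cpt v', cpt (v' + u')}"
    by (simp add: support_def closed_segment_eq cpt_add)
  also have "\<dots> \<longleftrightarrow> {v, v + u} = {v', v' + u'}"
    by (simp add: doubleton_eq_iff)
  also have "\<dots> \<longleftrightarrow> v + (v + u) = v' + (v' + u')"
  proof
    assume "{v, v + u} = {v', v' + u'}"
    then show "v + (v + u) = v' + (v' + u')" by (auto simp: doubleton_eq_iff algebra_simps)
  next
    assume "v + (v + u) = v' + (v' + u')"
    then have "v + v + u = v' + v' + u'" by (simp add: add.assoc)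
    from mid_ends[OF assms this] show "{v, v + u} = {v', v' + u'}" by auto
  qed
  finally show ?thesis .
qed

context
  fixes \<C> :: "curve set"
  assumes cov: "covering \<C>"
begin

lemma curve_assoc: "c \<in> \<C> \<Longrightarrow> \<exists>a. associated_curve UNIV a c"
  using cov by (auto simp: covering_def complete_curve_def)

lemma curve_seg: "c \<in> \<C> \<Longrightarrow> c k = Some (cpt (pos c k), cpt (pos c (k + 1) - pos c k))"
  using curve_assoc associated_UNIV(1) by blast

lemma curve_path: "c \<in> \<C> \<Longrightarrow> lattice_path (pos c)"
  using curve_assoc associated_UNIV(2) by blast

text \<open>Unit segments of the lattice have the same support exactly if they have the same
  midpoint.\<close>

lemma covering_fam: "fam \<C> pos"
proof -
  have ex1: "\<exists>!(c, k). c \<in> \<C> \<and> mid (pos c) k = m" if m: "edge_pt m" for m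
  proof -
    obtain v u where vu: "m = v + (v + u)" "u \<in> {(1,0),(0,1)}"
    proof -
      obtain X Y where XY: "m = (X, Y)" by (metis prod.collapse)
      show ?thesis
      proof (cases "odd X")
        case True
        then obtain i where i: "X = 2*i+1" by (rule oddE)
        have "even Y" using m True by (simp add: edge_pt_def XY)
        then obtain j where j: "Y = 2*j" by (rule evenE)
        show ?thesis by (rule that[of "(i,j)" "(1,0)"]) (simp_all add: XY i j)
      next
        case False
        then obtain i where i: "X = 2*i" by (auto elim: evenE)
        have "odd Y" using m False by (simp add: edge_pt_def XY)
        then obtain j where j: "Y = 2*j+1" by (rule oddE)
        show ?thesis by (rule that[of "(i,j)" "(0,1)"]) (simp_all add: XY i j)
      qed
    qed
    have u: "u \<in> units" using vu(2) by (auto simp: units_def)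
    have "cpt v \<in> lattice" "cpt u \<in> {1, \<i>}" using vu(2) by (auto simp: lattice_cpt cpt_def complex_eq_iff)
    then have "\<exists>!(c, k). c \<in> \<C> \<and> (\<exists>s. c k = Some s \<and> support s = closed_segment (cpt v) (cpt v + cpt u))"
      using cov unfolding covering_def by blast
    moreover have "(c \<in> \<C> \<and> (\<exists>s. c k = Some s \<and> support s = closed_segment (cpt v) (cpt v + cpt u))) \<longleftrightarrow>
        (c \<in> \<C> \<and> mid (pos c) k = m)" for c k
    proof (cases "c \<in> \<C>")
      case True
      have "closed_segment (cpt v) (cpt v + cpt u) = support (cpt v, cpt u)" by (simp add: support_def)
      moreover have "pos c (k + 1) - pos c k \<in> units" by (rule pathD[OF curve_path[OF True]])
      ultimately show ?thesis
        using support_eq_iff[OF _ u, of "pos c (k + 1) - pos c k" "pos c k" v] True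
        by (simp add: curve_seg[OF True] mid_def vu(1))
    qed simp
    ultimately show ?thesis by simp
  qed
  show ?thesis unfolding fam_def
  proof (intro conjI ballI allI impI)
    show "lattice_path (pos c)" if "c \<in> \<C>" for c by (rule curve_path[OF that])
    show "\<exists>c\<in>\<C>. \<exists>k. mid (pos c) k = m" if "edge_pt m" for m
      using ex1[OF that] by blast
    fix c c' k k'
    assume c: "c \<in> \<C>" "c' \<in> \<C>" and e: "mid (pos c) k = mid (pos c') k'"
    have "edge_pt (mid (pos c) k)" by (rule mid_edge_pt[OF curve_path[OF c(1)]])
    from ex1[OF this] have "(c, k) = (c', k')" using c e by auto
    then show "c = c'" "k = k'" by auto
  qed
qed

lemma covering_nonempty: "\<C> \<noteq> {}"
  using fam_surj[OF covering_fam, of "(1, 0)"] by (auto simp: edge_pt_def)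

text \<open>By the orientation convention horizontal segments start only at vertices of one parity
  and vertical ones only at those of the other. So a translation that carries one oriented segment
  of the covering to another preserves parity.\<close>

lemma translation_even:
  assumes c: "c \<in> \<C>" "c' \<in> \<C>" and e: "pos c' k' = pos c k + v" "pos c' (k' + 1) = pos c (k + 1) + v"
  shows "even (fst v + snd v)"
proof -
  obtain q where q: "\<And>x y. {(u, e) \<in> segments \<C>. u = lattice_pt x y \<or> u + e = lattice_pt x y} =
       (if even (x + y) = q
        then {(lattice_pt x y, 1), (lattice_pt x y, -1), (lattice_pt x y + \<i>, -\<i>), (lattice_pt x y - \<i>, \<i>)}
        else {(lattice_pt x y + 1, -1), (lattice_pt x y - 1, 1), (lattice_pt x y, \<i>), (lattice_pt x y, -\<i>)})"
    using cov unfolding covering_def well_oriented_def Let_def by blast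
  have out: "(cpt w, e) \<in> segments \<C> \<Longrightarrow> (even (fst w + snd w) = q) = (e \<in> {1, -1})" for w e
  proof -
    assume s: "(cpt w, e) \<in> segments \<C>"
    have w: "cpt w = lattice_pt (fst w) (snd w)" by (simp add: cpt_def lattice_pt_def)
    have "(cpt w, e) \<in> {(u, e) \<in> segments \<C>. u = lattice_pt (fst w) (snd w) \<or> u + e = lattice_pt (fst w) (snd w)}"
      using s w by simp
    then show ?thesis unfolding q w by (auto split: if_splits simp: complex_eq_iff)
  qed
  have s: "(cpt (pos c k), cpt (pos c (k + 1) - pos c k)) \<in> segments \<C>" if "c \<in> \<C>" for c k
    using curve_seg[OF that, of k] that unfolding segments_def ran_def by blast
  have "pos c' (k' + 1) - pos c' k' = pos c (k + 1) - pos c k" by (simp add: e)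
  then have "even (fst (pos c' k') + snd (pos c' k')) \<longleftrightarrow> even (fst (pos c k) + snd (pos c k))"
    using out[OF s[OF c(1)], of k] out[OF s[OF c(2)], of k'] by auto
  then show ?thesis by (auto simp: e(1))
qed

end

text \<open>Every disc of some radius contains a copy of a given patch. As folding curves fill
  discs, there is such a disc in which all edges belong to \<open>c0\<close>, and the copy there
  lies on \<open>c0\<close> alone.\<close>

lemma covering_repeats:
  assumes cov: "covering \<C>" and LI: "local_isomorphism \<C>" and c0: "c0 \<in> \<C>"
    and cf: "complete_folding a" and ac: "associated_curve UNIV a c0"
  shows "repeats \<C> pos c0"
proof -
  note F = covering_fam[OF cov]
  note seg = curve_seg[OF cov]
  have T: "turns (pos c0) a" by (rule associated_UNIV(3)[OF ac])
  have win: "\<exists>v. even (fst v + snd v) \<and> window \<C> pos c0 R v" if R: "R \<ge> 0" for R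
  proof -
    define S where "S = {(c, k). c \<in> \<C> \<and> \<bar>fst (pos c k)\<bar> \<le> R \<and> \<bar>snd (pos c k)\<bar> \<le> R}"
    have finS: "finite S"
    proof (rule inj_on_finite)
      show "inj_on (\<lambda>(c, k). mid (pos c) k) S"
        using fam_inj[OF F] by (auto simp: inj_on_def S_def)
      show "(\<lambda>(c, k). mid (pos c) k) ` S \<subseteq> {-2*R-1..2*R+1} \<times> {-2*R-1..2*R+1}"
      proof clarify
        fix c k m1 m2 assume ck: "(c, k) \<in> S" and m: "(m1, m2) = mid (pos c) k"
        have "pos c (k + 1) - pos c k \<in> units" using ck by (intro pathD[OF curve_path[OF cov]]) (simp add: S_def)
        then have "\<bar>fst (pos c (k + 1)) - fst (pos c k)\<bar> \<le> 1" "\<bar>snd (pos c (k + 1)) - snd (pos c k)\<bar> \<le> 1"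
          by (auto simp: units_def prod_eq_iff)
        moreover have "m1 = fst (pos c k) + fst (pos c (k + 1))" "m2 = snd (pos c k) + snd (pos c (k + 1))"
          using m by (simp_all add: mid_def prod_eq_iff)
        moreover have "\<bar>fst (pos c k)\<bar> \<le> R" "\<bar>snd (pos c k)\<bar> \<le> R" using ck by (simp_all add: S_def)
        ultimately show "m1 \<in> {-2*R-1..2*R+1} \<and> m2 \<in> {-2*R-1..2*R+1}" unfolding atLeastAtMost_iff by linarith
      qed
    qed simp
    have neS: "\<exists>c k. (c, k) \<in> S"
    proof -
      obtain c k where c: "c \<in> \<C>" and k: "mid (pos c) k = (1, 0)"
        using fam_surj[OF F, of "(1, 0)"] by (auto simp: edge_pt_def)
      have "pos c k + pos c k + (pos c (k + 1) - pos c k) = 0 + 0 + (1, 0)" using k by (simp add: mid_def)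
      then have "pos c k = 0 \<or> pos c k = 0 + (1, 0) \<and> pos c (k + 1) - pos c k = - (1, 0)"
        using mid_ends[OF pathD[OF curve_path[OF cov c], of k], of "(1, 0)" "pos c k" 0] by (auto simp: units_def)
      then have "pos c k = 0 \<or> pos c (k + 1) = 0" by (auto simp: prod_eq_iff)
      then show ?thesis
      proof
        assume "pos c k = 0"
        then have "(c, k) \<in> S" using c R by (simp add: S_def)
        then show ?thesis by blast
      next
        assume "pos c (k + 1) = 0"
        then have "(c, k + 1) \<in> S" using c R by (simp add: S_def)
        then show ?thesis by blast
      qed
    qed
    define W where "W = fst ` S"
    \<comment> \<open>One index earlier than the first visit, since a window also copies the
      preceding vertex.\<close>
    define lo where "lo c = Min {k. (c, k) \<in> S} - 1" for c
    define hi where "hi c = Max {k. (c, k) \<in> S}" for c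
    have fin: "finite {k. (c, k) \<in> S}" for c
      by (rule finite_subset[OF _ finite_imageI[OF finS, of snd]]) force
    have lohi: "lo c \<le> k - 1 \<and> k \<le> hi c" if "(c, k) \<in> S" for c k
    proof -
      have "Min {k. (c, k) \<in> S} \<le> k" by (rule Min_le[OF fin]) (simp add: that)
      moreover have "k \<le> Max {k. (c, k) \<in> S}" by (rule Max_ge[OF fin]) (simp add: that)
      ultimately show ?thesis by (simp add: lo_def hi_def)
    qed
    have WC: "c \<in> \<C>" and lo_hi: "lo c \<le> hi c" if "c \<in> W" for c
      using that lohi by (force simp: W_def S_def)+
    \<comment> \<open>One piece per curve, from its first to its last visit to the box, excursions
      included: thus a run of consecutive segments of the patch lies in a single piece, as
      \<open>precedes\<close> demands. Indices are shifted to start at 1 for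
      \<open>finite_curve\<close>.\<close>
    define piece :: "curve \<Rightarrow> curve" where
      "piece c = (\<lambda>i. if 1 \<le> i \<and> i \<le> hi c - lo c + 1 then c (i + lo c - 1) else None)" for c
    have dom_piece: "dom (piece c) = {1..hi c - lo c + 1}" if "c \<in> W" for c
      using seg[OF WC[OF that]] by (auto simp: piece_def split: if_splits)
    have piece_run: "piece c (k + (1 - lo c)) = c k" if "k \<in> {lo c..hi c}" for c k
      using that by (simp add: piece_def)
    define \<B> where "\<B> = piece ` W"
    have finB: "finite (segments \<B>)"
      unfolding segments_def
    proof (rule finite_UN_I)
      show "finite \<B>" using finS by (simp add: \<B>_def W_def)
      show "finite (ran b)" if "b \<in> \<B>" for b
        using that dom_piece by (intro finite_ran) (auto simp: \<B>_def)
    qed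
    have curB: "\<B> \<subseteq> curves"
    proof
      fix b assume "b \<in> \<B>"
      then obtain c where c: "c \<in> W" "b = piece c" by (auto simp: \<B>_def)
      obtain a' where a': "associated_curve UNIV a' c" using curve_assoc[OF cov WC[OF c(1)]] by blast
      have "associated_curve {1..hi c - lo c + 1} (\<lambda>k. a' (k + lo c - 1)) b"
        unfolding associated_curve_def
      proof (intro conjI allI impI)
        show "dom b = {1..hi c - lo c + 1}" using dom_piece c by simp
        fix k x e
        have b: "b k = Some s \<Longrightarrow> c (k + lo c - 1) = Some s" for k s
          by (simp add: c(2) piece_def split: if_splits)
        { assume "b k = Some (x, e)"
          then have "c (k + lo c - 1) = Some (x, e)" by (rule b)
          then show "x \<in> lattice" "e \<in> {1, -1, \<i>, -\<i>}" using a' unfolding associated_curve_def by blast+ }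
        { fix x' e'
          assume "b k = Some (x, e) \<and> b (k + 1) = Some (x', e')"
          then have "c (k + lo c - 1) = Some (x, e) \<and> c (k + lo c - 1 + 1) = Some (x', e')"
            using b[of k] b[of "k + 1"] by (simp add: algebra_simps)
          then show "a' (k + lo c - 1) \<in> {1, -1}" "x + e = x'" "e' = \<i> powi a' (k + lo c - 1) * e"
            using a' unfolding associated_curve_def by blast+ }
      qed
      moreover have "hi c - lo c + 1 \<ge> 1" using lo_hi[OF c(1)] by simp
      ultimately have "finite_curve b" unfolding finite_curve_def by blast
      then show "b \<in> curves" by (simp add: curves_def)
    qed
    have prec: "precedes \<B> \<C>" unfolding precedes_def
    proof (intro conjI ballI allI impI)
      show "\<not> same_curves \<B> \<C>"
      proof
        assume "same_curves \<B> \<C>"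
        then obtain b s where b: "b \<in> \<B>" "b = shift s c0" using c0 unfolding same_curves_def by blast
        then obtain c where c: "c \<in> W" "b = piece c" by (auto simp: \<B>_def)
        have "dom b = UNIV" using seg[OF c0] by (auto simp: b(2) shift_def)
        then have "finite (UNIV :: int set)" using dom_piece[OF c(1)] c(2) by simp
        then show False using infinite_UNIV_int by simp
      qed
      show "\<exists>c\<in>\<C>. subcurve b c" if b: "b \<in> \<B>" for b
      proof -
        obtain c where c: "c \<in> W" "b = piece c" using b by (auto simp: \<B>_def)
        have "b \<subseteq>\<^sub>m shift (lo c - 1) c"
          by (auto simp: map_le_def c(2) piece_def shift_def algebra_simps split: if_splits)
        then show ?thesis using WC[OF c(1)] unfolding subcurve_def by blast
      qed
      fix c i j
      assume c: "c \<in> \<C>" and ij: "i \<le> j \<and> (\<forall>k\<in>{i..j}. \<exists>s\<in>segments \<B>. c k = Some s)"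
      have in_range: "c \<in> W \<and> k \<in> {lo c..hi c}" if k: "k \<in> {i..j}" for k
      proof -
        obtain s where s: "s \<in> segments \<B>" "c k = Some s" using ij k by blast
        then obtain c' where c': "c' \<in> W" "s \<in> ran (piece c')" by (auto simp: segments_def \<B>_def)
        then obtain l where l: "piece c' l = Some s" by (auto simp: ran_def)
        then have l': "c' (l + lo c' - 1) = Some s" "l + lo c' - 1 \<in> {lo c'..hi c'}"
          by (simp_all add: piece_def split: if_splits)
        have "cpt (pos c k) = cpt (pos c' (l + lo c' - 1))"
          "cpt (pos c (k + 1) - pos c k) = cpt (pos c' (l + lo c' - 1 + 1) - pos c' (l + lo c' - 1))"
          using s(2) l'(1) seg[OF c, of k] seg[OF WC[OF c'(1)], of "l + lo c' - 1"] by auto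
        then have "mid (pos c) k = mid (pos c') (l + lo c' - 1)"
          unfolding cpt_eq mid_def by (metis diff_add_cancel)
        then show ?thesis using fam_inj[OF F _ c WC[OF c'(1)]] c'(1) l'(2) by blast
      qed
      then have "c \<in> W" using ij by auto
      then have "piece c \<in> \<B>" by (simp add: \<B>_def)
      moreover have "\<forall>k\<in>{i..j}. piece c (k + (1 - lo c)) = c k"
        using piece_run conjunct2[OF in_range] by simp
      ultimately show "\<exists>b\<in>\<B>. \<exists>m. \<forall>k\<in>{i..j}. b (k + m) = c k"
        by (intro bexI[of _ "piece c"] exI[of _ "1 - lo c"])
    qed
    obtain r where r: "\<And>z. \<exists>\<B>'\<subseteq>curves. precedes \<B>' \<C> \<and> translation_equiv \<B> \<B>' \<and>
         (\<Union>s\<in>segments \<B>'. support s) \<subseteq> cball z r"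
      using LI[unfolded local_isomorphism_def, rule_format, OF curB conjI[OF finB prec]]
      by (elim exE conjE) (rule that, erule spec)
    \<comment> \<open>Twice the radius, because \<open>fills\<close> measures doubled
      midpoints.\<close>
    have "fills (2 * r) (pos c0)"
      by (rule folding_path_fills[OF curve_path[OF cov c0] T cf])
    then obtain z0 where z0: "\<And>m. edge_pt m \<Longrightarrow> cmod (cpt m - z0) \<le> 2 * r \<Longrightarrow> \<exists>k. mid (pos c0) k = m"
      unfolding fills_def by blast
    obtain \<B>' where B': "precedes \<B>' \<C>" "translation_equiv \<B> \<B>'"
      "(\<Union>s\<in>segments \<B>'. support s) \<subseteq> cball (z0 / 2) r" using r by blast
    obtain t where t: "same_curves (translate t ` \<B>) \<B>'"
      using B'(2) unfolding translation_equiv_def by blast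
    have only_c0: "c1 = c0" if b': "b' \<in> \<B>'" and c1: "c1 \<in> \<C>" and s: "b' i = Some s" "c1 k = Some s" for b' c1 i k s
    proof -
      have "s \<in> segments \<B>'" using b' s(1) by (auto simp: segments_def ran_def)
      then have "support s \<subseteq> cball (z0 / 2) r" using B'(3) by blast
      moreover have sk: "s = (cpt (pos c1 k), cpt (pos c1 (k + 1) - pos c1 k))" using seg[OF c1, of k] s(2) by simp
      moreover have "fst s \<in> support s" "fst s + snd s \<in> support s" by (simp_all add: support_def)
      ultimately have "cpt (pos c1 k) \<in> cball (z0 / 2) r" "cpt (pos c1 (k + 1)) \<in> cball (z0 / 2) r"
        by (auto simp: cpt_diff)
      then have "cmod (cpt (pos c1 k) - z0 / 2) \<le> r" "cmod (cpt (pos c1 (k + 1)) - z0 / 2) \<le> r"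
        by (simp_all add: dist_norm norm_minus_commute)
      then have "cmod ((cpt (pos c1 k) - z0 / 2) + (cpt (pos c1 (k + 1)) - z0 / 2)) \<le> 2 * r"
        using norm_triangle_ineq[of "cpt (pos c1 k) - z0 / 2" "cpt (pos c1 (k + 1)) - z0 / 2"] by linarith
      moreover have "(cpt (pos c1 k) - z0 / 2) + (cpt (pos c1 (k + 1)) - z0 / 2) = cpt (mid (pos c1) k) - z0"
        by (simp add: mid_def cpt_add)
      ultimately have "cmod (cpt (mid (pos c1) k) - z0) \<le> 2 * r" by simp
      from z0[OF mid_edge_pt[OF curve_path[OF cov c1]] this] show ?thesis
        using fam_inj[OF F _ c0 c1] by metis
    qed
    have transl: "\<exists>q. \<forall>k\<in>{lo c..hi c}. cpt (pos c0 (k + q)) = cpt (pos c k) + t \<and>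
        pos c0 (k + q + 1) - pos c0 (k + q) = pos c (k + 1) - pos c k" if c: "c \<in> W" for c
    proof -
      have "translate t (piece c) \<in> translate t ` \<B>" using c by (simp add: \<B>_def)
      then obtain b' s where b': "b' \<in> \<B>'" "translate t (piece c) = shift s b'"
        using t unfolding same_curves_def by blast
      obtain c1 s' where c1: "c1 \<in> \<C>" "b' \<subseteq>\<^sub>m shift s' c1"
        using B'(1) b'(1) unfolding precedes_def subcurve_def by blast
      show ?thesis
      proof (intro exI[of _ "1 - lo c + s + s'"] ballI)
        fix k assume k: "k \<in> {lo c..hi c}"
        define i where "i = k + (1 - lo c)"
        have "piece c i = Some (cpt (pos c k), cpt (pos c (k + 1) - pos c k))"
          unfolding i_def piece_run[OF k] by (rule seg[OF WC[OF c]])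
        then have "translate t (piece c) i = Some (cpt (pos c k) + t, cpt (pos c (k + 1) - pos c k))"
          by (simp add: translate_def)
        then have b'i: "b' (i + s) = Some (cpt (pos c k) + t, cpt (pos c (k + 1) - pos c k))"
          unfolding b'(2) by (simp add: shift_def)
        then have "i + s \<in> dom b'" by blast
        then have "shift s' c1 (i + s) = b' (i + s)" using c1(2) unfolding map_le_def by metis
        then have c1i: "c1 (i + s + s') = Some (cpt (pos c k) + t, cpt (pos c (k + 1) - pos c k))"
          by (simp add: shift_def b'i)
        have "c1 = c0" by (rule only_c0[OF b'(1) c1(1) b'i c1i])
        moreover have "i + s + s' = k + (1 - lo c + s + s')" by (simp add: i_def)
        ultimately have "c0 (k + (1 - lo c + s + s')) = Some (cpt (pos c k) + t, cpt (pos c (k + 1) - pos c k))"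
          using c1i by metis
        then show "cpt (pos c0 (k + (1 - lo c + s + s'))) = cpt (pos c k) + t \<and>
          pos c0 (k + (1 - lo c + s + s') + 1) - pos c0 (k + (1 - lo c + s + s')) = pos c (k + 1) - pos c k"
          using seg[OF c0, of "k + (1 - lo c + s + s')"] by simp
      qed
    qed
    obtain c2 k2 where S2: "(c2, k2) \<in> S" using neS by blast
    then have W2: "c2 \<in> W" "k2 \<in> {lo c2..hi c2}" using lohi by (force simp: W_def)+
    obtain q2 where q2: "cpt (pos c0 (k2 + q2)) = cpt (pos c2 k2) + t"
      "pos c0 (k2 + q2 + 1) - pos c0 (k2 + q2) = pos c2 (k2 + 1) - pos c2 k2"
      using transl[OF W2(1)] W2(2) by blast
    \<comment> \<open>All pieces are moved by the same \<open>t\<close>, so a single segment shows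
      that it is a lattice vector.\<close>
    define v where "v = pos c0 (k2 + q2) - pos c2 k2"
    have tv: "t = cpt v" using q2(1) by (simp add: v_def cpt_diff)
    have "even (fst v + snd v)"
    proof (rule translation_even[OF cov WC[OF W2(1)] c0])
      show "pos c0 (k2 + q2) = pos c2 k2 + v" by (simp add: v_def)
      then show "pos c0 (k2 + q2 + 1) = pos c2 (k2 + 1) + v" using q2(2) by (simp add: algebra_simps)
    qed
    moreover have "window \<C> pos c0 R v" unfolding window_def
    proof (intro ballI allI impI)
      fix c k assume "c \<in> \<C>" "\<bar>fst (pos c k)\<bar> \<le> R \<and> \<bar>snd (pos c k)\<bar> \<le> R"
      then have ck: "(c, k) \<in> S" by (simp add: S_def)
      then have cW: "c \<in> W" by (force simp: W_def)
      obtain q where q: "\<And>k. k \<in> {lo c..hi c} \<Longrightarrow> cpt (pos c0 (k + q)) = cpt (pos c k) + t \<and>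
        pos c0 (k + q + 1) - pos c0 (k + q) = pos c (k + 1) - pos c k" using transl[OF cW] by blast
      have q': "pos c0 (k + q) = pos c k + v" if "k \<in> {lo c..hi c}" for k
        using q[OF that] unfolding tv cpt_add[symmetric] by simp
      have k: "k \<in> {lo c..hi c}" "k - 1 \<in> {lo c..hi c}" using lohi[OF ck] by auto
      have "pos c0 (k + q + 1) = pos c (k + 1) + v"
        using q[OF k(1)] q'[OF k(1)] by (simp add: algebra_simps)
      moreover have "pos c0 (k + q - 1) = pos c (k - 1) + v"
        using q'[OF k(2)] by (simp add: algebra_simps)
      ultimately show "\<exists>k'. pos c0 k' = pos c k + v \<and> pos c0 (k' + 1) = pos c (k + 1) + v \<and>
          pos c0 (k' - 1) = pos c (k - 1) + v" using q'[OF k(1)] by blast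
    qed
    ultimately show ?thesis by blast
  qed
  show ?thesis unfolding repeats_def
  proof (intro conjI allI)
    show "\<exists>a. complete_folding a \<and> turns (pos c0) a" using cf T by blast
    fix R :: int
    have "max R 0 \<ge> 0" by simp
    from win[OF this] obtain v where v: "even (fst v + snd v)" "window \<C> pos c0 (max R 0) v" by blast
    have "window \<C> pos c0 R v" by (rule window_mono[OF v(2)]) simp
    then show "\<exists>v. even (fst v + snd v) \<and> window \<C> pos c0 R v" using v(1) by blast
  qed
qed

section \<open>Counting the curves\<close>

text \<open>For consecutive edges \<open>a\<close> and \<open>a + 1\<close> of a curve with index
  parity \<open>b\<close>: if their parents differ, then the parents are consecutive and the vertex
  between the edges is kept.\<close>

lemma div2_jump:
  fixes a b :: int
  assumes "(a - b) div 2 < (a + 1 - b) div 2"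
  shows "(a + 1 - b) div 2 = (a - b) div 2 + 1" "a + 1 = b + 2 * ((a - b) div 2 + 1)"
  using assms by presburger+

text \<open>Provides the decreasing measure when two non-consecutive edges of one curve are followed
  through the levels.\<close>

lemma div2_contract:
  fixes a b c :: int
  assumes "a < b" "b \<noteq> a + 1"
  shows "(b - c) div 2 - (a - c) div 2 < b - a"
  using assms by presburger

lemma finite_units: "finite units"
  by (simp add: units_def)

locale hierarchy =
  fixes I :: "'c set" and X :: "nat \<Rightarrow> 'c \<Rightarrow> int \<Rightarrow> pt" and p t :: "nat \<Rightarrow> int" and r :: "nat \<Rightarrow> 'c \<Rightarrow> int"
  assumes F: "\<And>n. fam I (X n)" and p: "\<And>n. p n \<in> {0, 1}" and L: "\<And>n. lvl I (p n) (t n) (r n) (X n)"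
    and X_Suc: "\<And>n. X (Suc n) = Der (p n) (r n) (X n)"
begin

lemma t: "t n \<in> {1, -1}"
  using L[of n] unfolding lvl_def by (rule conjunct1)

lemma plvl: "c \<in> I \<Longrightarrow> plvl (p n) (t n) (r n c) (X n c)"
  using L[of n] unfolding lvl_def by blast

lemma path: "c \<in> I \<Longrightarrow> lattice_path (X n c)"
  by (rule fam_path[OF F])

definition nx :: "nat \<Rightarrow> 'c \<Rightarrow> int \<Rightarrow> int" where
  "nx n c k = (k - r n c) div 2"

lemma mid_nx: "c \<in> I \<Longrightarrow> mid (X (Suc n) c) (nx n c k) = parent (p n) (t n) (mid (X n c) k)"
  unfolding X_Suc Der_def nx_def by (rule mid_der_parent[OF plvl path t])

lemma inj: "mid (X n c) k = mid (X n c') k' \<Longrightarrow> c \<in> I \<Longrightarrow> c' \<in> I \<Longrightarrow> c = c' \<and> k = k'"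
  by (rule fam_inj[OF F])

text \<open>The edge followed in each curve is the one with index 0, an arbitrary choice.\<close>

primrec idx :: "nat \<Rightarrow> 'c \<Rightarrow> int" where
  "idx 0 c = 0"
| "idx (Suc n) c = nx n c (idx n c)"

definition rep :: "'c set \<Rightarrow> nat \<Rightarrow> pt set" where
  "rep J n = (\<lambda>c. mid (X n c) (idx n c)) ` J"

lemma rep_card:
  assumes "J \<subseteq> I"
  shows "card (rep J n) = card J"
  unfolding rep_def
proof (intro card_image inj_onI)
  fix c c' assume "c \<in> J" "c' \<in> J" and eq: "mid (X n c) (idx n c) = mid (X n c') (idx n c')"
  then show "c = c'" using inj[OF eq] assms by blast
qed

lemma vertex_of_mid:
  assumes c: "c \<in> I" and v: "at_vertex v (mid (X n c) k)"
  shows "v = X n c k \<or> v = X n c (k + 1)"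
proof -
  have "X n c k + X n c k + (X n c (k + 1) - X n c k) = v + v + (mid (X n c) k - v - v)"
    by (simp add: mid_def)
  then have "X n c k = v \<or> X n c k = v + (mid (X n c) k - v - v) \<and> X n c (k + 1) - X n c k = - (mid (X n c) k - v - v)"
    using mid_ends[OF pathD[OF path[OF c]]] v unfolding at_vertex_def by blast
  then show ?thesis
  proof
    assume *: "X n c k = v + (mid (X n c) k - v - v) \<and> X n c (k + 1) - X n c k = - (mid (X n c) k - v - v)"
    then have "X n c (k + 1) = v" by (simp add: prod_eq_iff)
    then show ?thesis by simp
  qed simp
qed

text \<open>At a vertex, an edge of a curve is followed by another edge of that curve; as \<open>rep J n\<close> has
  only one edge of each curve, it has at most half of the four edges at the vertex.\<close>

lemma rep_deg2:
  assumes J: "J \<subseteq> I" "finite J"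
  shows "card {m \<in> rep J n. at_vertex v m} \<le> 2"
proof -
  define A where "A = {c \<in> J. at_vertex v (mid (X n c) (idx n c))}"
  define partner where "partner c = mid (X n c) (if v = X n c (idx n c) then idx n c - 1 else idx n c + 1)" for c
  define St where "St = (\<lambda>u. v + v + u) ` units"
  have St: "finite St" "card St = 4"
    unfolding St_def by (simp_all add: units_def card_image inj_on_def)
  have at: "m \<in> St \<longleftrightarrow> at_vertex v m" for m
  proof
    assume "at_vertex v m"
    then have "v + v + (m - v - v) \<in> St" unfolding St_def at_vertex_def by (rule imageI)
    then show "m \<in> St" by (simp add: algebra_simps)
  qed (auto simp: St_def at_vertex_def)
  have B: "{m \<in> rep J n. at_vertex v m} = (\<lambda>c. mid (X n c) (idx n c)) ` A"
    by (auto simp: rep_def A_def)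
  have cB: "card ((\<lambda>c. mid (X n c) (idx n c)) ` A) = card A"
  proof (intro card_image inj_onI)
    fix c c' assume "c \<in> A" "c' \<in> A" and eq: "mid (X n c) (idx n c) = mid (X n c') (idx n c')"
    then show "c = c'" using inj[OF eq] J(1) by (auto simp: A_def)
  qed
  have cP: "card (partner ` A) = card A"
  proof (intro card_image inj_onI)
    fix c c' assume "c \<in> A" "c' \<in> A" and eq: "partner c = partner c'"
    then show "c = c'" using inj[OF eq[unfolded partner_def]] J(1) by (auto simp: A_def)
  qed
  have pSt: "partner c \<in> St" if c: "c \<in> A" for c
  proof -
    have cI: "c \<in> I" and v: "at_vertex v (mid (X n c) (idx n c))" using c J by (auto simp: A_def)
    consider "v = X n c (idx n c)" | "v = X n c (idx n c + 1)" "v \<noteq> X n c (idx n c)"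
      using vertex_of_mid[OF cI v] by blast
    then show ?thesis
    proof cases
      case 1
      have eq: "mid (X n c) (idx n c - 1) - v - v = X n c (idx n c - 1) - X n c (idx n c - 1 + 1)"
        by (simp add: mid_def 1)
      have pc: "partner c = mid (X n c) (idx n c - 1)" using 1 by (simp add: partner_def)
      show ?thesis unfolding at at_vertex_def pc eq by (rule pathD'[OF path[OF cI]])
    next
      case 2
      have eq: "mid (X n c) (idx n c + 1) - v - v = X n c (idx n c + 1 + 1) - X n c (idx n c + 1)"
        by (simp add: mid_def 2(1))
      have pc: "partner c = mid (X n c) (idx n c + 1)" using 2(2) by (simp add: partner_def)
      show ?thesis unfolding at at_vertex_def pc eq by (rule pathD[OF path[OF cI]])
    qed
  qed
  have disj: "partner ` A \<inter> (\<lambda>c. mid (X n c) (idx n c)) ` A = {}"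
  proof (rule ccontr)
    assume "\<not> ?thesis"
    then obtain m where m: "m \<in> partner ` A" "m \<in> (\<lambda>c. mid (X n c) (idx n c)) ` A" by blast
    then obtain c c' where c: "c \<in> A" "c' \<in> A" and eq: "partner c = mid (X n c') (idx n c')"
      by (elim imageE) (rule that, auto)
    have "c \<in> I" "c' \<in> I" using c J(1) by (auto simp: A_def)
    from inj[OF eq[unfolded partner_def] this]
    have cc: "c = c'" and "(if v = X n c (idx n c) then idx n c - 1 else idx n c + 1) = idx n c'"
      by (rule conjunct1, rule conjunct2)
    then show False unfolding cc by (simp split: if_splits)
  qed
  have finA: "finite A" using J by (simp add: A_def)
  have "card (partner ` A \<union> (\<lambda>c. mid (X n c) (idx n c)) ` A) \<le> card St"
    using pSt by (intro card_mono St) (auto simp: at A_def)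
  then have "card A + card A \<le> 4"
    using card_Un_disjoint[OF _ _ disj] finA cB cP St(2) by simp
  then show ?thesis unfolding B cB by simp
qed

lemma rep_shrinking:
  assumes "J \<subseteq> I" "finite J" "card J \<ge> 5"
  shows "shrinking p t (rep J)"
proof
  show "p n \<in> {0, 1}" "t n \<in> {1, -1}" for n by (rule p t)+
  show "rep J (Suc n) = parent (p n) (t n) ` rep J n" for n
    unfolding rep_def image_image using assms(1) by (intro image_cong refl) (auto simp: mid_nx)
  show "edge_pt m" if "m \<in> rep J n" for n m
    using that assms(1) mid_edge_pt[OF path] by (auto simp: rep_def)
  show "finite (rep J n)" for n using assms(2) by (simp add: rep_def)
  show "card {m \<in> rep J n. at_vertex v m} \<le> 2" for n v by (rule rep_deg2[OF assms(1,2)])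
  show "card (rep J n) \<ge> 5" for n using rep_card[OF assms(1)] assms(3) by simp
qed

text \<open>The pinwheel has four outer edges, and at most two of its four central edges can
  represent distinct curves.\<close>

lemma card_le_6:
  assumes "J \<subseteq> I" "finite J"
  shows "card J \<le> 6"
proof (rule ccontr)
  assume "\<not> card J \<le> 6"
  then have J5: "card J \<ge> 5" by simp
  interpret shrinking p t "rep J" by (rule rep_shrinking[OF assms J5])
  obtain N x s where s: "s \<in> {1, -1}" "covers (pinwheel s) x (rep J N)"
    using eventually_pinwheel by blast
  have "card (rep J N) \<le> length (filter (\<lambda>m. m \<notin> units) (pinwheel s)) + card {m \<in> rep J N. m - x - x \<in> units}"
    using s(2) fin by (intro card_le_filter) (auto simp: inj_on_def covers_def)
  also have "\<dots> \<le> 4 + 2"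
  proof (rule add_mono)
    show "length (filter (\<lambda>m. m \<notin> units) (pinwheel s)) \<le> 4"
      using s(1) by (auto simp: pinwheel_def unit_list_def units_def)
    show "card {m \<in> rep J N. m - x - x \<in> units} \<le> 2"
      using deg2[of N x] by (simp add: at_vertex_def)
  qed
  finally show False using \<open>\<not> card J \<le> 6\<close> rep_card[OF assms(1), of N] by simp
qed

lemma finite_I: "finite I"
proof (rule ccontr)
  assume "infinite I"
  then obtain J where "J \<subseteq> I" "finite J" "card J = 7" using infinite_arbitrarily_large[of I 7] by blast
  then show False using card_le_6[of J] by simp
qed

section \<open>The curves that meet a pinwheel\<close>

lemma pinwheel_children:
  "list_all (\<lambda>s. list_all (\<lambda>m. List.member (pinwheel (- s)) (parent 0 (- s) m) \<and>
      (List.member unit_list (parent 0 (- s) m) \<longleftrightarrow> List.member unit_list m)) (pinwheel s) \<and>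
     distinct (map (parent 0 (- s)) (pinwheel s))) [1, -1]"
  by code_simp

text \<open>The difference of two vertices that are kept at every level is divisible by all powers
  of \<open>1 + \<i>\<close>, so its norm \<open>q\<close> is divisible by all powers of 2.\<close>

lemma common_vertex:
  assumes x: "\<And>n. n \<ge> N \<Longrightarrow> surv (p n) (x n) \<and> x (Suc n) = dn (p n) (x n)"
    and y: "\<And>n. n \<ge> N \<Longrightarrow> surv (p n) (y n) \<and> y (Suc n) = dn (p n) (y n)"
  shows "x N = y N"
proof -
  have step: "x n - y n = up 0 (x (Suc n) - y (Suc n))" if "n \<ge> N" for n
  proof -
    have "x n = up (p n) (x (Suc n))" "y n = up (p n) (y (Suc n))"
      using x[OF that] y[OF that] by (simp_all add: up_dn)
    then show ?thesis by (simp add: up_def)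
  qed
  define q where "q v = (fst v)\<^sup>2 + (snd v)\<^sup>2" for v :: pt
  have q_up: "q (up 0 v) = 2 * q v" for v
    by (simp add: q_def up_def power2_eq_square algebra_simps)
  have "q (x N - y N) = 2 ^ j * q (x (N + j) - y (N + j))" for j
  proof (induction j)
    case (Suc j)
    have "q (x (N + j) - y (N + j)) = 2 * q (x (Suc (N + j)) - y (Suc (N + j)))"
      using step[of "N + j"] q_up by simp
    then show ?case using Suc.IH by simp
  qed simp
  then have dvd: "2 ^ j dvd q (x N - y N)" for j by (metis dvd_triv_left)
  have "q (x N - y N) = 0"
  proof (rule ccontr)
    assume ne: "q (x N - y N) \<noteq> 0"
    have nn: "q (x N - y N) \<ge> 0" by (simp add: q_def)
    define j where "j = nat (q (x N - y N))"
    have "2 ^ j \<le> q (x N - y N)" using zdvd_imp_le[OF dvd] ne nn by simp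
    moreover have "int j < 2 ^ j" by (metis less_exp of_nat_less_numeral_power_cancel_iff)
    ultimately show False using nn by (simp add: j_def)
  qed
  then have "fst (x N - y N) = 0 \<and> snd (x N - y N) = 0"
    unfolding q_def by (simp only: sum_power2_eq_zero_iff)
  then show ?thesis by (simp add: prod_eq_iff)
qed

context
  fixes N :: nat and x :: "nat \<Rightarrow> pt" and s :: "nat \<Rightarrow> int"
  assumes pin: "\<And>n. n \<ge> N \<Longrightarrow> s n \<in> {1, -1} \<and> surv (p n) (x n) \<and>
     x (Suc n) = dn (p n) (x n) \<and> t n * eps (fst (x n)) = - s n \<and> s (Suc n) = - s n"
begin

lemma pin_next:
  assumes n: "n \<ge> N" and e: "e \<in> set (pinwheel (s n))"
  shows "parent (p n) (t n) (e + x n + x n) = parent 0 (- s n) e + x (Suc n) + x (Suc n)"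
    and "parent 0 (- s n) e \<in> set (pinwheel (s (Suc n)))"
    and "parent 0 (- s n) e \<in> units \<longleftrightarrow> e \<in> units"
proof -
  note pn = pin[OF n]
  have s: "s n \<in> {1, -1}" using pn by simp
  have "edge_pt e" using s e by (auto simp: pinwheel_def unit_list_def edge_pt_def)
  moreover have "0 = (p n + fst (x n) + snd (x n)) mod 2"
  proof -
    have "even (fst (x n) + snd (x n) + p n)" using pn unfolding surv_def by blast
    then show ?thesis by presburger
  qed
  ultimately have "parent (p n) (t n) (e + x n + x n) = parent 0 (t n * eps (fst (x n))) e + dn (p n - 0) (x n) + dn (p n - 0) (x n)"
    by (intro parent_translate t)
  then show "parent (p n) (t n) (e + x n + x n) = parent 0 (- s n) e + x (Suc n) + x (Suc n)" using pn by simp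
  have "List.member (pinwheel (- s n)) (parent 0 (- s n) e)"
    "List.member unit_list (parent 0 (- s n) e) \<longleftrightarrow> List.member unit_list e"
    using pinwheel_children s e by (auto simp: list_all_iff)
  then show "parent 0 (- s n) e \<in> set (pinwheel (s (Suc n)))" "parent 0 (- s n) e \<in> units \<longleftrightarrow> e \<in> units"
    using pn by simp_all
qed

lemma pin_next_inj:
  assumes n: "n \<ge> N" and e: "e \<in> set (pinwheel (s n))" "e' \<in> set (pinwheel (s n))" "e \<noteq> e'"
  shows "parent 0 (- s n) e \<noteq> parent 0 (- s n) e'"
proof -
  have "distinct (map (parent 0 (- s n)) (pinwheel (s n)))"
    using pinwheel_children pin[OF n] by (auto simp: list_all_iff)
  then show ?thesis using e by (auto simp: distinct_map inj_on_def)
qed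

definition pin_edge :: "nat \<Rightarrow> pt \<Rightarrow> 'c \<Rightarrow> int \<Rightarrow> bool" where
  "pin_edge n e c k \<longleftrightarrow> e \<in> set (pinwheel (s n)) \<and> mid (X n c) k = e + x n + x n"

lemma pin_edge_next:
  "n \<ge> N \<Longrightarrow> c \<in> I \<Longrightarrow> pin_edge n e c k \<Longrightarrow> pin_edge (Suc n) (parent 0 (- s n) e) c (nx n c k)"
  unfolding pin_edge_def using pin_next mid_nx by simp

text \<open>\<open>nx\<close> is monotone, and it separates these two indices because
  \<open>parent\<close> is injective on the pinwheel.\<close>

lemma pin_edge_next_less:
  assumes n: "n \<ge> N" and c: "c \<in> I" and e: "pin_edge n e c k" "pin_edge n e' c k'" and k: "k < k'"
  shows "nx n c k < nx n c k'"
proof -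
  have "e \<noteq> e'" using e k inj[OF _ c c] unfolding pin_edge_def by (metis less_irrefl)
  then have "parent 0 (- s n) e \<noteq> parent 0 (- s n) e'" using pin_next_inj[OF n] e unfolding pin_edge_def by blast
  then have "nx n c k \<noteq> nx n c k'"
    using pin_edge_next[OF n c e(1)] pin_edge_next[OF n c e(2)] unfolding pin_edge_def by (metis add_right_cancel)
  moreover have "nx n c k \<le> nx n c k'" unfolding nx_def using k by (intro zdiv_mono1) auto
  ultimately show ?thesis by simp
qed

text \<open>Distinct pinwheel edges have distinct parents, so the two edges remain consecutive at
  all levels and the vertex between them is always kept. The centre is always kept too, and
  \<open>common_vertex\<close> identifies the two.\<close>

lemma consecutive:
  assumes n: "n \<ge> N" and c: "c \<in> I" and e: "pin_edge n e c k" "pin_edge n e' c (k + 1)"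
  shows "e \<in> units \<and> e' \<in> units"
proof -
  define f where "f = rec_nat (e, e', k) (\<lambda>j (e, e', k). (parent 0 (- s (n + j)) e, parent 0 (- s (n + j)) e', nx (n + j) c k))"
  define a b l where "a j = fst (f j)" and "b j = fst (snd (f j))" and "l j = snd (snd (f j))" for j
  have f0: "a 0 = e" "b 0 = e'" "l 0 = k" by (simp_all add: f_def a_def b_def l_def)
  have fS: "a (Suc j) = parent 0 (- s (n + j)) (a j)" "b (Suc j) = parent 0 (- s (n + j)) (b j)" "l (Suc j) = nx (n + j) c (l j)" for j
    by (simp_all add: f_def a_def b_def l_def split_beta)
  have main: "pin_edge (n + j) (a j) c (l j) \<and> pin_edge (n + j) (b j) c (l j + 1)" for j
  proof (induction j)
    case 0
    then show ?case using e by (simp add: f0)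
  next
    case (Suc j)
    have nj: "n + j \<ge> N" using n by simp
    note E = pin_edge_next[OF nj c conjunct1[OF Suc.IH]] pin_edge_next[OF nj c conjunct2[OF Suc.IH]]
    have "nx (n + j) c (l j) < nx (n + j) c (l j + 1)"
      by (rule pin_edge_next_less[OF nj c conjunct1[OF Suc.IH] conjunct2[OF Suc.IH]]) simp
    then have "nx (n + j) c (l j + 1) = nx (n + j) c (l j) + 1" unfolding nx_def by (rule div2_jump)
    then show ?case using E by (simp add: fS)
  qed
  define y where "y m = X m c (l (m - n) + 1)" for m
  have ys: "surv (p m) (y m) \<and> y (Suc m) = dn (p m) (y m)" if mn: "m \<ge> n" for m
  proof -
    obtain j where m: "m = n + j" using le_Suc_ex[OF mn] by blast
    have nj: "n + j \<ge> N" using n by simp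
    have "nx (n + j) c (l j) < nx (n + j) c (l j + 1)"
      by (rule pin_edge_next_less[OF nj c conjunct1[OF main] conjunct2[OF main]]) simp
    then have lj: "l j + 1 = r m c + 2 * (nx m c (l j) + 1)"
      unfolding nx_def m[symmetric] by (rule div2_jump)
    define i where "i = nx m c (l j) + 1"
    have i: "l j + 1 = r m c + 2 * i" "nx m c (l j) + 1 = i" using lj by (simp_all add: i_def)
    have "surv (p m) (y m)"
      using plvl_surv[OF plvl[OF c] path[OF c] t, of m "l j + 1"] i(1) by (simp add: y_def m)
    moreover have "y (Suc m) = X (Suc m) c i"
      using i(2) by (simp add: y_def m fS Suc_diff_le)
    moreover have "X (Suc m) c i = dn (p m) (X m c (r m c + 2 * i))"
      by (simp add: X_Suc Der_def der_def)
    ultimately show ?thesis using i(1) by (simp add: y_def m)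
  qed
  have "x n = y n"
    by (rule common_vertex) (use pin n ys in auto)
  then have v: "x n = X n c (k + 1)" by (simp add: y_def f0)
  have "e = X n c k - X n c (k + 1)" "e' = X n c (k + 1 + 1) - X n c (k + 1)"
    using e by (auto simp: pin_edge_def mid_def v algebra_simps)
  then show ?thesis using pathD'[OF path[OF c], of n k] pathD[OF path[OF c], of n "k + 1"] by simp
qed

text \<open>While the two edges are not consecutive, their index distance drops from level to level,
  until \<open>consecutive\<close> applies. The conclusion comes back down because
  \<open>parent\<close> maps central edges to central ones and outer edges to outer ones.\<close>

lemma same_curve_units:
  assumes n: "n \<ge> N" and c: "c \<in> I" and e: "pin_edge n e c k" "pin_edge n e' c k'" and k: "k < k'"
  shows "e \<in> units \<and> e' \<in> units"
  using n e k
proof (induction "nat (k' - k)" arbitrary: n e e' k k' rule: less_induct)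
  case less
  show ?case
  proof (cases "k' = k + 1")
    case True
    then show ?thesis using consecutive[OF less.prems(1) c less.prems(2)] less.prems(3) by simp
  next
    case False
    have lt: "nx n c k < nx n c k'" by (rule pin_edge_next_less[OF less.prems(1) c less.prems(2-4)])
    have "nx n c k' - nx n c k < k' - k" unfolding nx_def using less.prems(4) False by (rule div2_contract)
    then have "nat (nx n c k' - nx n c k) < nat (k' - k)" using less.prems(4) by simp
    from less.hyps[OF this _ pin_edge_next[OF less.prems(1) c less.prems(2)]
        pin_edge_next[OF less.prems(1) c less.prems(3)] lt]
    have "parent 0 (- s n) e \<in> units \<and> parent 0 (- s n) e' \<in> units" using less.prems(1) by simp
    then show ?thesis using pin_next(3)[OF less.prems(1)] less.prems(2,3) unfolding pin_edge_def by blast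
  qed
qed

text \<open>Infinite descent: the three indices stay in strict order at the next level, while
  \<open>k3 - k1\<close> decreases.\<close>

lemma no_three:
  assumes n: "n \<ge> N" and c: "c \<in> I"
    and e: "pin_edge n e1 c k1" "pin_edge n e2 c k2" "pin_edge n e3 c k3" and k: "k1 < k2" "k2 < k3"
  shows False
  using n e k
proof (induction "nat (k3 - k1)" arbitrary: n e1 e2 e3 k1 k2 k3 rule: less_induct)
  case less
  have lt: "nx n c k1 < nx n c k2" "nx n c k2 < nx n c k3"
    using pin_edge_next_less[OF less.prems(1) c] less.prems by blast+
  have "nx n c k3 - nx n c k1 < k3 - k1"
    unfolding nx_def using less.prems(5,6) by (intro div2_contract) auto
  then have "nat (nx n c k3 - nx n c k1) < nat (k3 - k1)" using less.prems by simp
  from less.hyps[OF this _ pin_edge_next[OF less.prems(1) c less.prems(2)]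
      pin_edge_next[OF less.prems(1) c less.prems(3)] pin_edge_next[OF less.prems(1) c less.prems(4)] lt]
  show False using less.prems(1) by simp
qed

text \<open>The outer edges lie on four distinct curves, none of which owns a central edge. A curve
  owns at most two of the four central edges, so these account for at least two more curves.\<close>

lemma card_ge_6: "card I \<ge> 6"
proof -
  have ex: "\<exists>c k. c \<in> I \<and> pin_edge N e c k" if "e \<in> set (pinwheel (s N))" for e
  proof -
    have "edge_pt e" using that pin[of N] by (auto simp: pinwheel_def unit_list_def edge_pt_def)
    then have "edge_pt (e + x N + x N)" by (simp add: edge_pt_def)
    then show ?thesis using fam_surj[OF F, of "e + x N + x N" N] that unfolding pin_edge_def by blast
  qed
  then obtain own ind where own: "\<And>e. e \<in> set (pinwheel (s N)) \<Longrightarrow> own e \<in> I \<and> pin_edge N e (own e) (ind e)"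
    by metis
  have ind: "ind e \<noteq> ind e'" if "e \<in> set (pinwheel (s N))" "e' \<in> set (pinwheel (s N))" "own e = own e'" "e \<noteq> e'" for e e'
    using own[OF that(1)] own[OF that(2)] that(3,4) unfolding pin_edge_def by (metis add_right_cancel)
  have same: "e \<in> units \<and> e' \<in> units"
    if "e \<in> set (pinwheel (s N))" "e' \<in> set (pinwheel (s N))" "own e = own e'" "e \<noteq> e'" for e e'
    using ind[OF that] same_curve_units[of N "own e" e "ind e" e' "ind e'"]
      same_curve_units[of N "own e" e' "ind e'" e "ind e"] own[OF that(1)] own[OF that(2)] that(3)
    by (metis linorder_neq_iff order_refl)
  define Out where "Out = set (pinwheel (s N)) - units"
  have U: "units \<subseteq> set (pinwheel (s N))" by (auto simp: pinwheel_def)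
  have cOut: "card Out = 4"
  proof -
    define Q :: "pt set" where "Q = {(2, s N), (-1, s N * 2), (-2, - s N), (1, - (s N * 2))}"
    have sN: "s N = 1 \<or> s N = -1" using pin[of N] by simp
    have "Q \<inter> units = {}" using sN by (auto simp: Q_def units_def)
    moreover have "set (pinwheel (s N)) = units \<union> Q" by (auto simp: pinwheel_def Q_def)
    ultimately have "Out = Q" unfolding Out_def by blast
    then show ?thesis using sN unfolding Q_def by (elim disjE) simp_all
  qed
  have "inj_on own Out"
    using same by (auto simp: inj_on_def Out_def)
  then have c4: "card (own ` Out) = 4" using cOut by (simp add: card_image)
  have "own e \<noteq> own e'" if "e \<in> Out" "e' \<in> units" for e e'
    using same[of e e'] that U unfolding Out_def by blast
  then have disj: "own ` Out \<inter> own ` units = {}" by blast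
  have c2: "card (own ` units) \<ge> 2"
  proof (rule ccontr)
    assume "\<not> ?thesis"
    then have "card (own ` units) \<le> Suc 0" by simp
    then have "\<forall>a\<in>own ` units. \<forall>b\<in>own ` units. a = b"
      using card_le_Suc0_iff_eq[OF finite_imageI[OF finite_units, of own]] by blast
    then have eq: "own e = own e'" if "e \<in> units" "e' \<in> units" for e e' using that by blast
    define e1 e2 e3 :: pt where "e1 = (1,0)" and "e2 = (-1,0)" and "e3 = (0,1)"
    have e: "e1 \<in> units" "e2 \<in> units" "e3 \<in> units" "e1 \<noteq> e2" "e1 \<noteq> e3" "e2 \<noteq> e3"
      by (simp_all add: e1_def e2_def e3_def units_def)
    define c where "c = own e1"
    have oc: "own e1 = c" "own e2 = c" "own e3 = c" unfolding c_def using eq e by blast+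
    have ep: "e1 \<in> set (pinwheel (s N))" "e2 \<in> set (pinwheel (s N))" "e3 \<in> set (pinwheel (s N))"
      using U e by blast+
    have c: "c \<in> I" "pin_edge N e1 c (ind e1)" "pin_edge N e2 c (ind e2)" "pin_edge N e3 c (ind e3)"
      using own[OF ep(1)] own[OF ep(2)] own[OF ep(3)] unfolding oc by blast+
    have i: "ind e1 \<noteq> ind e2" "ind e1 \<noteq> ind e3" "ind e2 \<noteq> ind e3"
      using ind[OF ep(1,2)] ind[OF ep(1,3)] ind[OF ep(2,3)] oc e(4-6) by simp_all
    show False
      using no_three[OF order_refl c(1)] c i by (metis linorder_neq_iff)
  qed
  have "6 \<le> card (own ` Out \<union> own ` units)"
    using card_Un_disjoint[OF _ _ disj] c4 c2 by (simp add: Out_def units_def)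
  also have "\<dots> \<le> card I"
    using own U by (intro card_mono finite_I) (auto simp: Out_def)
  finally show ?thesis .
qed

end

lemma number_of_curves:
  assumes "I \<noteq> {}"
  shows "card I \<in> {1, 2, 3, 4} \<or> (card I = 6 \<and> (\<exists>N x. \<forall>n\<ge>N. surv (p n) (x n) \<and>
     x (Suc n) = dn (p n) (x n) \<and> t (Suc n) * eps (fst (x (Suc n))) = - (t n * eps (fst (x n)))))"
proof (cases "card I \<ge> 5")
  case True
  interpret shrinking p t "rep I" by (rule rep_shrinking[OF order_refl finite_I True])
  obtain N x s where pin: "\<And>n. n \<ge> N \<Longrightarrow> s n \<in> {1, -1} \<and> surv (p n) (x n) \<and>
     x (Suc n) = dn (p n) (x n) \<and> t n * eps (fst (x n)) = - s n \<and> s (Suc n) = - s n"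
    using eventually_pinwheel by blast
  have "card I = 6" using card_ge_6[OF pin] card_le_6[OF order_refl finite_I] by simp
  moreover have "surv (p n) (x n) \<and> x (Suc n) = dn (p n) (x n) \<and>
      t (Suc n) * eps (fst (x (Suc n))) = - (t n * eps (fst (x n)))" if "n \<ge> N" for n
    using pin[OF that] pin[of "Suc n"] that by simp
  ultimately show ?thesis by blast
next
  case False
  moreover have "card I \<noteq> 0" using assms finite_I by simp
  ultimately show ?thesis by auto
qed

end

section \<open>Curves through the centre\<close>

text \<open>\<open>lvl_ex\<close> is iterated by dependent choice; \<open>repeats\<close> is the
  invariant that guarantees a further level.\<close>

lemma hierarchy_ex:
  assumes F: "fam I X0" and c0: "c0 \<in> I" and rep: "repeats I X0 c0"
  shows "\<exists>X p t r. X 0 = X0 \<and> hierarchy I X p t r"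
proof -
  define P where "P Y \<longleftrightarrow> fam I Y \<and> repeats I Y c0" for Y
  have "\<exists>q. fst q \<in> {0, 1} \<and> lvl I (fst q) (fst (snd q)) (snd (snd q)) Y \<and> P (Der (fst q) (snd (snd q)) Y)"
    if Y: "P Y" for Y
  proof -
    obtain p t r where *: "p \<in> {0, 1}" "lvl I p t r Y" "repeats I (Der p r Y) c0"
      using lvl_ex[OF _ c0, of Y] Y unfolding P_def by blast
    then have "P (Der p r Y)" using fam_Der[OF _ *(2)] Y unfolding P_def by blast
    then show ?thesis using * by (intro exI[of _ "(p, t, r)"]) simp
  qed
  then obtain q where q: "\<And>Y. P Y \<Longrightarrow> fst (q Y) \<in> {0, 1} \<and>
      lvl I (fst (q Y)) (fst (snd (q Y))) (snd (snd (q Y))) Y \<and> P (Der (fst (q Y)) (snd (snd (q Y))) Y)"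
    by metis
  define X where "X = rec_nat X0 (\<lambda>_ Y. Der (fst (q Y)) (snd (snd (q Y))) Y)"
  have X: "X 0 = X0" "X (Suc n) = Der (fst (q (X n))) (snd (snd (q (X n)))) (X n)" for n
    by (simp_all add: X_def)
  have PX: "P (X n)" for n
  proof (induction n)
    case 0
    show ?case using F rep by (simp add: X(1) P_def)
  next
    case (Suc n)
    show ?case unfolding X(2) using q[OF Suc.IH] by blast
  qed
  have "hierarchy I X (\<lambda>n. fst (q (X n))) (\<lambda>n. fst (snd (q (X n)))) (\<lambda>n. snd (snd (q (X n))))"
  proof
    fix n
    show "fam I (X n)" using PX[of n] unfolding P_def by blast
    show "fst (q (X n)) \<in> {0, 1}" using q[OF PX] by blast
    show "lvl I (fst (q (X n))) (fst (snd (q (X n)))) (snd (snd (q (X n)))) (X n)" using q[OF PX] by blast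
    show "X (Suc n) = Der (fst (q (X n))) (snd (snd (q (X n)))) (X n)" by (rule X(2))
  qed
  then show ?thesis using X(1) by blast
qed

text \<open>The pinwheel is known only from level \<open>N\<close> on; \<open>up\<close> pulls its
  centre back to a vertex of the original covering.\<close>

lemma extend_down:
  fixes p :: "nat \<Rightarrow> int"
  assumes "\<And>n. n \<ge> N \<Longrightarrow> surv (p n) (x n) \<and> x (Suc n) = dn (p n) (x n)"
  shows "\<exists>\<xi>. (\<forall>n. surv (p n) (\<xi> n) \<and> \<xi> (Suc n) = dn (p n) (\<xi> n)) \<and> (\<forall>n\<ge>N. \<xi> n = x n)"
  using assms
proof (induction N arbitrary: x)
  case 0
  then show ?case by blast
next
  case (Suc N)
  define x' where "x' = x(N := up (p N) (x (Suc N)))"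
  have "surv (p n) (x' n) \<and> x' (Suc n) = dn (p n) (x' n)" if "n \<ge> N" for n
  proof (cases "n = N")
    case True
    then show ?thesis by (simp add: x'_def surv_up)
  next
    case False
    then have "n \<ge> Suc N" using that by simp
    then show ?thesis using Suc.prems[of n] by (simp add: x'_def)
  qed
  from Suc.IH[OF this] obtain \<xi> where
    \<xi>: "\<forall>n. surv (p n) (\<xi> n) \<and> \<xi> (Suc n) = dn (p n) (\<xi> n)" "\<forall>n\<ge>N. \<xi> n = x' n" by blast
  have "\<forall>n\<ge>Suc N. \<xi> n = x n" using \<xi>(2) by (simp add: x'_def)
  then show ?case using \<xi>(1) by blast
qed

context
  fixes p t r y a
  assumes lv: "plvl p t r y" and pa: "lattice_path y" and t: "t \<in> {1, -1}" and T: "turns y a"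
begin

lemma turn_eq: "y (k + 2) - y (k + 1) = sc (a k) (rot (y (k + 1) - y k))"
  using T by (simp add: turns_def)

lemma turn_pm: "a k \<in> {1, -1}"
  using T by (simp add: turns_def)

lemma turn_of_type:
  assumes "even (k - r)"
  shows "a k = (if snd (y (k + 1) - y k) = 0 then - (t * eps (fst (y (k + 1)))) else t * eps (fst (y (k + 1))))"
proof -
  define e where "e = y (k + 1) - y k"
  have e: "e \<in> units" unfolding e_def by (rule pathD[OF pa])
  have "odd (k + 1 - r)" using assms by simp
  from plvl_next[OF lv pa t this]
  have "y (k + 2) - y (k + 1) = sc (t * eps (fst (y (k + 1)))) (sw (- e))"
    by (simp add: e_def add.assoc)
  then have "sc (a k) (rot e) = sc (t * eps (fst (y (k + 1)))) (sw (- e))"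
    using turn_eq[of k] by (simp add: e_def)
  then show ?thesis unfolding e_def[symmetric] using e by (auto simp: units_def sc_def rot_def sw_def)
qed

text \<open>A converse to \<open>plvl_of_turns\<close>, for the same reason: between consecutive
  dying vertices the parity of the abscissa changes and the direction type does not.\<close>

lemma turn_alternates: "a (r + 2 * l) = a r * eps l"
proof -
  have "a (r + 2 * (l + 1)) = - a (r + 2 * l)" for l
  proof -
    define e where "e = y (r + 2*l + 1) - y (r + 2*l)"
    define \<tau> where "\<tau> = t * eps (fst (y (r + 2*l + 1)))"
    have e: "e \<in> units" unfolding e_def by (rule pathD[OF pa])
    have h1: "y (r + 2*l + 2) - y (r + 2*l + 1) = sc (a (r + 2*l)) (rot e)"
      using turn_eq[of "r + 2*l"] by (simp add: e_def)
    have h2: "y (r + 2*l + 3) - y (r + 2*l + 2) = sc (a (r + 2*l + 1)) (rot (sc (a (r + 2*l)) (rot e)))"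
      using turn_eq[of "r + 2*l + 1"] h1 by (simp add: add.assoc)
    have "fst (y (r + 2*l + 3)) = fst (y (r + 2*l + 1)) + fst (y (r + 2*l + 2) - y (r + 2*l + 1)) +
        fst (y (r + 2*l + 3) - y (r + 2*l + 2))" by simp
    then have "fst (y (r + 2*l + 3)) = fst (y (r + 2*l + 1)) + 1 \<or> fst (y (r + 2*l + 3)) = fst (y (r + 2*l + 1)) - 1"
      unfolding h1 h2 using e turn_pm[of "r + 2*l"] turn_pm[of "r + 2*l + 1"]
      by (auto simp: units_def sc_def rot_def)
    then have \<tau>': "t * eps (fst (y (r + 2*l + 3))) = - \<tau>" by (auto simp: \<tau>_def)
    have 1: "a (r + 2*l) = (if snd e = 0 then - \<tau> else \<tau>)"
      using turn_of_type[of "r + 2*l"] by (simp add: e_def \<tau>_def)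
    have i: "r + 2*(l + 1) = r + 2*l + 2" "r + 2*l + 2 + 1 = r + 2*l + 3" by simp_all
    have 2: "a (r + 2*(l + 1)) = (if snd (sc (a (r + 2*l + 1)) (rot (sc (a (r + 2*l)) (rot e)))) = 0 then \<tau> else - \<tau>)"
      unfolding i using turn_of_type[of "r + 2*l + 2"] unfolding i h2 \<tau>' by simp
    have "snd (sc (a (r + 2*l + 1)) (rot (sc (a (r + 2*l)) (rot e)))) = 0 \<longleftrightarrow> snd e = 0"
      using e turn_pm[of "r + 2*l"] turn_pm[of "r + 2*l + 1"] by (auto simp: sc_def rot_def)
    then show ?thesis using 1 2 by simp
  qed
  then have "a (r + 2 * (l + 1)) * eps (l + 1) = a (r + 2 * l) * eps l" for l by simp
  then have "a (r + 2 * l) * eps l = a (r + 2 * 0) * eps 0"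
    by (rule int_const[of "\<lambda>l. a (r + 2 * l) * eps l"])
  then have "a (r + 2 * l) * (eps l * eps l) = a r * eps l" by (simp add: eps_def split: if_splits)
  then show ?thesis by simp
qed

text \<open>A horizontal first step changes the parity of the abscissa, which undoes the sign change
  for horizontal steps in \<open>turn_of_type\<close>; a vertical step does neither. So the first
  turn after a kept vertex is the same in all four directions.\<close>

lemma first_turn:
  assumes "even (k - r)"
  shows "a k = t * eps (fst (y k))"
proof -
  define e where "e = y (k + 1) - y k"
  have e: "e \<in> units" unfolding e_def by (rule pathD[OF pa])
  have f: "fst (y (k + 1)) = fst (y k) + fst e" by (simp add: e_def)
  show ?thesis using turn_of_type[OF assms] e unfolding f e_def[symmetric] by (auto simp: units_def)
qed

end

lemma rot_pow_units: "u \<in> units \<Longrightarrow> (rot ^^ j) u \<in> units"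
proof (induction j)
  case (Suc j)
  have "rot w \<in> units" if "w \<in> units" for w using that by (auto simp: units_def rot_def)
  then show ?case using Suc by simp
qed simp

lemma cpt_rot_pow: "cpt ((rot ^^ j) v) = \<i> ^ j * cpt v"
proof (induction j)
  case (Suc j)
  have "cpt (rot w) = \<i> * cpt w" for w by (simp add: cpt_def rot_def complex_eq_iff)
  then show ?case using Suc.IH by simp
qed simp

lemma rot_add: "rot (v + w) = rot v + rot w"
  by (simp add: rot_def)

lemma rot_0: "rot 0 = 0"
  by (simp add: rot_def zero_prod_def)

lemma rot_pow_add: "(rot ^^ j) (v + w) = (rot ^^ j) v + (rot ^^ j) w"
  by (induction j) (simp_all add: rot_add)

lemma rot_pow_sc: "(rot ^^ j) (sc b (rot v)) = sc b (rot ((rot ^^ j) v))"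
  by (induction j) (simp_all add: rot_sc)

text \<open>Start, first step and turns determine a walk, and rotations commute with
  turning.\<close>

lemma half_walks:
  fixes f g :: "nat \<Rightarrow> pt"
  assumes f: "\<And>i. f (Suc (Suc i)) - f (Suc i) = sc (b i) (rot (f (Suc i) - f i))"
    and g: "\<And>i. g (Suc (Suc i)) - g (Suc i) = sc (b i) (rot (g (Suc i) - g i))"
    and g0: "g 0 = f 0" and 1: "g (Suc 0) - g 0 = (rot ^^ j) (f (Suc 0) - f 0)"
  shows "g (Suc i) - g i = (rot ^^ j) (f (Suc i) - f i)" and "g i - f 0 = (rot ^^ j) (f i - f 0)"
proof -
  show d: "g (Suc i) - g i = (rot ^^ j) (f (Suc i) - f i)" for i
    by (induction i) (simp_all only: 1 f g rot_pow_sc)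
  show "g i - f 0 = (rot ^^ j) (f i - f 0)"
  proof (induction i)
    case 0
    have "(rot ^^ j) 0 = 0" by (induction j) (simp_all add: rot_0)
    then show ?case using g0 by simp
  next
    case (Suc i)
    have "g (Suc i) - f 0 = (g i - f 0) + (g (Suc i) - g i)" by simp
    also have "\<dots> = (rot ^^ j) ((f i - f 0) + (f (Suc i) - f i))" unfolding Suc.IH d rot_pow_add ..
    finally show ?case by simp
  qed
qed

lemma power2_odd: "n > 0 \<Longrightarrow> \<exists>m l. n = 2 ^ m * (2 * l + 1)" for n :: nat
proof (induction n rule: less_induct)
  case (less n)
  show ?case
  proof (cases "even n")
    case True
    then obtain k where k: "n = 2 * k" by (rule evenE)
    then obtain m l where "k = 2 ^ m * (2 * l + 1)" using less.IH[of k] less.prems by auto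
    then have "n = 2 ^ Suc m * (2 * l + 1)" using k by simp
    then show ?thesis by blast
  next
    case False
    then obtain l where "n = 2 * l + 1" by (rule oddE)
    then have "n = 2 ^ 0 * (2 * l + 1)" by simp
    then show ?thesis by blast
  qed
qed

text \<open>\<open>S\<close> is antisymmetric about every \<open>2 ^ n\<close>: the numbers
  \<open>2 ^ n + j\<close> and \<open>2 ^ n - j\<close> contain the same power of 2, and the values
  of \<open>l\<close> in their odd parts \<open>2 * l + 1\<close> have opposite parity. So the
  second half of each prefix is \<open>bar\<close> of the first half.\<close>

lemma folding_formula:
  fixes S :: "nat \<Rightarrow> int"
  assumes S: "\<And>m l. S (2 ^ m * (2 * l + 1)) = \<tau> m * eps (int l)" and \<tau>: "\<And>m. \<tau> m \<in> {1, -1}"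
  shows "infty_folding S"
  unfolding infty_folding_def
proof
  have refl: "S (2 ^ n + j) = - S (2 ^ n - j)" if j: "0 < j" "j < 2 ^ n" for n j
  proof -
    obtain m l where ml: "j = 2 ^ m * (2 * l + 1)" using power2_odd[OF j(1)] by blast
    have "2 ^ m \<le> j" unfolding ml by simp
    then have "(2::nat) ^ m < 2 ^ n" using j(2) by linarith
    then have mn: "m < n" by simp
    define h where "h = (2::nat) ^ (n - m - 1)"
    have "n = m + Suc (n - m - 1)" using mn by simp
    then have n2: "(2::nat) ^ n = 2 ^ m * (2 * h)" unfolding h_def by (metis power_add power_Suc)
    have "2 * l + 1 < 2 * h" using j(2) unfolding ml n2 mult_less_cancel1 by (rule conjunct2)
    then have lh: "l < h" by simp
    have 1: "2 ^ n + j = 2 ^ m * (2 * (h + l) + 1)" unfolding n2 ml by (simp add: algebra_simps)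
    have "2 * h - (2 * l + 1) = 2 * (h - l - 1) + 1" using lh by simp
    then have 2: "2 ^ n - j = 2 ^ m * (2 * (h - l - 1) + 1)" unfolding n2 ml by (metis diff_mult_distrib2)
    have "int (h - l - 1) = int h - int l - 1" using lh by simp
    then have "eps (int (h + l)) = - eps (int (h - l - 1))" by (simp add: eps_def)
    then show ?thesis unfolding 1 2 S by simp
  qed
  fix n
  show "map S [1..<2 ^ n] \<in> folding_seqs n"
  proof (induction n)
    case (Suc n)
    define U where "U = map S [1..<2 ^ n]"
    have lU: "length U = 2 ^ n - 1" by (simp add: U_def)
    have "map S [2 ^ n + 1..<2 ^ Suc n] = bar U"
    proof (rule nth_equalityI)
      show l: "length (map S [2 ^ n + 1..<2 ^ Suc n]) = length (bar U)" by (simp add: lU)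
      fix i assume "i < length (map S [2 ^ n + 1..<2 ^ Suc n])"
      then have i: "i < 2 ^ n - 1" using l lU by simp
      have "map S [2 ^ n + 1..<2 ^ Suc n] ! i = S (2 ^ n + (i + 1))" using i by simp
      also have "\<dots> = - S (2 ^ n - (i + 1))" using i by (intro refl) auto
      also have "2 ^ n - (i + 1) = 1 + (2 ^ n - 1 - 1 - i)" using i by auto
      also have "S \<dots> = U ! (2 ^ n - 1 - 1 - i)" using i by (simp add: U_def)
      finally show "map S [2 ^ n + 1..<2 ^ Suc n] ! i = bar U ! i"
        using i lU by (simp add: bar_nth)
    qed
    moreover have "[1..<2 ^ Suc n] = [1..<2 ^ n] @ [2 ^ n] @ [2 ^ n + 1..<2 ^ Suc n]"
    proof -
      have "[1..<2 ^ Suc n] = [1..<2 ^ n] @ [2 ^ n..<2 ^ Suc n]"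
        using upt_add_eq_append[of 1 "2 ^ n" "2 ^ n"] by (simp add: mult_2)
      also have "[2 ^ n..<2 ^ Suc n] = [2 ^ n] @ [2 ^ n + 1..<2 ^ Suc n]"
        by (simp add: upt_conv_Cons)
      finally show ?thesis .
    qed
    ultimately have "map S [1..<2 ^ Suc n] = bar (bar U) @ [S (2 ^ n)] @ bar U"
      unfolding bar_bar by (simp only: map_append list.map U_def)
    moreover have "S (2 ^ n) \<in> {1, -1}" using S[of n 0] \<tau>[of n] by (simp add: eps_def)
    ultimately show ?case
      using folding_seqs_SucI[OF bar_folding[OF Suc.IH[folded U_def]]] by (simp only:)
  qed simp
qed

lemma derivative_pow: "(derivative ^^ m) S k = S (2 ^ m * k)"
  by (induction m arbitrary: k) (simp_all add: derivative_def mult.assoc mult.left_commute)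

lemma turn_reverse:
  assumes "turns y a"
  shows "y q - y (q + 1) = sc (- a q) (rot (y (q + 1) - y (q + 2)))"
proof -
  have a: "a q \<in> {1, -1}" and h: "y (q + 2) - y (q + 1) = sc (a q) (rot (y (q + 1) - y q))"
    using assms by (auto simp: turns_def)
  have "y (q + 1) - y (q + 2) = - sc (a q) (rot (y (q + 1) - y q))" unfolding h[symmetric] by simp
  then show ?thesis using a by (auto simp: sc_def rot_def prod_eq_iff)
qed

context hierarchy
begin

context
  fixes \<xi> :: "nat \<Rightarrow> pt"
  assumes \<xi>: "\<And>n. surv (p n) (\<xi> n) \<and> \<xi> (Suc n) = dn (p n) (\<xi> n)"
begin

text \<open>Each derivation removes the alternating turns and halves the remaining distances from
  the centre, so the sign at level \<open>n + m\<close> governs the distances with exactly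
  \<open>m\<close> factors 2. The offset \<open>- 1\<close> occurs because the turn
  \<open>a i\<close> takes place at vertex \<open>i + 1\<close>; negative \<open>l\<close> describes
  the half that arrives at the centre.\<close>

lemma turns_at_centre:
  assumes c: "c \<in> I" and T: "turns (X n c) a" and k: "X n c k = \<xi> n"
  shows "a (k - 1 + 2 ^ m * (2 * l + 1)) = t (n + m) * eps (fst (\<xi> (n + m))) * eps l"
  using T k
proof (induction m arbitrary: n a k)
  case 0
  have ev: "even (k - r n c)"
    using plvl_surv[OF plvl[OF c] path[OF c] t, of n k] \<xi>[of n] 0(2) by simp
  then obtain k' where k': "k = r n c + 2 * k'" by (metis dvdE diff_add_cancel add.commute)
  note alt = turn_alternates[OF plvl[OF c] path[OF c] t 0(1)]
  have "k - 1 + 2 ^ 0 * (2 * l + 1) = r n c + 2 * (k' + l)" by (simp add: k')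
  then have "a (k - 1 + 2 ^ 0 * (2 * l + 1)) = a (r n c) * eps k' * eps l"
    by (simp only: alt eps_add mult.assoc)
  also have "a (r n c) * eps k' = a k" unfolding k' by (rule alt[symmetric])
  also have "a k = t n * eps (fst (\<xi> n))"
    using first_turn[OF plvl[OF c] path[OF c] t 0(1) ev] 0(2) by simp
  finally show ?case by simp
next
  case (Suc m)
  have ev: "even (k - r n c)"
    using plvl_surv[OF plvl[OF c] path[OF c] t, of n k] \<xi>[of n] Suc.prems(2) by simp
  then obtain k' where k': "k = r n c + 2 * k'" by (metis dvdE diff_add_cancel add.commute)
  note alt = turn_alternates[OF plvl[OF c] path[OF c] t Suc.prems(1)]
  have T': "turns (X (Suc n) c) (\<lambda>j. a (r n c + 1 + 2*j))"
    unfolding X_Suc Der_def by (rule turns_der[OF plvl[OF c] path[OF c] t Suc.prems(1) alt])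
  have "X (Suc n) c k' = \<xi> (Suc n)"
    using \<xi>[of n] Suc.prems(2) unfolding X_Suc Der_def der_def k' by simp
  from Suc.IH[OF T' this]
  have "a (r n c + 1 + 2 * (k' - 1 + 2 ^ m * (2 * l + 1))) = t (n + Suc m) * eps (fst (\<xi> (n + Suc m))) * eps l"
    by simp
  moreover have "r n c + 1 + 2 * (k' - 1 + 2 ^ m * (2 * l + 1)) = k - 1 + 2 ^ Suc m * (2 * l + 1)"
    by (simp add: k')
  ultimately show ?case by metis
qed

end

end

text \<open>The turns counted from the centre depend on the levels only and not on the curve. Hence
  the four half curves at the centre, reversed if they arrive there, are rotated copies of one
  another by \<open>half_walks\<close>.\<close>

lemma generated:
  assumes cov: "covering \<C>" and H: "hierarchy \<C> X p t r" and X0: "X 0 = pos"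
    and \<xi>: "\<And>n. surv (p n) (\<xi> n) \<and> \<xi> (Suc n) = dn (p n) (\<xi> n)"
  shows "\<exists>S D. (\<forall>m l. S (2 ^ m * (2 * l + 1)) = t m * eps (fst (\<xi> m)) * eps (int l)) \<and>
    infty_curve_of S D \<and> generated_by \<C> D"
proof -
  interpret hierarchy \<C> X p t r by (rule H)
  note F0 = covering_fam[OF cov] and seg = curve_seg[OF cov] and pth = curve_path[OF cov]
  define \<tau> where "\<tau> m = t m * eps (fst (\<xi> m))" for m
  have centre: "a (k - 1 + 2 ^ m * (2 * l + 1)) = \<tau> m * eps l"
    if "c \<in> \<C>" "associated_curve UNIV a c" "pos c k = \<xi> 0" for c a k m l
    using turns_at_centre[of \<xi> c 0 a k m l] \<xi> that associated_UNIV(3)[OF that(2)] X0 by (simp add: \<tau>_def)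
  have at_centre: "\<exists>c\<in>\<C>. \<exists>k. pos c k = \<xi> 0 \<and> (pos c (k + 1) = \<xi> 0 + w \<or> pos c (k - 1) = \<xi> 0 + w)"
    if w: "w \<in> units" for w
  proof -
    have "edge_pt (\<xi> 0 + \<xi> 0 + w)" using unit_parity[OF w] by (auto simp: edge_pt_def)
    then obtain c k where c: "c \<in> \<C>" and k: "mid (pos c) k = \<xi> 0 + \<xi> 0 + w" using fam_surj[OF F0] by blast
    have "pos c k + pos c k + (pos c (k + 1) - pos c k) = \<xi> 0 + \<xi> 0 + w" using k by (simp add: mid_def)
    from mid_ends[OF pathD[OF pth[OF c]] w this]
    have "pos c k = \<xi> 0 \<and> pos c (k + 1) = \<xi> 0 + w \<or> pos c (k + 1) = \<xi> 0 \<and> pos c (k + 1 - 1) = \<xi> 0 + w"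
      by (auto simp: prod_eq_iff)
    then show ?thesis using c by blast
  qed
  have "(1, 0) \<in> units" by (simp add: units_def)
  from at_centre[OF this] obtain c k0 where c: "c \<in> \<C>" and k0: "pos c k0 = \<xi> 0" by blast
  obtain a where a: "associated_curve UNIV a c" using curve_assoc[OF cov c] by blast
  define S where "S j = a (k0 - 1 + int j)" for j
  have S: "S (2 ^ m * (2 * l + 1)) = \<tau> m * eps (int l)" for m l
    using centre[OF c a k0, of m "int l"] by (simp add: S_def algebra_simps)
  define D :: curve where "D i = (if i \<ge> 1 then c (k0 + i - 1) else None)" for i
  define f where "f i = pos c (k0 + int i)" for i
  have Dseg: "D i = Some (cpt (f (nat i - 1)), cpt (f (nat i) - f (nat i - 1)))" if "i \<ge> 1" for i
  proof -
    have "k0 + int (nat i - 1) = k0 + i - 1" "k0 + int (nat i) = k0 + i - 1 + 1" using that by simp_all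
    then show ?thesis using that seg[OF c, of "k0 + i - 1"] by (simp only: D_def f_def if_True)
  qed
  have inf: "infty_curve_of S D" unfolding infty_curve_of_def associated_curve_def
  proof (intro conjI allI impI)
    show "dom D = {1..}" using seg[OF c] by (auto simp: D_def split: if_splits)
    fix k x e
    have D: "D k = Some s \<Longrightarrow> c (k0 + k - 1) = Some s \<and> k \<ge> 1" for k s
      by (simp add: D_def split: if_splits)
    { assume "D k = Some (x, e)"
      then have "c (k0 + k - 1) = Some (x, e)" using D by blast
      then show "x \<in> lattice" "e \<in> {1, -1, \<i>, -\<i>}" using a unfolding associated_curve_def by blast+ }
    { fix x' e'
      assume DD: "D k = Some (x, e) \<and> D (k + 1) = Some (x', e')"
      have "k0 + (k + 1) - 1 = k0 + k - 1 + 1" by simp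
      then have "c (k0 + k - 1) = Some (x, e) \<and> c (k0 + k - 1 + 1) = Some (x', e')"
        using D[of k] D[of "k + 1"] DD by metis
      then have *: "a (k0 + k - 1) \<in> {1, -1} \<and> x + e = x' \<and> e' = \<i> powi a (k0 + k - 1) * e"
        using a unfolding associated_curve_def by blast
      have "k \<ge> 1" using D DD by blast
      then have "S (nat k) = a (k0 + k - 1)" by (simp add: S_def algebra_simps)
      then show "S (nat k) \<in> {1, -1}" "x + e = x'" "e' = \<i> powi S (nat k) * e" using * by simp_all }
  qed
  have f_step: "f (Suc (Suc i)) - f (Suc i) = sc (S (Suc i)) (rot (f (Suc i) - f i))" for i
  proof -
    have "pos c (k0 + int i + 2) - pos c (k0 + int i + 1) = sc (a (k0 + int i)) (rot (pos c (k0 + int i + 1) - pos c (k0 + int i)))"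
      using associated_UNIV(3)[OF a] by (simp add: turns_def)
    then show ?thesis by (simp add: f_def S_def algebra_simps)
  qed
  have f0: "f 0 = \<xi> 0" by (simp add: f_def k0)
  have u: "f (Suc 0) - f 0 \<in> units" using pathD[OF pth[OF c], of k0] by (simp add: f_def add.commute)
  have "generated_by \<C> D" unfolding generated_by_def
  proof (intro exI conjI allI impI)
    show "D 1 = Some (cpt (f 0), cpt (f 1 - f 0))" using Dseg[of 1] by simp
    fix j :: nat
    define R where "R = rotate_curve j (cpt (f 0)) D"
    define w where "w = (rot ^^ j) (f (Suc 0) - f 0)"
    have w: "w \<in> units" unfolding w_def by (rule rot_pow_units[OF u])
    have Rdom: "R i = None" if "\<not> i \<ge> 1" for i using that by (simp add: R_def rotate_curve_def D_def)
    obtain c' k where c': "c' \<in> \<C>" and k: "pos c' k = \<xi> 0"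
      and dir: "pos c' (k + 1) = \<xi> 0 + w \<or> pos c' (k - 1) = \<xi> 0 + w" using at_centre[OF w] by blast
    obtain a' where a': "associated_curve UNIV a' c'" using curve_assoc[OF cov c'] by blast
    note T' = associated_UNIV(3)[OF a']
    have walk: "R i = Some (cpt (g (nat i - 1)), cpt (g (nat i) - g (nat i - 1)))"
      if g: "\<And>i. g (Suc (Suc i)) - g (Suc i) = sc (S (Suc i)) (rot (g (Suc i) - g i))"
        and g0: "g 0 = f 0" and g1: "g (Suc 0) = \<xi> 0 + w" and i: "i \<ge> 1" for g :: "nat \<Rightarrow> pt" and i
    proof -
      have g1': "g (Suc 0) - g 0 = (rot ^^ j) (f (Suc 0) - f 0)" by (simp add: g1 g0 f0 w_def)
      note hw = half_walks[where b = "\<lambda>i. S (Suc i)", OF f_step g g0 g1']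
      have "Suc (nat i - 1) = nat i" using i by simp
      then have d: "g (nat i) - g (nat i - 1) = (rot ^^ j) (f (nat i) - f (nat i - 1))"
        using hw(1)[of "nat i - 1"] by simp
      have "cpt (g (nat i - 1)) = cpt (f 0) + cpt (g (nat i - 1) - f 0)" by (simp add: cpt_diff)
      also have "\<dots> = cpt (f 0) + \<i> ^ j * (cpt (f (nat i - 1)) - cpt (f 0))"
        unfolding hw(2) cpt_rot_pow cpt_diff ..
      finally show ?thesis
        using Dseg[OF i] unfolding d cpt_rot_pow by (simp add: R_def rotate_curve_def)
    qed
    show "\<exists>c\<in>\<C>. subcurve (rotate_curve j (cpt (f 0)) D) c \<or> subcurve (reverse_curve (rotate_curve j (cpt (f 0)) D)) c"
      using dir
    proof
      assume out: "pos c' (k + 1) = \<xi> 0 + w"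
      define g where "g i = pos c' (k + int i)" for i
      have "g (Suc (Suc i)) - g (Suc i) = sc (S (Suc i)) (rot (g (Suc i) - g i))" for i
      proof -
        have "Suc i > 0" by simp
        then obtain m l where ml: "Suc i = 2 ^ m * (2 * l + 1)" using power2_odd by blast
        then have iml: "int i + 1 = 2 ^ m * (2 * int l + 1)" by (metis int_ops(2) int_ops(5) int_ops(7) of_nat_Suc of_nat_numeral of_nat_power add.commute)
        have "k + int i = k - 1 + 2 ^ m * (2 * int l + 1)" unfolding iml[symmetric] by simp
        then have "a' (k + int i) = S (Suc i)" unfolding ml S by (simp only: centre[OF c' a' k])
        moreover have "pos c' (k + int i + 2) - pos c' (k + int i + 1) = sc (a' (k + int i)) (rot (pos c' (k + int i + 1) - pos c' (k + int i)))"
          using T' by (simp add: turns_def)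
        ultimately show ?thesis by (simp add: g_def algebra_simps)
      qed
      from walk[OF this] have Rg: "R i = Some (cpt (g (nat i - 1)), cpt (g (nat i) - g (nat i - 1)))" if "i \<ge> 1" for i
        using that out by (simp add: g_def f0 k)
      have "R \<subseteq>\<^sub>m shift (k - 1) c'" unfolding map_le_def
      proof
        fix i assume "i \<in> dom R"
        then have i: "i \<ge> 1" using Rdom by (metis domIff)
        have "k + int (nat i - 1) = i + (k - 1)" "k + int (nat i) = i + (k - 1) + 1" using i by simp_all
        then show "R i = shift (k - 1) c' i"
          using Rg[OF i] seg[OF c', of "i + (k - 1)"] by (simp only: g_def shift_def)
      qed
      then show ?thesis using c' unfolding subcurve_def R_def by blast
    next
      assume inc: "pos c' (k - 1) = \<xi> 0 + w"
      define g where "g i = pos c' (k - int i)" for i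
      have "g (Suc (Suc i)) - g (Suc i) = sc (S (Suc i)) (rot (g (Suc i) - g i))" for i
      proof -
        have "Suc i > 0" by simp
        then obtain m l where ml: "Suc i = 2 ^ m * (2 * l + 1)" using power2_odd by blast
        then have iml: "int i + 1 = 2 ^ m * (2 * int l + 1)" by (metis int_ops(2) int_ops(5) int_ops(7) of_nat_Suc of_nat_numeral of_nat_power add.commute)
        \<comment> \<open>Backwards from the centre \<open>l\<close> becomes \<open>- l - 1\<close>,
          which changes the sign of \<open>eps\<close>; reversing the direction changes it
          back.\<close>
        have "k - int i - 2 = k - 1 - (int i + 1)" by simp
        also have "\<dots> = k - 1 + 2 ^ m * (2 * (- int l - 1) + 1)" unfolding iml by (simp add: algebra_simps)
        finally have "a' (k - int i - 2) = \<tau> m * eps (- int l - 1)" by (simp only: centre[OF c' a' k])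
        moreover have "eps (- int l - 1) = - eps (int l)" by (simp add: eps_def)
        ultimately have "- a' (k - int i - 2) = S (Suc i)" unfolding ml S by simp
        moreover have "pos c' (k - int i - 2) - pos c' (k - int i - 2 + 1) =
            sc (- a' (k - int i - 2)) (rot (pos c' (k - int i - 2 + 1) - pos c' (k - int i - 2 + 2)))"
          by (rule turn_reverse[OF T'])
        moreover have "k - int i - 2 = k - int (Suc (Suc i))" "k - int (Suc (Suc i)) + 1 = k - int (Suc i)"
          "k - int (Suc (Suc i)) + 2 = k - int i" by simp_all
        ultimately show ?thesis by (simp only: g_def)
      qed
      from walk[OF this] have Rg: "R i = Some (cpt (g (nat i - 1)), cpt (g (nat i) - g (nat i - 1)))" if "i \<ge> 1" for i
        using that inc by (simp add: g_def f0 k)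
      have "reverse_curve R \<subseteq>\<^sub>m shift k c'" unfolding map_le_def
      proof
        fix i assume "i \<in> dom (reverse_curve R)"
        then have i: "- i \<ge> 1" using Rdom[of "- i"] by (cases "- i \<ge> 1") (auto simp: reverse_curve_def)
        have "reverse_curve R i = Some (cpt (g (nat (- i))), cpt (g (nat (- i) - 1) - g (nat (- i))))"
          using Rg[OF i] by (simp add: reverse_curve_def cpt_diff)
        moreover have "k - int (nat (- i)) = i + k" "k - int (nat (- i) - 1) = i + k + 1" using i by simp_all
        ultimately show "reverse_curve R i = shift k c' i"
          using seg[OF c', of "i + k"] by (simp only: g_def shift_def)
      qed
      then show ?thesis using c' unfolding subcurve_def R_def by blast
    qed
  qed
  then show ?thesis using S inf unfolding \<tau>_def by blast
qed

theorem theorem6: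
  fixes \<C> :: "curve set"
  assumes "covering \<C>"
    and "\<forall>c\<in>\<C>. complete_folding_curve c"
    and "local_isomorphism \<C>"
  shows "card \<C> \<in> {1, 2, 3, 4} \<or>
    (card \<C> = 6 \<and>
     (\<exists>A S D. alternating_folding A \<and> (S = A \<or> primitive_of S A) \<and>
        infty_curve_of S D \<and> generated_by \<C> D))"
proof -
  obtain c0 where c0: "c0 \<in> \<C>" using covering_nonempty[OF assms(1)] by blast
  then obtain a where "complete_folding a" "associated_curve UNIV a c0"
    using assms(2) unfolding complete_folding_curve_def by blast
  then have "repeats \<C> pos c0" by (rule covering_repeats[OF assms(1,3) c0])
  from hierarchy_ex[OF covering_fam[OF assms(1)] c0 this]
  obtain X p t r where X0: "X 0 = pos" and H: "hierarchy \<C> X p t r" by blast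
  interpret hierarchy \<C> X p t r by (rule H)
  have "\<C> \<noteq> {}" using c0 by blast
  from number_of_curves[OF this] show ?thesis
  proof
    assume "card \<C> = 6 \<and> (\<exists>N x. \<forall>n\<ge>N. surv (p n) (x n) \<and>
     x (Suc n) = dn (p n) (x n) \<and> t (Suc n) * eps (fst (x (Suc n))) = - (t n * eps (fst (x n))))"
    then obtain N x where six: "card \<C> = 6" and x: "\<And>n. n \<ge> N \<Longrightarrow> surv (p n) (x n) \<and> x (Suc n) = dn (p n) (x n)"
      and alt: "\<And>n. n \<ge> N \<Longrightarrow> t (Suc n) * eps (fst (x (Suc n))) = - (t n * eps (fst (x n)))" by blast
    obtain \<xi> where \<xi>: "\<And>n. surv (p n) (\<xi> n) \<and> \<xi> (Suc n) = dn (p n) (\<xi> n)" "\<And>n. n \<ge> N \<Longrightarrow> \<xi> n = x n"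
      using extend_down[of N p x, OF x] by blast
    define \<tau> where "\<tau> m = t m * eps (fst (\<xi> m))" for m
    have \<tau>: "\<tau> m \<in> {1, -1}" for m unfolding \<tau>_def by (rule tau_pm[OF t])
    have \<tau>_alt: "\<tau> (Suc n) = - \<tau> n" if "n \<ge> N" for n
      using alt[OF that] \<xi>(2)[of n] \<xi>(2)[of "Suc n"] that by (simp add: \<tau>_def)
    obtain S D where S: "\<And>m l. S (2 ^ m * (2 * l + 1)) = \<tau> m * eps (int l)"
      and D: "infty_curve_of S D" "generated_by \<C> D"
      using generated[OF assms(1) H X0 \<xi>(1)] unfolding \<tau>_def by blast
    \<comment> \<open>\<open>M \<ge> 1\<close> because a primitive takes at least one derivative;
      \<open>\<tau> M = 1\<close> because the alternating sequence starts with 1.\<close>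
    obtain M where M: "M \<ge> N" "M \<ge> 1" "\<tau> M = 1"
    proof (cases "\<tau> (Suc N) = 1")
      case True
      then show ?thesis using that[of "Suc N"] by simp
    next
      case False
      then have "\<tau> (Suc (Suc N)) = 1" using \<tau>[of "Suc N"] \<tau>_alt[of "Suc N"] by simp
      then show ?thesis using that[of "Suc (Suc N)"] by simp
    qed
    define A where "A = (derivative ^^ M) S"
    have A: "A (2 ^ m * (2 * l + 1)) = \<tau> (M + m) * eps (int l)" for m l
      using S[of "M + m" l] by (simp only: A_def derivative_pow power_add mult.assoc)
    have "\<tau> (M + n) = (-1) ^ n" for n
    proof (induction n)
      case (Suc n)
      then show ?case using \<tau>_alt[of "M + n"] M(1) by simp
    qed (use M in simp)
    then have "A (2 ^ n) = (-1) ^ n" for n using A[of n 0] by (simp add: eps_def)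
    moreover have "infty_folding A" by (rule folding_formula[OF A]) (rule \<tau>)
    ultimately have "alternating_folding A" unfolding alternating_folding_def by blast
    moreover have "primitive_of S A"
      unfolding primitive_of_def A_def using folding_formula[OF S \<tau>] M(2) by blast
    ultimately show ?thesis using six D by blast
  qed blast
qed

end
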